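(* Let $\mu,\nu\in\mathcal{S}'(\mathbb{R}^d)$. If $\Pi_2\operatorname{supp}W_T(\mu,\nu)$ is a uniformly discrete set and $T$ is an invertible $2d\times 2d$ matrix satisfying $$T^{-1}=\begin{pmatrix}A&B\\C&D\end{pmatrix}$$ with $A,B,C,D$ matrices of size $d\times d$, then $$\det A\neq 0\ \Longrightarrow\ \operatorname{supp}\widehat{\nu}\text{ is uniformly discrete},$$ $$\det B\neq 0\ \Longrightarrow\ \operatorname{supp}\widehat{\mu}\text{ is uniformly discrete}.$$
   Context: A set $E\subset\mathbb{R}^d$ is uniformly discrete if there is $\delta>0$ such that $|r-s|\ge\delta$ for all $r,s\in E$ with $r\ne s$. For $E\subset\mathbb{R}^{2d}=\mathbb{R}^d_x\times\mathbb{R}^d_\omega$, $\Pi_2(E)=\{\omega:\exists\,x,\ (x,\omega)\in E\}$. The Fourier transform is $\widehat f(\omega)=\int_{\mathbb{R}^d}f(t)e^{-2\pi i\omega t}\,dt$, extended to $\mathcal{S}'(\mathbb{R}^d)$. For an invertible linear map $T:\mathbb{R}^{2d}\to\mathbb{R}^{2d}$ the same letter denotes the matrix of the map and the change of coordinate operator $TF=F\circ T$, extended to $\mathcal{S}'(\mathbb{R}^{2d})$ in the natural way (pull-back). $\mathcal{F}_2$ is the partial Fourier transform $\mathcal{F}_2F(x,\omega)=\int_{\mathbb{R}^d}F(x,t)e^{-2\pi i\omega t}\,dt$, extended to $\mathcal{S}'(\mathbb{R}^{2d})$. The matrix-Wigner transform of $\mu,\nu\in\mathcal{S}'(\mathbb{R}^d)$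 is $W_T(\mu,\nu)=\mathcal{F}_2\left(T(\mu\otimes\overline{\nu})\right)\in\mathcal{S}'(\mathbb{R}^{2d})$, where $\overline{\nu}$ is the complex conjugate distribution.
   Formalization: The first implication is proved for μ ≠ 0 and the second for ν ≠ 0; without this the claim fails, e.g. μ = 0, ν = δ₀, T = I, where W_T(μ,ν) = 0 has empty support but supp of the Fourier transform of ν is all of R^d. *)

theory Defs
  imports "HOL-Analysis.Analysis"
begin

section \<open>Schwartz functions and tempered distributions\<close>

text \<open>Iterated partial derivative: a multi-index is given as a list of basis vectors.\<close>

fun partial_deriv :: "'a::euclidean_space list \<Rightarrow> ('a \<Rightarrow> complex) \<Rightarrow> 'a \<Rightarrow> complex" where
  "partial_deriv [] f = f"
| "partial_deriv (v # vs) f = (\<lambda>x. frechet_derivative (partial_deriv vs f) (at x) v)"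

definition smooth :: "('a::euclidean_space \<Rightarrow> complex) \<Rightarrow> bool" where
  "smooth f \<longleftrightarrow> (\<forall>vs. set vs \<subseteq> Basis \<longrightarrow> partial_deriv vs f differentiable_on UNIV)"

definition schwartz :: "('a::euclidean_space \<Rightarrow> complex) \<Rightarrow> bool" where
  "schwartz f \<longleftrightarrow> smooth f \<and>
     (\<forall>k vs. set vs \<subseteq> Basis \<longrightarrow> (\<exists>C. \<forall>x. norm x ^ k * norm (partial_deriv vs f x) \<le> C))"

definition schwartz_seminorm :: "nat \<Rightarrow> 'a::euclidean_space list \<Rightarrow> ('a \<Rightarrow> complex) \<Rightarrow> real" where
  "schwartz_seminorm k vs f = (SUP x. norm x ^ k * norm (partial_deriv vs f x))"

text \<open>Distributions are functionals on all functions, but only their values on Schwartz functions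
  are meaningful; all notions below depend on those values only.
  The last clause is continuity for the topology given by the Schwartz seminorms.\<close>

type_synonym 'a functional = "('a \<Rightarrow> complex) \<Rightarrow> complex"

definition tempered_distribution :: "'a::euclidean_space functional \<Rightarrow> bool" where
  "tempered_distribution u \<longleftrightarrow>
     (\<forall>f g. schwartz f \<longrightarrow> schwartz g \<longrightarrow> u (\<lambda>x. f x + g x) = u f + u g) \<and>
     (\<forall>c f. schwartz f \<longrightarrow> u (\<lambda>x. c * f x) = c * u f) \<and>
     (\<exists>C N. \<forall>f. schwartz f \<longrightarrow>
        norm (u f) \<le> C * (\<Sum>vs\<in>{vs. set vs \<subseteq> Basis \<and> length vs \<le> N}. \<Sum>k\<le>N. schwartz_seminorm k vs f))"

definition zero_distribution :: "'a::euclidean_space functional \<Rightarrow> bool" where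
  "zero_distribution u \<longleftrightarrow> (\<forall>f. schwartz f \<longrightarrow> u f = 0)"

definition test_function_on :: "'a::euclidean_space set \<Rightarrow> ('a \<Rightarrow> complex) \<Rightarrow> bool" where
  "test_function_on U f \<longleftrightarrow>
     smooth f \<and> compact (closure {x. f x \<noteq> 0}) \<and> closure {x. f x \<noteq> 0} \<subseteq> U"

definition dist_supp :: "'a::euclidean_space functional \<Rightarrow> 'a set" where
  "dist_supp u = - \<Union>{U. open U \<and> (\<forall>f. test_function_on U f \<longrightarrow> u f = 0)}"

text \<open>The conjugate is fixed by requiring that it extends pointwise conjugation of functions under
  the bilinear pairing of \<open>g\<close> with \<open>f\<close>, the integral of \<open>g x * f x\<close>.\<close>

definition cnj_distribution :: "'a::euclidean_space functional \<Rightarrow> 'a functional" where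
  "cnj_distribution u = (\<lambda>f. cnj (u (\<lambda>x. cnj (f x))))"

definition fourier :: "('a::euclidean_space \<Rightarrow> complex) \<Rightarrow> 'a \<Rightarrow> complex" where
  "fourier f \<omega> = (LINT t|lborel. f t * cis (- 2 * pi * (\<omega> \<bullet> t)))"

definition fourier_distribution :: "'a::euclidean_space functional \<Rightarrow> 'a functional" where
  "fourier_distribution u = (\<lambda>f. u (fourier f))"

section \<open>The product of two copies of the space\<close>

text \<open>The space of dimension \<open>2d\<close> is \<open>real^('d+'d)\<close>; the left summand of the index type carries
  the \<open>x\<close> coordinates and the right one the \<open>\<omega>\<close> (or \<open>t\<close>) coordinates.\<close>

definition join :: "real^'d \<Rightarrow> real^'d \<Rightarrow> real^('d::finite + 'd)" where
  "join x y = (\<chi> i. case i of Inl k \<Rightarrow> x $ k | Inr k \<Rightarrow> y $ k)"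

definition part1 :: "real^('d::finite + 'd) \<Rightarrow> real^'d" where
  "part1 z = (\<chi> k. z $ Inl k)"

definition part2 :: "real^('d::finite + 'd) \<Rightarrow> real^'d" where
  "part2 z = (\<chi> k. z $ Inr k)"

definition block_matrix ::
  "real^'d^'d \<Rightarrow> real^'d^'d \<Rightarrow> real^'d^'d \<Rightarrow> real^'d^'d \<Rightarrow> real^('d::finite + 'd)^('d + 'd)" where
  "block_matrix A B C D =
     (\<chi> i j. case i of
        Inl k \<Rightarrow> (case j of Inl l \<Rightarrow> A $ k $ l | Inr l \<Rightarrow> B $ k $ l)
      | Inr k \<Rightarrow> (case j of Inl l \<Rightarrow> C $ k $ l | Inr l \<Rightarrow> D $ k $ l))"

lemma part1_join [simp]: "part1 (join x y) = x"
  and part2_join [simp]: "part2 (join x y) = y"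
  and join_parts [simp]: "join (part1 z) (part2 z) = z"
  by (auto simp: part1_def part2_def join_def vec_eq_iff split: sum.splits)

lemma block_matrix_mult_join:
  "block_matrix A B C D *v join x y = join (A *v x + B *v y) (C *v x + D *v y)"
proof -
  have "(block_matrix A B C D *v join x y) $ i = join (A *v x + B *v y) (C *v x + D *v y) $ i" for i
    by (cases i) (simp_all add: block_matrix_def join_def matrix_vector_mult_def
        sum.Plus flip: UNIV_Plus_UNIV)
  then show ?thesis
    by (simp add: vec_eq_iff)
qed

definition proj2 :: "(real^('d::finite + 'd)) set \<Rightarrow> (real^'d) set" where
  "proj2 E = {\<omega>. \<exists>x. join x \<omega> \<in> E}"

section \<open>The matrix-Wigner transform\<close>

definition tensor_distribution ::
  "(real^'d) functional \<Rightarrow> (real^'d) functional \<Rightarrow> (real^('d::finite + 'd)) functional" where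
  "tensor_distribution u v = (\<lambda>\<phi>. u (\<lambda>x. v (\<lambda>y. \<phi> (join x y))))"

text \<open>The pull-back extends \<open>F \<mapsto> F \<circ> T\<close>, by the change of variables formula.\<close>

definition pullback_distribution :: "real^'n^'n \<Rightarrow> (real^'n::finite) functional \<Rightarrow> (real^'n) functional" where
  "pullback_distribution T u = (\<lambda>\<phi>. u (\<lambda>z. \<phi> (matrix_inv T *v z)) / complex_of_real \<bar>det T\<bar>)"

definition fourier2 :: "(real^('d::finite + 'd) \<Rightarrow> complex) \<Rightarrow> real^('d + 'd) \<Rightarrow> complex" where
  "fourier2 F z = fourier (\<lambda>t. F (join (part1 z) t)) (part2 z)"

definition fourier2_distribution ::
  "(real^('d::finite + 'd)) functional \<Rightarrow> (real^('d + 'd)) functional" where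
  "fourier2_distribution u = (\<lambda>\<phi>. u (fourier2 \<phi>))"

definition matrix_wigner ::
  "real^('d::finite + 'd)^('d + 'd) \<Rightarrow> (real^'d) functional \<Rightarrow> (real^'d) functional
     \<Rightarrow> (real^('d + 'd)) functional" where
  "matrix_wigner T \<mu> \<nu> =
     fourier2_distribution (pullback_distribution T (tensor_distribution \<mu> (cnj_distribution \<nu>)))"

end

theory Submission
  imports Defs
begin

text \<open>With \<open>M = matrix_inv T\<close>, the full Fourier transform turns \<open>T (\<mu> \<otimes> cnj \<nu>)\<close> into the tensor product of the
  transforms of \<open>\<mu>\<close> and \<open>cnj \<nu>\<close> composed with the transpose of \<open>M\<close>, and it arises from the Wigner transform
  by a partial transform in the first variable, which does not affect the projection of the support to
  the second variable. Hence for \<open>p\<close> in the spectrum of \<open>\<mu>\<close> and \<open>q\<close> in the spectrum of \<open>cnj \<nu>\<close> the second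
  component of \<open>transpose T *v join p q\<close> lies in the given uniformly discrete set. Fixing \<open>p\<close> leaves an affine
  map of \<open>q\<close>, injective when \<open>det A \<noteq> 0\<close>; fixing \<open>q\<close> leaves an affine map of \<open>p\<close>, injective when
  \<open>det B \<noteq> 0\<close>. The spectrum of \<open>cnj \<nu>\<close> is the reflection of that of \<open>\<nu>\<close>, and a non-zero tempered
  distribution has non-empty spectrum.

  Continuity on Schwartz functions is expressed by families bounded in every seminorm by multiples of a
  function of the index, so that invariance of the Schwartz space, continuity of operators and remainder
  estimates are instances of one statement. Fourier inversion and changes of variables are only needed
  up to non-zero constants.\<close>

text \<open>The tensor product is an iteration of two functionals, so evaluating \<open>W_T\<close>
  on a Schwartz function already requires that
  \<open>x \<mapsto> u (\<lambda>y. \<phi> (join x y))\<close> is Schwartz, with uniform estimates;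
  this forces the calculus of families. Supports of tensor products are not computed. If the
  frequency attached to \<open>p\<close> and \<open>q\<close> were outside the projection, one
  explicit function would give a contradiction: choose test functions \<open>f\<close> near
  \<open>p\<close> and \<open>g\<close> near \<open>q\<close> that the transforms of the two
  distributions do not annihilate, compose their tensor product with the transpose of
  \<open>M\<close>, and transform partially in the first variable. The value of \<open>W_T\<close>
  there is a non-zero multiple of the product of two non-zero numbers, yet all second components of
  the support stay near the frequency. Two obstacles remain. The partial transform destroys compact
  support, so vanishing off the support has to be extended from test functions to Schwartz
  functions. And a whole neighbourhood of the frequency must miss the projection; the projection of
  a closed set need not be closed, but a uniformly discrete set is.\<close>

definition dir_deriv :: "'a::euclidean_space \<Rightarrow> ('a \<Rightarrow> complex) \<Rightarrow> 'a \<Rightarrow> complex" where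
  "dir_deriv v f x = frechet_derivative f (at x) v"

lemma partial_deriv_Cons: "partial_deriv (v # vs) f = dir_deriv v (partial_deriv vs f)"
  by (simp add: dir_deriv_def fun_eq_iff)

lemma partial_deriv_append: "partial_deriv (vs @ ws) f = partial_deriv vs (partial_deriv ws f)"
  by (induction vs) simp_all

lemma partial_deriv_singleton: "partial_deriv [v] f = dir_deriv v f"
  by (simp add: dir_deriv_def fun_eq_iff)

lemma dir_deriv_eqI: "(f has_derivative f') (at x) \<Longrightarrow> dir_deriv v f x = f' v"
  unfolding dir_deriv_def by (metis frechet_derivative_at)

lemma has_derivative_dir_deriv:
  "f differentiable (at x) \<Longrightarrow> (f has_derivative (\<lambda>v. dir_deriv v f x)) (at x)"
  unfolding dir_deriv_def by (simp add: frechet_derivative_works eta_contract_eq)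

lemma linear_dir_deriv: "f differentiable (at x) \<Longrightarrow> linear (\<lambda>v. dir_deriv v f x)"
  using has_derivative_dir_deriv has_derivative_linear by blast

lemma dir_deriv_expand:
  assumes "f differentiable (at x)"
  shows "dir_deriv v f x = (\<Sum>e\<in>Basis. of_real (v \<bullet> e) * dir_deriv e f x)"
proof -
  have "dir_deriv v f x = dir_deriv (\<Sum>e\<in>Basis. (v \<bullet> e) *\<^sub>R e) f x"
    by (simp add: euclidean_representation)
  also have "\<dots> = (\<Sum>e\<in>Basis. dir_deriv ((v \<bullet> e) *\<^sub>R e) f x)"
    by (rule linear_sum[OF linear_dir_deriv[OF assms]])
  also have "\<dots> = (\<Sum>e\<in>Basis. of_real (v \<bullet> e) * dir_deriv e f x)"
    by (simp add: linear_cmul[OF linear_dir_deriv[OF assms]] scaleR_conv_of_real)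
  finally show ?thesis .
qed

subsection \<open>Families of functions with control of all derivatives\<close>

text \<open>A predicate \<open>Q\<close> on indexed families says that the members of a family satisfy some bound uniformly
  in the index; below it is required of all derivatives.\<close>

primrec derivs_upto ::
  "nat \<Rightarrow> (('i \<Rightarrow> 'a::euclidean_space \<Rightarrow> complex) \<Rightarrow> bool) \<Rightarrow> ('i \<Rightarrow> 'a \<Rightarrow> complex) \<Rightarrow> bool" where
  "derivs_upto 0 Q f \<longleftrightarrow> Q f"
| "derivs_upto (Suc n) Q f \<longleftrightarrow> Q f \<and> (\<forall>i x. f i differentiable (at x)) \<and>
     (\<forall>e\<in>Basis. derivs_upto n Q (\<lambda>i. dir_deriv e (f i)))"

text \<open>The recursion by order is chosen because the closure properties below share one pattern:
  a derivative of the image of a family is a combination of images of other admissible families, so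
  induction on \<open>n\<close> with \<open>f\<close> generalised proves them.\<close>

definition derivs_in ::
  "(('i \<Rightarrow> 'a::euclidean_space \<Rightarrow> complex) \<Rightarrow> bool) \<Rightarrow> ('i \<Rightarrow> 'a \<Rightarrow> complex) \<Rightarrow> bool" where
  "derivs_in Q f \<longleftrightarrow> (\<forall>n. derivs_upto n Q f)"

lemma derivs_upto_SucD: "derivs_upto (Suc n) Q f \<Longrightarrow> derivs_upto n Q f"
proof (induction n arbitrary: f)
  case 0
  then show ?case by simp
next
  case (Suc n)
  have "derivs_upto n Q (\<lambda>i. dir_deriv e (f i))" if "e \<in> Basis" for e
    using that Suc.prems[unfolded derivs_upto.simps(2)[of "Suc n"]] by (intro Suc.IH) (elim conjE bspec)
  then show ?case
    using Suc.prems by simp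
qed

lemma derivs_in_base: "derivs_in Q f \<Longrightarrow> Q f"
  unfolding derivs_in_def by (drule spec[of _ 0]) simp

lemma derivs_in_differentiable: "derivs_in Q f \<Longrightarrow> f i differentiable (at x)"
  unfolding derivs_in_def by (drule spec[of _ "Suc 0"]) simp

lemma derivs_in_dir_deriv: "derivs_in Q f \<Longrightarrow> e \<in> Basis \<Longrightarrow> derivs_in Q (\<lambda>i. dir_deriv e (f i))"
  unfolding derivs_in_def
proof
  fix n assume "\<forall>n. derivs_upto n Q f" "e \<in> Basis"
  then have "derivs_upto (Suc n) Q f" by blast
  with \<open>e \<in> Basis\<close> show "derivs_upto n Q (\<lambda>i. dir_deriv e (f i))" by simp
qed

lemma derivs_in_partial_deriv:
  "derivs_in Q f \<Longrightarrow> set vs \<subseteq> Basis \<Longrightarrow> derivs_in Q (\<lambda>i. partial_deriv vs (f i))"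
  by (induction vs) (auto simp: partial_deriv_Cons derivs_in_dir_deriv simp del: partial_deriv.simps(2))

text \<open>The link to \<open>smooth\<close> and \<open>schwartz\<close>, which quantify over lists
  of basis vectors.\<close>

lemma derivs_in_iff_partial_deriv:
  "derivs_in Q f \<longleftrightarrow> (\<forall>vs. set vs \<subseteq> Basis \<longrightarrow> Q (\<lambda>i. partial_deriv vs (f i)) \<and>
     (\<forall>i x. partial_deriv vs (f i) differentiable (at x)))" (is "_ \<longleftrightarrow> ?R f")
proof
  show "?R f" if "derivs_in Q f"
    by (intro allI impI conjI derivs_in_differentiable[OF derivs_in_partial_deriv[OF that]]
        derivs_in_base[OF derivs_in_partial_deriv[OF that]])
  have "derivs_upto n Q f" if "?R f" for n
    using that
  proof (induction n arbitrary: f)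
    case 0
    then show ?case using 0[rule_format, of "[]"] by simp
  next
    case (Suc n)
    have "?R (\<lambda>i. dir_deriv e (f i))" if "e \<in> Basis" for e
    proof (intro allI impI)
      fix vs :: "'b list" assume "set vs \<subseteq> Basis"
      then show "Q (\<lambda>i. partial_deriv vs (dir_deriv e (f i))) \<and>
         (\<forall>i x. partial_deriv vs (dir_deriv e (f i)) differentiable at x)"
        \<comment> \<open>\<open>derivs_upto\<close> differentiates along \<open>e\<close> before
          all other directions, and in \<open>partial_deriv\<close> the derivative taken first is
          the last entry of the list.\<close>
        using Suc.prems[rule_format, of "vs @ [e]"] that
        by (simp add: partial_deriv_append partial_deriv_singleton del: partial_deriv.simps(2))
    qed
    then show ?case
      using Suc.IH Suc.prems[rule_format, of "[]"] by simp
  qed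
  then show "derivs_in Q f" if "?R f"
    using that by (simp add: derivs_in_def)
qed

lemma derivs_in_mono: "derivs_in Q f \<Longrightarrow> (\<And>g. Q g \<Longrightarrow> Q' g) \<Longrightarrow> derivs_in Q' f"
  by (auto simp: derivs_in_iff_partial_deriv)

lemma smooth_iff_derivs_in: "smooth f \<longleftrightarrow> derivs_in (\<lambda>_. True) (\<lambda>_::unit. f)"
  by (auto simp: smooth_def derivs_in_iff_partial_deriv differentiable_on_def)

lemma derivs_in_imp_smooth: "derivs_in Q f \<Longrightarrow> smooth (f i)"
  by (auto simp: smooth_def derivs_in_iff_partial_deriv differentiable_on_def)

lemma derivs_in_True: "derivs_in (\<lambda>_. True) f \<longleftrightarrow> (\<forall>i. smooth (f i))"
  by (auto simp: smooth_def derivs_in_iff_partial_deriv differentiable_on_def)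

text \<open>Closure under the sums and scalar multiples that the Leibniz rule, the chain rule and
  the expansion over \<open>Basis\<close> produce.\<close>

definition function_space :: "(('i \<Rightarrow> 'a \<Rightarrow> complex) \<Rightarrow> bool) \<Rightarrow> bool" where
  "function_space Q \<longleftrightarrow> Q (\<lambda>i x. 0) \<and> (\<forall>f g. Q f \<longrightarrow> Q g \<longrightarrow> Q (\<lambda>i x. f i x + g i x)) \<and>
     (\<forall>c f. Q f \<longrightarrow> Q (\<lambda>i x. c * f i x))"

lemma function_space_True: "function_space (\<lambda>_. True)"
  by (simp add: function_space_def)

lemma dir_deriv_zero [simp]: "dir_deriv v (\<lambda>x. c) = (\<lambda>x. 0)"
  by (rule ext) (rule dir_deriv_eqI[of _ "\<lambda>_. 0"], auto)

lemma dir_deriv_add: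
  assumes "f differentiable (at x)" "g differentiable (at x)"
  shows "dir_deriv v (\<lambda>x. f x + g x) x = dir_deriv v f x + dir_deriv v g x"
  by (rule dir_deriv_eqI) (intro has_derivative_add has_derivative_dir_deriv assms)

lemma dir_deriv_cmult:
  assumes "f differentiable (at x)"
  shows "dir_deriv v (\<lambda>x. c * f x) x = c * dir_deriv v f x"
  by (rule dir_deriv_eqI) (intro has_derivative_mult_right has_derivative_dir_deriv assms)

lemma dir_deriv_mult:
  assumes "f differentiable (at x)" "g differentiable (at x)"
  shows "dir_deriv v (\<lambda>x. f x * g x) x = f x * dir_deriv v g x + dir_deriv v f x * g x"
  by (rule dir_deriv_eqI) (intro has_derivative_mult has_derivative_dir_deriv assms)

lemma derivs_upto_zero: "function_space Q \<Longrightarrow> derivs_upto n Q (\<lambda>i x. 0)"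
  by (induction n) (auto simp: function_space_def)

lemma derivs_upto_add:
  assumes Q: "function_space Q"
  shows "derivs_upto n Q f \<Longrightarrow> derivs_upto n Q g \<Longrightarrow> derivs_upto n Q (\<lambda>i x. f i x + g i x)"
proof (induction n arbitrary: f g)
  case 0
  then show ?case using Q by (auto simp: function_space_def)
next
  case (Suc n)
  have "(\<lambda>i. dir_deriv e (\<lambda>x. f i x + g i x)) = (\<lambda>i x. dir_deriv e (f i) x + dir_deriv e (g i) x)" for e
    using Suc.prems by (intro ext dir_deriv_add) auto
  then show ?case
    using Suc Q by (auto simp: function_space_def)
qed

lemma derivs_upto_cmult:
  assumes Q: "function_space Q"
  shows "derivs_upto n Q f \<Longrightarrow> derivs_upto n Q (\<lambda>i x. c * f i x)"
proof (induction n arbitrary: f)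
  case 0
  then show ?case using Q by (auto simp: function_space_def)
next
  case (Suc n)
  have "(\<lambda>i. dir_deriv e (\<lambda>x. c * f i x)) = (\<lambda>i x. c * dir_deriv e (f i) x)" for e
    using Suc.prems by (intro ext dir_deriv_cmult) auto
  then show ?case
    using Suc Q by (auto simp: function_space_def)
qed

lemma derivs_upto_sum:
  assumes Q: "function_space Q" and "finite A" "\<And>a. a \<in> A \<Longrightarrow> derivs_upto n Q (f a)"
  shows "derivs_upto n Q (\<lambda>i x. \<Sum>a\<in>A. f a i x)"
  using assms(2,3)
  by (induction A rule: finite_induct) (auto intro: derivs_upto_zero derivs_upto_add Q)

lemma derivs_in_add:
  "function_space Q \<Longrightarrow> derivs_in Q f \<Longrightarrow> derivs_in Q g \<Longrightarrow> derivs_in Q (\<lambda>i x. f i x + g i x)"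
  by (simp add: derivs_in_def derivs_upto_add)

lemma derivs_in_cmult: "function_space Q \<Longrightarrow> derivs_in Q f \<Longrightarrow> derivs_in Q (\<lambda>i x. c * f i x)"
  by (simp add: derivs_in_def derivs_upto_cmult)

lemma derivs_in_diff:
  "function_space Q \<Longrightarrow> derivs_in Q f \<Longrightarrow> derivs_in Q g \<Longrightarrow> derivs_in Q (\<lambda>i x. f i x - g i x)"
  using derivs_in_add[of Q f "\<lambda>i x. (-1) * g i x"] derivs_in_cmult[of Q g "-1"] by simp

lemma derivs_in_sum:
  "function_space Q \<Longrightarrow> finite A \<Longrightarrow> (\<And>a. a \<in> A \<Longrightarrow> derivs_in Q (f a)) \<Longrightarrow>
     derivs_in Q (\<lambda>i x. \<Sum>a\<in>A. f a i x)"
  by (simp add: derivs_in_def derivs_upto_sum)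

lemma derivs_in_dir_deriv':
  assumes "function_space Q" "derivs_in Q f"
  shows "derivs_in Q (\<lambda>i. dir_deriv v (f i))"
proof -
  have "(\<lambda>i. dir_deriv v (f i)) = (\<lambda>i x. \<Sum>e\<in>Basis. of_real (v \<bullet> e) * dir_deriv e (f i) x)"
    by (intro ext dir_deriv_expand derivs_in_differentiable[OF assms(2)])
  then show ?thesis
    using assms by (auto intro!: derivs_in_sum derivs_in_cmult derivs_in_dir_deriv)
qed

text \<open>The factors may obey different bounds; the main instance is rapid decay times polynomial
  growth.\<close>

lemma derivs_upto_mult:
  assumes Q: "function_space Q" and mult: "\<And>f g. Q1 f \<Longrightarrow> Q2 g \<Longrightarrow> Q (\<lambda>i x. f i x * g i x)"
  shows "derivs_upto n Q1 f \<Longrightarrow> derivs_upto n Q2 g \<Longrightarrow> derivs_upto n Q (\<lambda>i x. f i x * g i x)"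
proof (induction n arbitrary: f g)
  case 0
  then show ?case using mult by auto
next
  case (Suc n)
  have *: "(\<lambda>i. dir_deriv e (\<lambda>x. f i x * g i x)) =
      (\<lambda>i x. f i x * dir_deriv e (g i) x + dir_deriv e (f i) x * g i x)" for e
    using Suc.prems by (intro ext dir_deriv_mult) auto
  \<comment> \<open>In each term of the Leibniz rule one factor stays undifferentiated, while
    \<open>Suc.IH\<close> asks for both factors at order \<open>n\<close>.\<close>
  have "derivs_upto n Q1 f" "derivs_upto n Q2 g"
    by (rule derivs_upto_SucD, rule Suc.prems)+
  then have "derivs_upto n Q (\<lambda>i. dir_deriv e (\<lambda>x. f i x * g i x))" if "e \<in> Basis" for e
    unfolding * using Suc.prems that by (intro derivs_upto_add Q Suc.IH) auto
  then show ?case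
    using Suc.prems by (auto intro!: mult)
qed

lemma derivs_in_mult:
  assumes "function_space Q" "\<And>f g. Q1 f \<Longrightarrow> Q2 g \<Longrightarrow> Q (\<lambda>i x. f i x * g i x)"
    and "derivs_in Q1 f" "derivs_in Q2 g"
  shows "derivs_in Q (\<lambda>i x. f i x * g i x)"
proof -
  have "derivs_upto n Q (\<lambda>i x. f i x * g i x)" for n
  proof (rule derivs_upto_mult[of Q Q1 Q2])
    show "Q (\<lambda>i x. f i x * g i x)" if "Q1 f" "Q2 g" for f g
      using that by (rule assms(2))
    show "derivs_upto n Q1 f" "derivs_upto n Q2 g"
      using assms(3,4) by (simp_all add: derivs_in_def)
  qed (rule assms)
  then show ?thesis
    by (simp add: derivs_in_def)
qed

lemma has_derivative_affine:
  fixes L :: "'b::euclidean_space \<Rightarrow> 'a::euclidean_space"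
  assumes "f differentiable (at (w + L y))" "linear L"
  shows "((\<lambda>y. c * f (w + L y)) has_derivative (\<lambda>v. c * dir_deriv (L v) f (w + L y))) (at y)"
proof -
  have L: "(L has_derivative L) (at y)"
    by (rule bounded_linear_imp_has_derivative) (rule assms(2)[unfolded linear_conv_bounded_linear])
  have "((\<lambda>y. w + L y) has_derivative L) (at y)"
    using has_derivative_add[OF has_derivative_const[of w] L] by (simp only: add_0)
  then have "((\<lambda>y. f (w + L y)) has_derivative (\<lambda>v. dir_deriv (L v) f (w + L y))) (at y)"
    using has_derivative_dir_deriv[OF assms(1)]
    by (rule has_derivative_compose[of "\<lambda>y. w + L y" L y UNIV f "\<lambda>v. dir_deriv v f (w + L y)"])
  then show ?thesis
    by (rule has_derivative_mult_right)
qed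

text \<open>Factor, translation and old index all depend on the new index \<open>j\<close>. In this
  form a slice \<open>y \<mapsto> \<Phi> i (join x y)\<close>, weighted by a power of
  \<open>norm x\<close>, is a family indexed by the pair of \<open>i\<close> and \<open>x\<close>.
  The bound \<open>base\<close> is assumed for every \<open>f\<close> because the induction applies
  it to derivatives.\<close>

lemma derivs_upto_affine:
  fixes L :: "'b::euclidean_space \<Rightarrow> 'a::euclidean_space"
  assumes Q: "function_space Q'" and L: "linear L"
    and base: "\<And>f. Q f \<Longrightarrow> Q' (\<lambda>j y. c j * f (\<iota> j) (w j + L y))"
  shows "derivs_upto n Q f \<Longrightarrow> derivs_upto n Q' (\<lambda>j y. c j * f (\<iota> j) (w j + L y))"
proof (induction n arbitrary: f)
  case 0
  then show ?case using base by auto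
next
  case (Suc n)
  have der: "((\<lambda>y. c j * f (\<iota> j) (w j + L y)) has_derivative
      (\<lambda>v. c j * dir_deriv (L v) (f (\<iota> j)) (w j + L y))) (at y)" for j y
    using Suc.prems by (intro has_derivative_affine L) auto
  have *: "(\<lambda>j. dir_deriv e (\<lambda>y. c j * f (\<iota> j) (w j + L y))) =
     (\<lambda>j y. \<Sum>b\<in>Basis. of_real (L e \<bullet> b) * (c j * dir_deriv b (f (\<iota> j)) (w j + L y)))" for e
  proof (intro ext)
    fix j y
    have "dir_deriv e (\<lambda>y. c j * f (\<iota> j) (w j + L y)) y = c j * dir_deriv (L e) (f (\<iota> j)) (w j + L y)"
      by (rule dir_deriv_eqI[OF der])
    also have "dir_deriv (L e) (f (\<iota> j)) (w j + L y) =
        (\<Sum>b\<in>Basis. of_real (L e \<bullet> b) * dir_deriv b (f (\<iota> j)) (w j + L y))"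
      using Suc.prems by (intro dir_deriv_expand) auto
    finally show "dir_deriv e (\<lambda>y. c j * f (\<iota> j) (w j + L y)) y =
       (\<Sum>b\<in>Basis. of_real (L e \<bullet> b) * (c j * dir_deriv b (f (\<iota> j)) (w j + L y)))"
      by (simp add: sum_distrib_left mult_ac)
  qed
  have "derivs_upto n Q' (\<lambda>j y. c j * dir_deriv b (f (\<iota> j)) (w j + L y))" if "b \<in> Basis" for b
    using Suc.prems that by (intro Suc.IH) auto
  then have "derivs_upto n Q' (\<lambda>j. dir_deriv e (\<lambda>y. c j * f (\<iota> j) (w j + L y)))" for e
    unfolding * by (intro derivs_upto_sum derivs_upto_cmult Q) auto
  moreover have "(\<lambda>y. c j * f (\<iota> j) (w j + L y)) differentiable (at y)" for j y
    using der by (auto simp: differentiable_def)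
  ultimately show ?case
    using base Suc.prems by simp
qed

lemma derivs_in_affine:
  fixes L :: "'b::euclidean_space \<Rightarrow> 'a::euclidean_space"
  assumes "function_space Q'" "linear L"
    and "\<And>f. Q f \<Longrightarrow> Q' (\<lambda>j y. c j * f (\<iota> j) (w j + L y))" and "derivs_in Q f"
  shows "derivs_in Q' (\<lambda>j y. c j * f (\<iota> j) (w j + L y))"
proof -
  have "derivs_upto n Q' (\<lambda>j y. c j * f (\<iota> j) (w j + L y))" for n
  proof (rule derivs_upto_affine[of Q' L Q])
    show "Q' (\<lambda>j y. c j * f (\<iota> j) (w j + L y))" if "Q f" for f
      using that by (rule assms(3))
    show "derivs_upto n Q f"
      using assms(4) by (simp add: derivs_in_def)
  qed (rule assms)+
  then show ?thesis
    by (simp add: derivs_in_def)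
qed

subsection \<open>Taylor estimates along lines\<close>

lemma norm_increment_le:
  fixes g :: "real \<Rightarrow> complex"
  assumes "\<And>s. s \<in> {0..t} \<Longrightarrow> (g has_vector_derivative g' s) (at s within {0..t})"
    and "\<And>s. s \<in> {0..t} \<Longrightarrow> norm (g' s) \<le> B" and "0 \<le> t"
  shows "norm (g t - g 0) \<le> B * t"
proof -
  have "norm (g t - g 0) \<le> B * norm (t - 0)"
  proof (rule differentiable_bound)
    show "convex {0..t}" by simp
    show "(g has_derivative (\<lambda>h. h *\<^sub>R g' s)) (at s within {0..t})" if "s \<in> {0..t}" for s
      using assms(1)[OF that] by (simp add: has_vector_derivative_def)
    show "onorm (\<lambda>h. h *\<^sub>R g' s) \<le> B" if "s \<in> {0..t}" for s
      using assms(2)[OF that] by (intro onorm_le) (simp add: mult_left_mono mult.commute[of B])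
  qed (use assms(3) in auto)
  then show ?thesis using assms(3) by simp
qed

text \<open>The mean value inequality is applied twice, to \<open>g'\<close> and then to
  \<open>g s - s *\<^sub>R g' 0\<close>. This yields \<open>B\<close> where integration would give
  \<open>B / 2\<close>; later uses only see the order of the remainder.\<close>

lemma taylor_line:
  fixes g :: "real \<Rightarrow> complex"
  assumes "\<And>s. (g has_vector_derivative g' s) (at s)"
    and "\<And>s. (g' has_vector_derivative g'' s) (at s)"
    and "\<And>s. s \<in> {0..1} \<Longrightarrow> norm (g'' s) \<le> B"
  shows "norm (g 1 - g 0 - g' 0) \<le> B"
proof -
  have B: "0 \<le> B"
    using assms(3)[of 0] norm_ge_zero[of "g'' 0"] by (simp del: norm_ge_zero)
  have 1: "norm (g' s - g' 0) \<le> B" if "s \<in> {0..1}" for s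
  proof -
    have "norm (g' s - g' 0) \<le> B * s"
      using that assms(3) by (intro norm_increment_le[of s g' g''] has_vector_derivative_at_within[OF assms(2)]) auto
    also have "\<dots> \<le> B" using that B by (simp add: mult_left_le)
    finally show ?thesis .
  qed
  have "norm ((g 1 - 1 *\<^sub>R g' 0) - (g 0 - 0 *\<^sub>R g' 0)) \<le> B * 1"
  proof (rule norm_increment_le[of 1 "\<lambda>s. g s - s *\<^sub>R g' 0" "\<lambda>s. g' s - g' 0"])
    show "((\<lambda>s. g s - s *\<^sub>R g' 0) has_vector_derivative g' s - g' 0) (at s within {0..1})" for s
      by (auto intro!: derivative_eq_intros has_vector_derivative_at_within[OF assms(1)])
  qed (use 1 in auto)
  then show ?thesis by (simp add: algebra_simps)
qed

lemma has_vector_derivative_line: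
  fixes f :: "'a::euclidean_space \<Rightarrow> complex"
  assumes "f differentiable (at (x + s *\<^sub>R v))"
  shows "((\<lambda>s. f (x + s *\<^sub>R v)) has_vector_derivative dir_deriv v f (x + s *\<^sub>R v)) (at s within S)"
proof -
  have "((\<lambda>s. x + s *\<^sub>R v) has_derivative (\<lambda>h. h *\<^sub>R v)) (at s within S)"
    by (auto intro!: derivative_eq_intros)
  then have "((\<lambda>s. f (x + s *\<^sub>R v)) has_derivative (\<lambda>h. dir_deriv (h *\<^sub>R v) f (x + s *\<^sub>R v))) (at s within S)"
    using has_derivative_dir_deriv[OF assms]
    by (rule has_derivative_compose[of "\<lambda>s. x + s *\<^sub>R v" "\<lambda>h. h *\<^sub>R v" s S f "\<lambda>v'. dir_deriv v' f (x + s *\<^sub>R v)"])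
  then show ?thesis
    by (simp add: has_vector_derivative_def linear_cmul[OF linear_dir_deriv[OF assms]])
qed

lemma taylor_dir_deriv:
  fixes f :: "'a::euclidean_space \<Rightarrow> complex"
  assumes "\<And>x. f differentiable (at x)" "\<And>x. dir_deriv h f differentiable (at x)"
    and "\<And>x. norm (dir_deriv h (dir_deriv h f) x) \<le> B"
  shows "norm (f (x + h) - f x - dir_deriv h f x) \<le> B"
proof -
  have "norm (f (x + 1 *\<^sub>R h) - f (x + 0 *\<^sub>R h) - dir_deriv h f (x + 0 *\<^sub>R h)) \<le> B"
    by (rule taylor_line[of "\<lambda>s. f (x + s *\<^sub>R h)" "\<lambda>s. dir_deriv h f (x + s *\<^sub>R h)"
      "\<lambda>s. dir_deriv h (dir_deriv h f) (x + s *\<^sub>R h)" B]) (intro has_vector_derivative_line assms)+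
  then show ?thesis by simp
qed

text \<open>The second difference over the parallelogram spanned by \<open>s *\<^sub>R u\<close> and
  \<open>s *\<^sub>R v\<close> is an increment in direction \<open>u\<close> of a first difference
  in direction \<open>v\<close>. One mean value inequality per direction compares it with
  \<open>s * s\<close> times the mixed derivative.\<close>

lemma mixed_difference:
  fixes f :: "'a::euclidean_space \<Rightarrow> complex"
  assumes f: "\<And>x. f differentiable (at x)" "\<And>x. dir_deriv u f differentiable (at x)"
    and s: "0 \<le> s"
    and le: "\<And>p q. p \<in> {0..s} \<Longrightarrow> q \<in> {0..s} \<Longrightarrow>
      norm (dir_deriv v (dir_deriv u f) (x + p *\<^sub>R u + q *\<^sub>R v) - c) \<le> \<epsilon>"
  shows "norm (f (x + s *\<^sub>R u + s *\<^sub>R v) - f (x + s *\<^sub>R u) - f (x + s *\<^sub>R v) + f x - (s * s) *\<^sub>R c) \<le> \<epsilon> * s * s"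
proof -
  define \<phi> where "\<phi> r = f (x + s *\<^sub>R v + r *\<^sub>R u) - f (x + r *\<^sub>R u) - (r * s) *\<^sub>R c" for r
  define \<phi>' where "\<phi>' r = dir_deriv u f (x + s *\<^sub>R v + r *\<^sub>R u) - dir_deriv u f (x + r *\<^sub>R u) - s *\<^sub>R c" for r
  have \<phi>': "(\<phi> has_vector_derivative \<phi>' r) (at r within S)" for r S
    unfolding \<phi>_def \<phi>'_def
    by (auto intro!: derivative_eq_intros has_vector_derivative_line f)
  have "norm (\<phi>' r) \<le> \<epsilon> * s" if r: "r \<in> {0..s}" for r
  proof -
    have "norm ((dir_deriv u f (x + r *\<^sub>R u + s *\<^sub>R v) - s *\<^sub>R c) - (dir_deriv u f (x + r *\<^sub>R u + 0 *\<^sub>R v) - 0 *\<^sub>R c)) \<le> \<epsilon> * s"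
    proof (rule norm_increment_le[of s "\<lambda>q. dir_deriv u f (x + r *\<^sub>R u + q *\<^sub>R v) - q *\<^sub>R c"
          "\<lambda>q. dir_deriv v (dir_deriv u f) (x + r *\<^sub>R u + q *\<^sub>R v) - c"])
      show "((\<lambda>q. dir_deriv u f (x + r *\<^sub>R u + q *\<^sub>R v) - q *\<^sub>R c) has_vector_derivative
         dir_deriv v (dir_deriv u f) (x + r *\<^sub>R u + q *\<^sub>R v) - c) (at q within {0..s})" for q
        by (auto intro!: derivative_eq_intros has_vector_derivative_line f)
    qed (use s r le in auto)
    then show ?thesis by (simp add: \<phi>'_def algebra_simps)
  qed
  from norm_increment_le[OF \<phi>' this s] have "norm (\<phi> s - \<phi> 0) \<le> \<epsilon> * s * s" by blast
  moreover have "\<phi> s - \<phi> 0 = f (x + s *\<^sub>R u + s *\<^sub>R v) - f (x + s *\<^sub>R u) - f (x + s *\<^sub>R v) + f x - (s * s) *\<^sub>R c"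
    by (simp add: \<phi>_def algebra_simps)
  ultimately show ?thesis by simp
qed

text \<open>Schwarz's theorem: the second difference is symmetric in \<open>u\<close> and
  \<open>v\<close>, so after division by \<open>s * s\<close> both mixed derivatives are within
  \<open>\<epsilon>/2\<close> of the same number.\<close>

lemma dir_deriv_commute:
  fixes f :: "'a::euclidean_space \<Rightarrow> complex"
  assumes f: "\<And>x. f differentiable (at x)" "\<And>x. dir_deriv u f differentiable (at x)"
      "\<And>x. dir_deriv v f differentiable (at x)"
    and c: "isCont (dir_deriv v (dir_deriv u f)) x" "isCont (dir_deriv u (dir_deriv v f)) x"
  shows "dir_deriv u (dir_deriv v f) x = dir_deriv v (dir_deriv u f) x" (is "?a = ?b")
proof -
  have near: "\<exists>d>0. \<forall>y. norm (y - x) < d \<longrightarrow> norm (g y - g x) \<le> \<epsilon>" if "isCont g x" "\<epsilon> > 0"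
    for g :: "'a \<Rightarrow> complex" and \<epsilon>
    using that unfolding continuous_at_eps_delta dist_norm by (meson less_imp_le)
  have "norm (?a - ?b) \<le> \<epsilon>" if "\<epsilon> > 0" for \<epsilon>
  proof -
    obtain d1 where d1: "d1 > 0" "\<And>y. norm (y - x) < d1 \<Longrightarrow> norm (dir_deriv v (dir_deriv u f) y - ?b) \<le> \<epsilon>/2"
      using near[OF c(1) half_gt_zero[OF \<open>\<epsilon> > 0\<close>]] by blast
    obtain d2 where d2: "d2 > 0" "\<And>y. norm (y - x) < d2 \<Longrightarrow> norm (dir_deriv u (dir_deriv v f) y - ?a) \<le> \<epsilon>/2"
      using near[OF c(2) half_gt_zero[OF \<open>\<epsilon> > 0\<close>]] by blast
    define d where "d = min d1 d2"
    have "d > 0" using d1 d2 by (simp add: d_def)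
    \<comment> \<open>The summand 1 keeps \<open>K\<close> positive when \<open>u\<close> and
      \<open>v\<close> vanish; with \<open>s = d / (2 * K)\<close> the whole parallelogram lies
      within \<open>d / 2\<close> of \<open>x\<close>.\<close>
    define K where "K = norm u + norm v + 1"
    have K: "K > 0" by (simp add: K_def add_nonneg_pos)
    define s where "s = d / (2 * K)"
    have s: "s > 0" using \<open>d > 0\<close> K by (simp add: s_def)
    have small: "norm ((x + p *\<^sub>R u' + q *\<^sub>R v') - x) < d"
      if "p \<in> {0..s}" "q \<in> {0..s}" "norm u' + norm v' \<le> K" for p q u' v'
    proof -
      have "norm ((x + p *\<^sub>R u' + q *\<^sub>R v') - x) \<le> p * norm u' + q * norm v'"
        using that by (auto intro: order_trans[OF norm_triangle_ineq])
      also have "\<dots> \<le> s * norm u' + s * norm v'"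
        using that by (intro add_mono mult_right_mono) auto
      also have "\<dots> = s * (norm u' + norm v')" by (simp add: algebra_simps)
      also have "\<dots> \<le> s * K" using that s by (intro mult_left_mono) auto
      also have "\<dots> < d" using \<open>d > 0\<close> K by (simp add: s_def)
      finally show ?thesis .
    qed
    let ?\<Delta> = "f (x + s *\<^sub>R u + s *\<^sub>R v) - f (x + s *\<^sub>R u) - f (x + s *\<^sub>R v) + f x"
    have 1: "norm (?\<Delta> - (s * s) *\<^sub>R ?b) \<le> \<epsilon>/2 * s * s"
    proof (rule mixed_difference)
      fix p q assume "p \<in> {0..s}" "q \<in> {0..s}"
      then show "norm (dir_deriv v (dir_deriv u f) (x + p *\<^sub>R u + q *\<^sub>R v) - ?b) \<le> \<epsilon>/2"
        by (intro d1(2) less_le_trans[OF small]) (auto simp: K_def d_def)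
    qed (use s f in auto)
    have "norm (f (x + s *\<^sub>R v + s *\<^sub>R u) - f (x + s *\<^sub>R v) - f (x + s *\<^sub>R u) + f x - (s * s) *\<^sub>R ?a) \<le> \<epsilon>/2 * s * s"
    proof (rule mixed_difference)
      fix p q assume "p \<in> {0..s}" "q \<in> {0..s}"
      then show "norm (dir_deriv u (dir_deriv v f) (x + p *\<^sub>R v + q *\<^sub>R u) - ?a) \<le> \<epsilon>/2"
        by (intro d2(2) less_le_trans[OF small]) (auto simp: K_def d_def)
    qed (use s f in auto)
    then have 2: "norm (?\<Delta> - (s * s) *\<^sub>R ?a) \<le> \<epsilon>/2 * s * s"
      by (simp add: algebra_simps)
    have "(s * s) * norm (?a - ?b) = norm ((?\<Delta> - (s * s) *\<^sub>R ?b) - (?\<Delta> - (s * s) *\<^sub>R ?a))"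
      using s by (simp add: scaleR_diff_right[symmetric])
    also have "\<dots> \<le> \<epsilon>/2 * s * s + \<epsilon>/2 * s * s"
      using 1 2 by (rule order_trans[OF norm_triangle_ineq4 add_mono])
    finally have "(s * s) * norm (?a - ?b) \<le> (s * s) * \<epsilon>" by (simp add: field_simps)
    then show ?thesis using s by simp
  qed
  then have "norm (?a - ?b) \<le> 0" by (rule field_le_epsilon[of _ 0, simplified])
  then show ?thesis by simp
qed

section \<open>Continuity and commuting derivatives for families\<close>

lemma derivs_in_continuous:
  assumes "derivs_in Q f" shows "continuous_on S (f i)"
  by (intro continuous_at_imp_continuous_on ballI differentiable_imp_continuous_within
      derivs_in_differentiable[OF assms])

lemma derivs_in_True_of: "derivs_in Q f \<Longrightarrow> derivs_in (\<lambda>_. True) f"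
  by (erule derivs_in_mono) simp

lemma derivs_in_differentiable_dir:
  assumes "derivs_in Q f"
  shows "dir_deriv v (f i) differentiable (at x)" "dir_deriv u (dir_deriv v (f i)) differentiable (at x)"
proof -
  have 1: "derivs_in (\<lambda>_. True) (\<lambda>i. dir_deriv v (f i))"
    by (rule derivs_in_dir_deriv'[OF function_space_True derivs_in_True_of[OF assms]])
  have 2: "derivs_in (\<lambda>_. True) (\<lambda>i. dir_deriv u (dir_deriv v (f i)))"
    by (rule derivs_in_dir_deriv'[OF function_space_True 1])
  show "dir_deriv v (f i) differentiable (at x)"
    by (rule derivs_in_differentiable[OF 1])
  show "dir_deriv u (dir_deriv v (f i)) differentiable (at x)"
    by (rule derivs_in_differentiable[OF 2])
qed

lemma derivs_in_commute:
  assumes "derivs_in Q f"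
  shows "dir_deriv u (dir_deriv v (f i)) = dir_deriv v (dir_deriv u (f i))"
  by (intro ext dir_deriv_commute derivs_in_differentiable[OF assms] differentiable_imp_continuous_within
      derivs_in_differentiable_dir[OF assms])

subsection \<open>Rapidly decreasing families\<close>

text \<open>The constant may depend on \<open>k\<close> but not on the index. For a single function
  \<open>a\<close> is constantly 1; for Taylor remainders it is the square of the increment, for
  truncation errors \<open>1 / real (Suc n)\<close>.\<close>

definition decay :: "('i \<Rightarrow> real) \<Rightarrow> ('i \<Rightarrow> 'a::euclidean_space \<Rightarrow> complex) \<Rightarrow> bool" where
  "decay a f \<longleftrightarrow> (\<forall>k. \<exists>C. \<forall>i x. norm x ^ k * norm (f i x) \<le> C * a i)"

definition growth :: "('i \<Rightarrow> real) \<Rightarrow> ('i \<Rightarrow> 'a::euclidean_space \<Rightarrow> complex) \<Rightarrow> bool" where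
  "growth c f \<longleftrightarrow> (\<exists>C N. \<forall>i x. norm (f i x) \<le> C * c i * (1 + norm x) ^ N)"

lemma one_plus_power_le: "0 \<le> t \<Longrightarrow> (1 + t) ^ k \<le> 2 ^ k * (1 + t ^ k)" for t :: real
proof -
  assume t: "0 \<le> t"
  have "(1 + t) ^ k \<le> (2 * max 1 t) ^ k"
    using t by (intro power_mono) auto
  also have "\<dots> \<le> 2 ^ k * (1 + t ^ k)"
    using t by (auto simp: power_mult_distrib max_def)
  finally show ?thesis .
qed

lemma decay_one_plus:
  assumes "decay a f"
  obtains C where "\<And>i x. (1 + norm x) ^ k * norm (f i x) \<le> C * a i"
proof -
  obtain C0 where C0: "\<And>i x. norm x ^ 0 * norm (f i x) \<le> C0 * a i"
    using assms unfolding decay_def by blast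
  obtain Ck where Ck: "\<And>i x. norm x ^ k * norm (f i x) \<le> Ck * a i"
    using assms unfolding decay_def by blast
  have "(1 + norm x) ^ k * norm (f i x) \<le> (2 ^ k * (C0 + Ck)) * a i" for i x
  proof -
    have "(1 + norm x) ^ k * norm (f i x) \<le> 2 ^ k * (1 + norm x ^ k) * norm (f i x)"
      by (intro mult_right_mono one_plus_power_le) auto
    also have "\<dots> = 2 ^ k * (norm x ^ 0 * norm (f i x) + norm x ^ k * norm (f i x))"
      by (simp add: algebra_simps)
    also have "\<dots> \<le> 2 ^ k * (C0 * a i + Ck * a i)"
      by (intro mult_left_mono add_mono C0 Ck) auto
    finally show ?thesis by (simp add: algebra_simps)
  qed
  then show ?thesis by (rule that)
qed

lemma function_space_decay: "function_space (decay a)"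
  unfolding function_space_def
proof (intro conjI allI impI)
  show "decay a (\<lambda>i x. 0)" by (auto simp: decay_def intro!: exI[of _ 0])
next
  fix f g :: "'a \<Rightarrow> 'b \<Rightarrow> complex" assume fg: "decay a f" "decay a g"
  show "decay a (\<lambda>i x. f i x + g i x)" unfolding decay_def
  proof
    fix k
    obtain C D where C: "\<And>i x. norm x ^ k * norm (f i x) \<le> C * a i"
       and D: "\<And>i x. norm x ^ k * norm (g i x) \<le> D * a i"
      using fg unfolding decay_def by blast
    have "norm x ^ k * norm (f i x + g i x) \<le> (C + D) * a i" for i x
    proof -
      have "norm x ^ k * norm (f i x + g i x) \<le> norm x ^ k * (norm (f i x) + norm (g i x))"
        by (intro mult_left_mono norm_triangle_ineq) auto
      also have "\<dots> \<le> (C + D) * a i" using C[of x i] D[of x i] by (simp add: algebra_simps)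
      finally show ?thesis .
    qed
    then show "\<exists>C. \<forall>i x. norm x ^ k * norm (f i x + g i x) \<le> C * a i" by blast
  qed
next
  fix c and f :: "'a \<Rightarrow> 'b \<Rightarrow> complex" assume f: "decay a f"
  show "decay a (\<lambda>i x. c * f i x)" unfolding decay_def
  proof
    fix k
    obtain C where C: "\<And>i x. norm x ^ k * norm (f i x) \<le> C * a i"
      using f unfolding decay_def by blast
    have "norm x ^ k * norm (c * f i x) \<le> (norm c * C) * a i" for i x
      using mult_left_mono[OF C[of x i], of "norm c"] by (simp add: norm_mult mult_ac)
    then show "\<exists>C. \<forall>i x. norm x ^ k * norm (c * f i x) \<le> C * a i" by blast
  qed
qed

lemma decay_mult_growth:
  assumes "decay a f" "growth c g"
  shows "decay (\<lambda>i. a i * c i) (\<lambda>i x. f i x * g i x)"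
  unfolding decay_def
proof
  fix k
  obtain C N where C: "\<And>i x. norm (g i x) \<le> C * c i * (1 + norm x) ^ N"
    using assms(2) unfolding growth_def by blast
  obtain D where D: "\<And>i x. (1 + norm x) ^ (k + N) * norm (f i x) \<le> D * a i"
    using decay_one_plus[OF assms(1)] by blast
  have "norm x ^ k * norm (f i x * g i x) \<le> (C * D) * (a i * c i)" for i x
  proof -
    \<comment> \<open>The sign of \<open>c i\<close> is unknown, but its product with
      \<open>C\<close> bounds a norm and is therefore non-negative.\<close>
    have pos: "0 \<le> C * c i"
    proof -
      have "0 \<le> C * c i * (1 + norm x) ^ N" using C norm_ge_zero order_trans by blast
      moreover have "0 < (1 + norm x) ^ N" by (simp add: add_pos_nonneg)
      ultimately show ?thesis by (metis zero_le_mult_iff not_le)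
    qed
    have "norm x ^ k * norm (f i x * g i x) = (norm x ^ k * norm (f i x)) * norm (g i x)"
      by (simp add: norm_mult)
    also have "\<dots> \<le> ((1 + norm x) ^ k * norm (f i x)) * (C * c i * (1 + norm x) ^ N)"
      by (rule mult_mono[OF _ C]) (auto intro!: mult_right_mono power_mono)
    also have "\<dots> = (C * c i) * ((1 + norm x) ^ (k + N) * norm (f i x))"
      by (simp add: power_add mult_ac)
    also have "\<dots> \<le> (C * c i) * (D * a i)"
      by (intro mult_left_mono D pos)
    finally show ?thesis by (simp add: mult_ac)
  qed
  then show "\<exists>C. \<forall>i x. norm x ^ k * norm (f i x * g i x) \<le> C * (a i * c i)" by blast
qed

text \<open>The assumption measures \<open>y\<close> by the point at which \<open>f\<close> is
  evaluated; a power of that size is absorbed by the decay of \<open>f\<close>, uniformly in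
  \<open>j\<close>.\<close>

lemma decay_affine:
  fixes L :: "'b::euclidean_space \<Rightarrow> 'a::euclidean_space"
  assumes f: "decay a f"
    and w: "\<And>k. \<exists>C N. \<forall>j y. norm (c j) * norm y ^ k \<le> C * (1 + norm (w j + L y)) ^ N"
  shows "decay (\<lambda>j. a (\<iota> j)) (\<lambda>j y. c j * f (\<iota> j) (w j + L y))"
  unfolding decay_def
proof
  fix k
  obtain C N where C: "\<And>j y. norm (c j) * norm y ^ k \<le> C * (1 + norm (w j + L y)) ^ N"
    using w by blast
  obtain D where D: "\<And>i x. (1 + norm x) ^ N * norm (f i x) \<le> D * a i"
    using decay_one_plus[OF f] by blast
  have "norm y ^ k * norm (c j * f (\<iota> j) (w j + L y)) \<le> (\<bar>C\<bar> * D) * a (\<iota> j)" for j y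
  proof -
    have "norm y ^ k * norm (c j * f (\<iota> j) (w j + L y)) = (norm (c j) * norm y ^ k) * norm (f (\<iota> j) (w j + L y))"
      by (simp add: norm_mult)
    also have "\<dots> \<le> (\<bar>C\<bar> * (1 + norm (w j + L y)) ^ N) * norm (f (\<iota> j) (w j + L y))"
      by (intro mult_right_mono order_trans[OF C]) auto
    also have "\<dots> \<le> \<bar>C\<bar> * (D * a (\<iota> j))"
      unfolding mult.assoc by (intro mult_left_mono D) auto
    finally show ?thesis by (simp add: mult_ac)
  qed
  then show "\<exists>C. \<forall>j y. norm y ^ k * norm (c j * f (\<iota> j) (w j + L y)) \<le> C * a (\<iota> j)" by blast
qed

lemma schwartz_iff_derivs_in: "schwartz f \<longleftrightarrow> derivs_in (decay (\<lambda>_. 1)) (\<lambda>_::unit. f)"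
  unfolding schwartz_def smooth_def derivs_in_iff_partial_deriv decay_def differentiable_on_def by auto

lemma schwartz_imp_derivs_in: "schwartz f \<Longrightarrow> derivs_in (decay (\<lambda>_. 1)) (\<lambda>_. f)"
  unfolding schwartz_def smooth_def derivs_in_iff_partial_deriv decay_def differentiable_on_def by auto

lemma derivs_in_imp_schwartz:
  assumes "derivs_in (decay a) f" shows "schwartz (f i)"
  unfolding schwartz_def
proof (intro conjI allI impI)
  show "smooth (f i)" using derivs_in_imp_smooth[OF assms] .
  fix k and vs :: "'b list" assume "set vs \<subseteq> Basis"
  then have "decay a (\<lambda>i. partial_deriv vs (f i))"
    by (rule derivs_in_base[OF derivs_in_partial_deriv[OF assms]])
  then show "\<exists>C. \<forall>x. norm x ^ k * cmod (partial_deriv vs (f i) x) \<le> C"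
    unfolding decay_def by blast
qed

text \<open>Temperedness involves finitely many seminorms, so the decay constants for these can be
  summed, and the index enters only through the factor \<open>a i\<close>.\<close>

lemma tempered_family_bound:
  assumes u: "tempered_distribution u" and f: "derivs_in (decay a) f"
  obtains C where "\<And>i. norm (u (f i)) \<le> C * a i"
proof -
  obtain C N where C: "\<And>f. schwartz f \<Longrightarrow> norm (u f) \<le>
      C * (\<Sum>vs\<in>{vs. set vs \<subseteq> Basis \<and> length vs \<le> N}. \<Sum>k\<le>N. schwartz_seminorm k vs f)"
    using u unfolding tempered_distribution_def by blast
  define V where "V = {vs::'a list. set vs \<subseteq> Basis \<and> length vs \<le> N}"
  have "\<exists>D. \<forall>i x. norm x ^ k * norm (partial_deriv vs (f i) x) \<le> D * a i" if "vs \<in> V" for vs k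
  proof -
    have "decay a (\<lambda>i. partial_deriv vs (f i))"
      using that by (intro derivs_in_base[OF derivs_in_partial_deriv[OF f]]) (simp add: V_def)
    then show ?thesis unfolding decay_def by blast
  qed
  then have "\<forall>k vs. \<exists>D. vs \<in> V \<longrightarrow> (\<forall>i x. norm x ^ k * norm (partial_deriv vs (f i) x) \<le> D * a i)"
    by blast
  then obtain D where D: "\<And>k vs i x. vs \<in> V \<Longrightarrow> norm x ^ k * norm (partial_deriv vs (f i) x) \<le> D k vs * a i"
    unfolding choice_iff by blast
  have sn: "schwartz_seminorm k vs (f i) \<le> D k vs * a i" "0 \<le> schwartz_seminorm k vs (f i)" if "vs \<in> V" for i k vs
  proof -
    \<comment> \<open>A \<open>SUP\<close> of reals bounds its members only when the set is bounded
      above.\<close>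
    have bdd: "bdd_above (range (\<lambda>x. norm x ^ k * norm (partial_deriv vs (f i) x)))"
      using D[OF that] by (auto intro!: bdd_aboveI)
    show "schwartz_seminorm k vs (f i) \<le> D k vs * a i"
      unfolding schwartz_seminorm_def by (intro cSUP_least D that) auto
    have "0 \<le> norm (0::'a) ^ k * norm (partial_deriv vs (f i) 0)" by simp
    also have "\<dots> \<le> schwartz_seminorm k vs (f i)"
      unfolding schwartz_seminorm_def by (intro cSUP_upper bdd) auto
    finally show "0 \<le> schwartz_seminorm k vs (f i)" .
  qed
  have "norm (u (f i)) \<le> (\<bar>C\<bar> * (\<Sum>vs\<in>V. \<Sum>k\<le>N. D k vs)) * a i" for i
  proof -
    have "norm (u (f i)) \<le> C * (\<Sum>vs\<in>V. \<Sum>k\<le>N. schwartz_seminorm k vs (f i))"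
      unfolding V_def by (intro C derivs_in_imp_schwartz[OF f])
    \<comment> \<open>The constant in \<open>tempered_distribution\<close> may be negative; since
      the seminorms are non-negative, it can be replaced by its absolute value.\<close>
    also have "\<dots> \<le> \<bar>C\<bar> * (\<Sum>vs\<in>V. \<Sum>k\<le>N. schwartz_seminorm k vs (f i))"
      by (intro mult_right_mono sum_nonneg sn) auto
    also have "\<dots> \<le> \<bar>C\<bar> * (\<Sum>vs\<in>V. \<Sum>k\<le>N. D k vs * a i)"
      by (intro mult_left_mono sum_mono sn) auto
    finally show ?thesis by (simp add: sum_distrib_right mult.assoc)
  qed
  then show ?thesis by (rule that)
qed

subsection \<open>Integrals of rapidly decreasing families\<close>

text \<open>The exponent is two per dimension, so that the weight is at most the product over the
  coordinates of \<open>inverse (1 + x\<^sup>2)\<close>, and its integral at most a product of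
  arctangent integrals.\<close>

definition weight :: "'a::euclidean_space \<Rightarrow> real" where
  "weight t = 1 / (1 + norm t) ^ (2 * DIM('a))"

lemma weight_pos: "weight t > 0"
  by (simp add: weight_def add_pos_nonneg)

lemma continuous_on_weight: "continuous_on S weight"
  unfolding weight_def[abs_def] by (intro continuous_intros) (auto simp: add_nonneg_eq_0_iff)

lemma weight_measurable [measurable]: "weight \<in> borel_measurable borel"
  by (intro borel_measurable_continuous_onI continuous_on_weight)

lemma nn_integral_inverse_one_plus_square: "(\<integral>\<^sup>+x. ennreal (inverse (1 + x\<^sup>2)) \<partial>lborel) < \<infinity>" for x :: real
proof -
  let ?f = "\<lambda>x::real. inverse (1 + x\<^sup>2)"
  have half: "(\<integral>\<^sup>+x. ennreal (?f x) * indicator {0..} x \<partial>lborel) = pi / 2 - arctan 0"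
    by (rule nn_integral_FTC_atLeast[OF _ _ _ tendsto_arctan_at_top])
       (auto intro!: DERIV_arctan measurable_compose[OF _ borel_measurable_inverse])
  have "(\<integral>\<^sup>+x. ennreal (?f x) * indicator {0..} x \<partial>lborel) =
      (\<integral>\<^sup>+x. ennreal (?f (- x)) * indicator {0..} (- x) \<partial>lborel)"
    using nn_integral_real_affine[of "\<lambda>x. ennreal (?f x) * indicator {0..} x" "-1" 0] by simp
  moreover have "(\<integral>\<^sup>+x. ennreal (?f x) \<partial>lborel) \<le>
     (\<integral>\<^sup>+x. ennreal (?f x) * indicator {0..} x + ennreal (?f (- x)) * indicator {0..} (- x) \<partial>lborel)"
    by (intro nn_integral_mono) (auto simp: indicator_def)
  moreover have "\<dots> = (\<integral>\<^sup>+x. ennreal (?f x) * indicator {0..} x \<partial>lborel) +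
     (\<integral>\<^sup>+x. ennreal (?f (- x)) * indicator {0..} (- x) \<partial>lborel)"
    by (intro nn_integral_add) auto
  ultimately show ?thesis
    unfolding half by (auto simp: top_unique less_top[symmetric])
qed

lemma weight_le_prod: "weight (t::'a::euclidean_space) \<le> (\<Prod>b\<in>Basis. inverse (1 + (t \<bullet> b)\<^sup>2))"
proof -
  have "(\<Prod>b\<in>Basis. 1 + (t \<bullet> b)\<^sup>2) \<le> (\<Prod>b\<in>(Basis::'a set). (1 + norm t) ^ 2)"
  proof (intro prod_mono conjI)
    fix b :: 'a assume b: "b \<in> Basis"
    have "(t \<bullet> b)\<^sup>2 \<le> (norm t)\<^sup>2"
      using Basis_le_norm[OF b, of t] by (metis abs_ge_zero power2_abs power_mono)
    then show "1 + (t \<bullet> b)\<^sup>2 \<le> (1 + norm t)\<^sup>2"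
      by (simp add: power2_sum add_increasing2)
  qed auto
  also have "\<dots> = (1 + norm t) ^ (2 * DIM('a))"
    by (simp add: power_mult)
  finally have "(\<Prod>b\<in>Basis. 1 + (t \<bullet> b)\<^sup>2) \<le> (1 + norm t) ^ (2 * DIM('a))" .
  moreover have "0 < (\<Prod>b\<in>Basis. 1 + (t \<bullet> b)\<^sup>2)"
    by (intro prod_pos) (auto simp: add_pos_nonneg)
  ultimately show ?thesis
    unfolding weight_def inverse_eq_divide prod_dividef by (simp add: frac_le)
qed

lemma integrable_weight: "integrable lborel (weight :: 'a::euclidean_space \<Rightarrow> real)"
proof (rule integrableI_nonneg)
  have "(\<integral>\<^sup>+t. ennreal (weight (t::'a)) \<partial>lborel) \<le> (\<integral>\<^sup>+t. (\<Prod>b\<in>Basis. ennreal (inverse (1 + (t \<bullet> b)\<^sup>2))) \<partial>(lborel :: 'a measure))"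
    by (intro nn_integral_mono) (auto simp: prod_ennreal intro!: ennreal_leI weight_le_prod)
  also have "\<dots> = (\<Prod>b\<in>(Basis::'a set). (\<integral>\<^sup>+x. ennreal (inverse (1 + x\<^sup>2)) \<partial>lborel))"
    by (rule nn_integral_lborel_prod) auto
  also have "\<dots> < \<infinity>"
    using nn_integral_inverse_one_plus_square by (simp add: power_less_top_ennreal)
  finally show "(\<integral>\<^sup>+t. ennreal (weight (t::'a)) \<partial>lborel) < \<infinity>" .
qed (auto simp: less_imp_le[OF weight_pos])

lemma weight_dominated:
  fixes g :: "'a::euclidean_space \<Rightarrow> complex"
  assumes g: "g \<in> borel_measurable borel" and le: "\<And>t. norm (g t) \<le> B * weight t"
  shows "integrable lborel g" "norm (LINT t|lborel. g t) \<le> B * (LINT t|lborel. weight (t::'a))"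
proof -
  have *: "integrable lborel (\<lambda>t::'a. B * weight t)"
    by (intro integrable_mult_right integrable_weight)
  show "integrable lborel g"
    by (rule Bochner_Integration.integrable_bound[OF *])
       (use g le in \<open>auto intro!: AE_I2 order_trans[OF le]\<close>)
  have "norm (LINT t|lborel. g t) \<le> (LINT t|lborel. B * weight (t::'a))"
    by (rule Bochner_Integration.integral_norm_bound_integral[OF \<open>integrable lborel g\<close> *]) (rule le)
  then show "norm (LINT t|lborel. g t) \<le> B * (LINT t|lborel. weight (t::'a))"
    by simp
qed

text \<open>With \<open>r\<close> the projection to the variables of integration, the bound is
  uniform in the remaining variables; this is the integrable majorant for partial Fourier
  transforms.\<close>

lemma decay_weight:
  fixes r :: "'a::euclidean_space \<Rightarrow> 'b::euclidean_space"
  assumes "decay a f" and r: "\<And>z. norm (r z) \<le> norm z"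
  obtains C where "\<And>i x. norm (f i x) \<le> C * a i * weight (r x)"
proof -
  obtain C where C: "\<And>i x. (1 + norm x) ^ (2 * DIM('b)) * norm (f i x) \<le> C * a i"
    using decay_one_plus[OF assms(1)] by blast
  have "norm (f i x) \<le> C * a i * weight (r x)" for i x
  proof -
    have "(1 + norm (r x)) ^ (2 * DIM('b)) * norm (f i x) \<le> (1 + norm x) ^ (2 * DIM('b)) * norm (f i x)"
      by (intro mult_right_mono power_mono) (auto simp: r)
    also have "\<dots> \<le> C * a i" by (rule C)
    finally show ?thesis
      by (simp add: weight_def pos_le_divide_eq add_pos_nonneg mult.commute)
  qed
  then show ?thesis by (rule that)
qed

lemma derivs_in_measurable:
  fixes f :: "'i \<Rightarrow> 'a::euclidean_space \<Rightarrow> complex"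
  assumes "derivs_in Q f" shows "f i \<in> borel_measurable borel"
  by (intro borel_measurable_continuous_onI derivs_in_continuous[OF assms])

lemma schwartz_integrable: "schwartz f \<Longrightarrow> integrable lborel f"
proof -
  assume "schwartz f"
  then have f: "derivs_in (decay (\<lambda>_. 1)) (\<lambda>_::unit. f)"
    by (simp add: schwartz_iff_derivs_in)
  obtain C where "\<And>i x. norm ((\<lambda>_::unit. f) i x) \<le> C * 1 * weight x"
    using decay_weight[OF derivs_in_base[OF f], of "\<lambda>x. x"] by auto
  then show ?thesis
    using weight_dominated(1)[OF derivs_in_measurable[OF f]] by auto
qed

subsection \<open>Multiplication by linear functionals\<close>

lemma derivs_in_step:
  assumes "Q f" "\<And>i x. f i differentiable (at x)"
    and "\<And>e. e \<in> Basis \<Longrightarrow> derivs_in Q (\<lambda>i. dir_deriv e (f i))"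
  shows "derivs_in Q f"
  unfolding derivs_in_def
proof
  fix n show "derivs_upto n Q f"
    using assms by (cases n) (simp_all add: derivs_in_def)
qed

lemma derivs_in_const:
  assumes "\<And>c. Q (\<lambda>i x. c)"
  shows "derivs_in Q (\<lambda>i x. c)"
proof -
  have "derivs_upto n Q (\<lambda>i x. c)" for n c
    by (induction n arbitrary: c) (simp_all add: assms)
  then show ?thesis by (simp add: derivs_in_def)
qed

lemma derivs_in_linear_functional:
  fixes l :: "'a::euclidean_space \<Rightarrow> real"
  assumes l: "linear l"
  shows "derivs_in (growth (\<lambda>_::'i. 1)) (\<lambda>_ x. complex_of_real (l x))"
proof (rule derivs_in_step)
  obtain B where B: "\<And>x. norm (l x) \<le> B * norm x"
    using linear_bounded[OF l] by blast
  have "norm (complex_of_real (l x)) \<le> \<bar>B\<bar> * 1 * (1 + norm x) ^ 1" for x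
  proof -
    have "norm (l x) \<le> \<bar>B\<bar> * norm x"
      by (rule order_trans[OF B]) (auto intro: mult_right_mono)
    then show ?thesis by (simp add: algebra_simps)
  qed
  then show "growth (\<lambda>_::'i. 1) (\<lambda>_ x. complex_of_real (l x))"
    unfolding growth_def by blast
  have der: "((\<lambda>x. complex_of_real (l x)) has_derivative (\<lambda>v. complex_of_real (l v))) (at x)" for x
    using l by (intro has_derivative_of_real bounded_linear_imp_has_derivative) (simp add: linear_conv_bounded_linear)
  then show "(\<lambda>x. complex_of_real (l x)) differentiable (at x)" for x
    by (auto simp: differentiable_def)
  have "dir_deriv e (\<lambda>x. complex_of_real (l x)) = (\<lambda>x. complex_of_real (l e))" for e
    by (intro ext dir_deriv_eqI[OF der])
  moreover have base: "growth (\<lambda>_::'i. 1) (\<lambda>i x::'a. c)" for c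
    unfolding growth_def by (intro exI[of _ "norm c"] exI[of _ 0]) simp
  have "derivs_in (growth (\<lambda>_::'i. 1)) (\<lambda>i x::'a. c)" for c
    by (rule derivs_in_const) (rule base)
  ultimately show "derivs_in (growth (\<lambda>_::'i. 1)) (\<lambda>_. dir_deriv e (\<lambda>x. complex_of_real (l x)))" for e
    by simp
qed

lemma derivs_in_decay_mult:
  assumes "derivs_in (decay a) f" "derivs_in (growth c) g"
  shows "derivs_in (decay (\<lambda>i. a i * c i)) (\<lambda>i x. f i x * g i x)"
  by (rule derivs_in_mult[OF function_space_decay _ assms]) (rule decay_mult_growth)

lemma derivs_in_decay_linear_functional:
  assumes "derivs_in (decay a) f" "linear l"
  shows "derivs_in (decay a) (\<lambda>i x. complex_of_real (l x) * f i x)"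
  using derivs_in_decay_mult[OF assms(1) derivs_in_linear_functional[OF assms(2)]] by (simp add: mult.commute)

subsection \<open>Second-order estimates\<close>

text \<open>This is how derivatives pass through integrals and distributions: the remainder estimate
  is integrated, or fed to the functional, before any limit is taken.\<close>

lemma has_derivative_quadratic:
  fixes F :: "'a::euclidean_space \<Rightarrow> complex"
  assumes L: "linear L" and \<delta>: "\<delta> > 0"
    and le: "\<And>h. norm h < \<delta> \<Longrightarrow> norm (F (z + h) - F z - L h) \<le> B * (norm h)\<^sup>2"
  shows "(F has_derivative L) (at z)"
proof (rule has_derivativeI_sandwich[OF \<delta>])
  show "bounded_linear L" using L by (simp add: linear_conv_bounded_linear)
  show "norm (F y - F z - L (y - z)) / norm (y - z) \<le> B * norm (y - z)"
    if "y \<noteq> z" "dist y z < \<delta>" for y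
    using le[of "y - z"] that by (simp add: dist_norm divide_le_eq power2_eq_square mult.assoc)
  show "((\<lambda>y. B * norm (y - z)) \<longlongrightarrow> 0) (at z)"
    by (auto intro!: tendsto_eq_intros)
qed

lemma norm_dir_deriv_le:
  fixes f :: "'a::euclidean_space \<Rightarrow> complex"
  assumes "f differentiable (at x)"
  shows "norm (dir_deriv v f x) \<le> norm v * (\<Sum>e\<in>Basis. norm (dir_deriv e f x))"
proof -
  have "norm (dir_deriv v f x) \<le> (\<Sum>e\<in>Basis. norm (of_real (v \<bullet> e) * dir_deriv e f x))"
    unfolding dir_deriv_expand[OF assms, of v] by (rule norm_sum)
  also have "\<dots> \<le> (\<Sum>e\<in>Basis. norm v * norm (dir_deriv e f x))"
    by (intro sum_mono) (auto simp: norm_mult intro!: mult_right_mono Basis_le_norm)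
  finally show ?thesis by (simp add: sum_distrib_left)
qed

lemma first_order_bound:
  assumes f: "derivs_in (decay a) f"
  obtains C where "\<And>i x v. (1 + norm x) ^ k * norm (dir_deriv v (f i) x) \<le> C * norm v * a i"
proof -
  have "\<exists>C. \<forall>i x. (1 + norm x) ^ k * norm (dir_deriv e (f i) x) \<le> C * a i" for e
    using decay_one_plus[OF derivs_in_base[OF derivs_in_dir_deriv'[OF function_space_decay f, of e]], of k] by metis
  then obtain C where C: "\<And>e i x. (1 + norm x) ^ k * norm (dir_deriv e (f i) x) \<le> C e * a i"
    unfolding choice_iff by metis
  have "(1 + norm x) ^ k * norm (dir_deriv v (f i) x) \<le> (\<Sum>e\<in>Basis. C e) * norm v * a i" for i x v
  proof -
    have "(1 + norm x) ^ k * norm (dir_deriv v (f i) x) \<le>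
        (1 + norm x) ^ k * (norm v * (\<Sum>e\<in>Basis. norm (dir_deriv e (f i) x)))"
      by (intro mult_left_mono norm_dir_deriv_le derivs_in_differentiable[OF f]) auto
    also have "\<dots> = norm v * (\<Sum>e\<in>Basis. (1 + norm x) ^ k * norm (dir_deriv e (f i) x))"
      by (simp add: sum_distrib_left mult_ac)
    also have "\<dots> \<le> norm v * (\<Sum>e\<in>Basis. C e * a i)"
      by (intro mult_left_mono sum_mono C) auto
    finally show ?thesis by (simp add: sum_distrib_left sum_distrib_right mult_ac)
  qed
  then show ?thesis by (rule that)
qed

text \<open>Expansion over \<open>Basis\<close> makes a bound uniform in the outer direction.
  Commuting the derivatives brings each of the two directions to the outer place in turn.\<close>

lemma second_order_bound:
  assumes f: "derivs_in (decay a) f"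
  obtains C where
    "\<And>i x v u. (1 + norm x) ^ k * norm (dir_deriv u (dir_deriv v (f i)) x) \<le> C * norm u * norm v * a i"
proof -
  have "\<exists>C. \<forall>i x v. (1 + norm x) ^ k * norm (dir_deriv v (dir_deriv e (f i)) x) \<le> C * norm v * a i" for e
    using first_order_bound[OF derivs_in_dir_deriv'[OF function_space_decay f, of e], of k] by metis
  then obtain C where C: "\<And>e i x v. (1 + norm x) ^ k * norm (dir_deriv v (dir_deriv e (f i)) x) \<le> C e * norm v * a i"
    unfolding choice_iff by metis
  have "(1 + norm x) ^ k * norm (dir_deriv u (dir_deriv v (f i)) x) \<le> (\<Sum>e\<in>Basis. C e) * norm u * norm v * a i" for i x v u
  proof -
    have "(1 + norm x) ^ k * norm (dir_deriv u (dir_deriv v (f i)) x) \<le>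
        (1 + norm x) ^ k * (norm v * (\<Sum>e\<in>Basis. norm (dir_deriv e (dir_deriv u (f i)) x)))"
      unfolding derivs_in_commute[OF f, of u v]
      by (intro mult_left_mono norm_dir_deriv_le derivs_in_differentiable_dir[OF f]) auto
    also have "\<dots> = norm v * (\<Sum>e\<in>Basis. (1 + norm x) ^ k * norm (dir_deriv u (dir_deriv e (f i)) x))"
      by (simp add: sum_distrib_left mult_ac derivs_in_commute[OF f, of u])
    also have "\<dots> \<le> norm v * (\<Sum>e\<in>Basis. C e * norm u * a i)"
      by (intro mult_left_mono sum_mono C) auto
    finally show ?thesis by (simp add: sum_distrib_left sum_distrib_right mult_ac)
  qed
  then show ?thesis by (rule that)
qed

text \<open>Moving the argument of a partial transform shifts the free variables by \<open>u\<close>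
  and changes the frequency by \<open>c\<close> at the same time. Both are treated along the single
  curve \<open>s \<mapsto> f (w + s *\<^sub>R u) * cis (\<theta> * s)\<close>; \<open>c = 0\<close>
  is the ordinary Taylor estimate.\<close>

lemma twisted_taylor:
  fixes f :: "'a::euclidean_space \<Rightarrow> complex" and r :: "'a \<Rightarrow> 'b::euclidean_space"
  assumes f: "schwartz f" and r: "\<And>z. norm (r z) \<le> norm z"
  obtains C where "\<And>w u c. norm u \<le> 1 \<Longrightarrow>
    norm (f (w + u) * cis (- 2 * pi * (c \<bullet> r w)) - f w -
      (dir_deriv u f w - 2 * pi * \<i> * (c \<bullet> r w) * f w)) \<le> C * (norm u + norm c)\<^sup>2 * weight (r w)"
proof -
  define K where "K = 2 * DIM('b)"
  have F: "derivs_in (decay (\<lambda>_. 1)) (\<lambda>_::unit. f)"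
    using f by (simp add: schwartz_iff_derivs_in)
  \<comment> \<open>Each factor \<open>\<theta>\<close> grows linearly with the position, and at
    most two of them occur in a term of \<open>g''\<close>. The two extra powers pay for them and
    leave the power \<open>K\<close> of the weight.\<close>
  obtain C0 where C0: "\<And>x. (1 + norm x) ^ (K + 2) * norm (f x) \<le> C0"
    using decay_one_plus[OF derivs_in_base[OF F], of "K + 2"] by auto
  obtain C1 where C1: "\<And>x v. (1 + norm x) ^ (K + 2) * norm (dir_deriv v f x) \<le> C1 * norm v"
    using first_order_bound[OF F, of "K + 2"] by auto
  obtain C2 where C2: "\<And>x v u. (1 + norm x) ^ (K + 2) * norm (dir_deriv u (dir_deriv v f) x) \<le> C2 * norm u * norm v"
    using second_order_bound[OF F, of "K + 2"] by auto
  \<comment> \<open>\<open>C'\<close> collects the coefficients of \<open>g''\<close>: the second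
    derivative, \<open>2 * \<theta>\<close> times the first, and \<open>\<theta>\<^sup>2\<close>
    times \<open>f\<close>. In \<open>C\<close>, the 4 comes from \<open>(2 * y)\<^sup>2\<close>,
    and \<open>2 ^ K\<close> from passing from \<open>y = 1 + norm x\<close> to
    \<open>1 + norm (r w) \<le> 2 * y\<close>.\<close>
  define C' where "C' = \<bar>C2\<bar> + 2 * (2 * pi) * \<bar>C1\<bar> + (2 * pi)\<^sup>2 * \<bar>C0\<bar>"
  define C where "C = 2 ^ K * (4 * C')"
  show ?thesis
  proof (rule that[of C])
    fix w u :: 'a and c :: 'b assume u: "norm u \<le> 1"
    define \<theta> where "\<theta> = - 2 * pi * (c \<bullet> r w)"
    define g where "g s = f (w + s *\<^sub>R u) * cis (\<theta> * s)" for s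
    define g' where "g' s = dir_deriv u f (w + s *\<^sub>R u) * cis (\<theta> * s) + f (w + s *\<^sub>R u) * (\<i> * \<theta> * cis (\<theta> * s))" for s
    define g'' where "g'' s = (dir_deriv u (dir_deriv u f) (w + s *\<^sub>R u) + 2 * \<i> * \<theta> * dir_deriv u f (w + s *\<^sub>R u)
        - \<theta>\<^sup>2 * f (w + s *\<^sub>R u)) * cis (\<theta> * s)" for s
    have cis: "((\<lambda>s. cis (\<theta> * s)) has_vector_derivative \<i> * \<theta> * cis (\<theta> * s)) (at s)" for s
      unfolding has_vector_derivative_def
      by (auto intro!: derivative_eq_intros simp: scaleR_conv_of_real algebra_simps)
    have d0: "((\<lambda>s. f (w + s *\<^sub>R u)) has_vector_derivative dir_deriv u f (w + s *\<^sub>R u)) (at s)" for s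
      by (intro has_vector_derivative_line derivs_in_differentiable[OF F])
    have d1: "((\<lambda>s. dir_deriv u f (w + s *\<^sub>R u)) has_vector_derivative dir_deriv u (dir_deriv u f) (w + s *\<^sub>R u)) (at s)" for s
      by (intro has_vector_derivative_line derivs_in_differentiable_dir[OF F])
    have g: "(g has_vector_derivative g' s) (at s)" for s
      unfolding g_def[abs_def] g'_def
      using has_vector_derivative_mult[OF d0 cis, of s] by (simp add: add.commute)
    have g': "(g' has_vector_derivative g'' s) (at s)" for s
      unfolding g'_def[abs_def] g''_def
      by (rule has_vector_derivative_eq_rhs[OF has_vector_derivative_add[OF
            has_vector_derivative_mult[OF d1 cis] has_vector_derivative_mult[OF d0
            has_vector_derivative_mult_right[OF cis]]]]) (simp add: algebra_simps power2_eq_square)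
    have "norm (g'' s) \<le> C * (norm u + norm c)\<^sup>2 * weight (r w)" if s: "s \<in> {0..1}" for s
    proof -
      define x where "x = w + s *\<^sub>R u"
      define y where "y = 1 + norm x"
      have y: "y > 0" by (simp add: y_def add_pos_nonneg)
      have 1: "norm w \<le> norm x + norm (s *\<^sub>R u)"
        unfolding x_def by (metis add_diff_cancel_right' norm_triangle_ineq4)
      have 2: "norm (s *\<^sub>R u) \<le> 1"
        using s u by (simp add: mult_le_one)
      have "norm w \<le> norm x + 1"
        by (rule order_trans[OF 1 add_left_mono[OF 2]])
      then have wy: "1 + norm (r w) \<le> 2 * y"
        using order_trans[OF r[of w]] norm_ge_zero[of x] unfolding y_def by (smt (verit))
      have \<theta>: "\<bar>\<theta>\<bar> \<le> 2 * pi * (norm c * (2 * y))"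
      proof -
        have "\<bar>c \<bullet> r w\<bar> \<le> norm c * norm (r w)" by (rule Cauchy_Schwarz_ineq2)
        also have "\<dots> \<le> norm c * (2 * y)" using wy by (intro mult_left_mono) auto
        finally show ?thesis by (simp add: \<theta>_def abs_mult mult_ac)
      qed
      let ?n = "norm u + norm c"
      have y1: "1 \<le> y" by (simp add: y_def)
      have e2: "y ^ (K + 2) * norm (dir_deriv u (dir_deriv u f) x) \<le> \<bar>C2\<bar> * ?n\<^sup>2"
      proof -
        have "y ^ (K + 2) * norm (dir_deriv u (dir_deriv u f) x) \<le> C2 * norm u * norm u"
          unfolding y_def by (rule C2)
        also have "\<dots> \<le> \<bar>C2\<bar> * (?n * ?n)"
          unfolding mult.assoc by (intro mult_mono) auto
        finally show ?thesis by (simp add: power2_eq_square)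
      qed
      have e1: "y ^ (K + 2) * (2 * \<bar>\<theta>\<bar> * norm (dir_deriv u f x)) \<le> 2 * (2 * pi) * \<bar>C1\<bar> * ?n\<^sup>2 * (2 * y)"
      proof -
        have "y ^ (K + 2) * (2 * \<bar>\<theta>\<bar> * norm (dir_deriv u f x)) = 2 * \<bar>\<theta>\<bar> * (y ^ (K + 2) * norm (dir_deriv u f x))"
          by simp
        also have "\<dots> \<le> 2 * (2 * pi * (norm c * (2 * y))) * (\<bar>C1\<bar> * norm u)"
        proof (rule mult_mono)
          show "y ^ (K + 2) * norm (dir_deriv u f x) \<le> \<bar>C1\<bar> * norm u"
            unfolding y_def by (rule order_trans[OF C1]) (auto intro: mult_right_mono)
        qed (use \<theta> y in \<open>auto simp: mult_ac\<close>)
        also have "\<dots> = 2 * (2 * pi) * \<bar>C1\<bar> * (norm c * norm u) * (2 * y)" by simp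
        also have "\<dots> \<le> 2 * (2 * pi) * \<bar>C1\<bar> * (?n * ?n) * (2 * y)"
          using y by (intro mult_right_mono mult_left_mono mult_mono) auto
        finally show ?thesis by (simp add: power2_eq_square)
      qed
      have e0: "y ^ (K + 2) * (\<theta>\<^sup>2 * norm (f x)) \<le> (2 * pi)\<^sup>2 * \<bar>C0\<bar> * ?n\<^sup>2 * (2 * y)\<^sup>2"
      proof -
        have "y ^ (K + 2) * (\<theta>\<^sup>2 * norm (f x)) = \<theta>\<^sup>2 * (y ^ (K + 2) * norm (f x))"
          by simp
        also have "\<dots> \<le> (2 * pi * (norm c * (2 * y)))\<^sup>2 * \<bar>C0\<bar>"
        proof (rule mult_mono)
          show "y ^ (K + 2) * norm (f x) \<le> \<bar>C0\<bar>"
            unfolding y_def by (rule order_trans[OF C0]) auto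
          show "\<theta>\<^sup>2 \<le> (2 * pi * (norm c * (2 * y)))\<^sup>2"
            using \<theta> by (metis abs_ge_zero power2_abs power_mono)
        qed (use y in auto)
        also have "\<dots> = (2 * pi)\<^sup>2 * \<bar>C0\<bar> * (norm c)\<^sup>2 * (2 * y)\<^sup>2" by (simp add: power_mult_distrib)
        also have "\<dots> \<le> (2 * pi)\<^sup>2 * \<bar>C0\<bar> * ?n\<^sup>2 * (2 * y)\<^sup>2"
          using y by (intro mult_right_mono mult_left_mono power_mono) auto
        finally show ?thesis .
      qed
      have "y ^ (K + 2) * norm (g'' s) \<le> y ^ (K + 2) * (norm (dir_deriv u (dir_deriv u f) x) +
          2 * \<bar>\<theta>\<bar> * norm (dir_deriv u f x) + \<theta>\<^sup>2 * norm (f x))"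
      proof (intro mult_left_mono)
        have "norm (g'' s) = norm (dir_deriv u (dir_deriv u f) x + 2 * \<i> * \<theta> * dir_deriv u f x - \<theta>\<^sup>2 * f x)"
          unfolding g''_def x_def[symmetric] norm_mult norm_cis by simp
        also have "\<dots> \<le> norm (dir_deriv u (dir_deriv u f) x) + norm (2 * \<i> * \<theta> * dir_deriv u f x) + norm (\<theta>\<^sup>2 * f x)"
          by (intro order_trans[OF norm_triangle_ineq4] add_right_mono norm_triangle_ineq)
        finally show "norm (g'' s) \<le> norm (dir_deriv u (dir_deriv u f) x) +
            2 * \<bar>\<theta>\<bar> * norm (dir_deriv u f x) + \<theta>\<^sup>2 * norm (f x)"
          by (simp add: norm_mult norm_power)
      qed (use y in auto)
      also have "\<dots> \<le> \<bar>C2\<bar> * ?n\<^sup>2 + 2 * (2 * pi) * \<bar>C1\<bar> * ?n\<^sup>2 * (2 * y) + (2 * pi)\<^sup>2 * \<bar>C0\<bar> * ?n\<^sup>2 * (2 * y)\<^sup>2"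
        unfolding distrib_left by (intro add_mono e0 e1 e2)
      also have "\<dots> \<le> \<bar>C2\<bar> * ?n\<^sup>2 * (2 * y)\<^sup>2 + 2 * (2 * pi) * \<bar>C1\<bar> * ?n\<^sup>2 * (2 * y)\<^sup>2 + (2 * pi)\<^sup>2 * \<bar>C0\<bar> * ?n\<^sup>2 * (2 * y)\<^sup>2"
      proof (intro add_right_mono add_mono)
        have "1 \<le> (2 * y)\<^sup>2" using y1 by (intro one_le_power) auto
        then show "\<bar>C2\<bar> * ?n\<^sup>2 \<le> \<bar>C2\<bar> * ?n\<^sup>2 * (2 * y)\<^sup>2"
          using mult_left_mono[of 1 "(2 * y)\<^sup>2" "\<bar>C2\<bar> * ?n\<^sup>2"] by simp
        have "(2 * y) \<le> (2 * y)\<^sup>2" using y1 by (simp add: power2_eq_square)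
        then show "2 * (2 * pi) * \<bar>C1\<bar> * ?n\<^sup>2 * (2 * y) \<le> 2 * (2 * pi) * \<bar>C1\<bar> * ?n\<^sup>2 * (2 * y)\<^sup>2"
          by (intro mult_left_mono) auto
      qed
      also have "\<dots> = C' * ?n\<^sup>2 * (2 * y)\<^sup>2"
        by (simp add: C'_def algebra_simps)
      finally have "y\<^sup>2 * (y ^ K * norm (g'' s)) \<le> y\<^sup>2 * (4 * C' * ?n\<^sup>2)"
        by (simp add: power_add power_mult_distrib power2_eq_square mult_ac)
      then have "y ^ K * norm (g'' s) \<le> 4 * C' * ?n\<^sup>2"
        using y by (simp add: mult_le_cancel_left_pos)
      from mult_left_mono[OF this, of "2 ^ K"] have "(2 * y) ^ K * norm (g'' s) \<le> C * ?n\<^sup>2"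
        by (simp add: C_def power_mult_distrib mult_ac)
      moreover have "(1 + norm (r w)) ^ K * norm (g'' s) \<le> (2 * y) ^ K * norm (g'' s)"
        using wy by (intro mult_right_mono power_mono) auto
      ultimately have "(1 + norm (r w)) ^ K * norm (g'' s) \<le> C * ?n\<^sup>2"
        by (rule order_trans[rotated])
      then show ?thesis
        unfolding weight_def K_def[symmetric] by (simp add: pos_le_divide_eq add_pos_nonneg mult.commute[of _ "(1 + norm (r w)) ^ K"])
    qed
    from taylor_line[OF g g' this] have "norm (g 1 - g 0 - g' 0) \<le> C * (norm u + norm c)\<^sup>2 * weight (r w)" by blast
    then show "norm (f (w + u) * cis (- 2 * pi * (c \<bullet> r w)) - f w -
      (dir_deriv u f w - 2 * pi * \<i> * (c \<bullet> r w) * f w)) \<le> C * (norm u + norm c)\<^sup>2 * weight (r w)"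
      by (simp add: g_def g'_def \<theta>_def algebra_simps)
  qed
qed

subsection \<open>Partial Fourier transforms\<close>

lemma lborel_translate:
  fixes g :: "'b::euclidean_space \<Rightarrow> complex"
  assumes [measurable]: "g \<in> borel_measurable borel"
  shows "(LINT t|lborel. g (c + t)) = (LINT t|lborel. g t)"
    and "integrable lborel (\<lambda>t. g (c + t)) \<longleftrightarrow> integrable lborel g"
proof -
  have "(LINT t|lborel. g t) = (LINT t|distr lborel borel ((+) c). g t)"
    by (simp only: lborel_distr_plus)
  also have "\<dots> = (LINT t|lborel. g (c + t))"
    by (rule integral_distr) auto
  finally show "(LINT t|lborel. g (c + t)) = (LINT t|lborel. g t)" ..
  have "integrable lborel g \<longleftrightarrow> integrable (distr lborel borel ((+) c)) g"
    by (simp only: lborel_distr_plus)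
  also have "\<dots> \<longleftrightarrow> integrable lborel (\<lambda>t. g (c + t))"
    by (rule integrable_distr_eq) auto
  finally show "integrable lborel (\<lambda>t. g (c + t)) \<longleftrightarrow> integrable lborel g" ..
qed

text \<open>The partial Fourier transform in the directions of the range of an isometry \<open>j\<close>;
  \<open>r\<close> is the adjoint of \<open>j\<close>. With \<open>j\<close> the identity this is the full Fourier transform.\<close>

locale splitting =
  fixes j :: "'b::euclidean_space \<Rightarrow> 'a::euclidean_space" and r :: "'a \<Rightarrow> 'b"
  assumes linear_j: "linear j" and linear_r: "linear r" and r_j [simp]: "r (j t) = t"
    and norm_r: "norm (r z) \<le> norm z"
begin

definition q :: "'a \<Rightarrow> 'a" where "q z = z - j (r z)"

definition pft :: "('a \<Rightarrow> complex) \<Rightarrow> 'a \<Rightarrow> complex" where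
  "pft f z = (LINT t|lborel. f (q z + j t) * cis (- 2 * pi * (r z \<bullet> t)))"

text \<open>The derivative of \<open>pft f\<close> in direction \<open>v\<close> is
  \<open>pft (twist v f)\<close>: the part of \<open>v\<close> in the free variables differentiates
  \<open>f\<close>, and the part in the frequencies brings down the variable of integration, which
  is \<open>r w\<close>.\<close>

definition twist :: "'a \<Rightarrow> ('a \<Rightarrow> complex) \<Rightarrow> 'a \<Rightarrow> complex" where
  "twist v f w = dir_deriv (q v) f w - 2 * pi * \<i> * (r v \<bullet> r w) * f w"

lemma linear_q: "linear q"
  unfolding q_def[abs_def] by (intro linear_compose_sub linear_compose[OF linear_r linear_j, unfolded o_def] linear_ident)

lemma r_q [simp]: "r (q z + j t) = t"
  by (simp add: q_def linear_add[OF linear_r] linear_diff[OF linear_r])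

lemma r_q_0 [simp]: "r (q z) = 0"
  by (simp add: q_def linear_diff[OF linear_r])

lemma q_q [simp]: "q (q z + j t) = q z"
proof -
  have "q (q z + j t) = q z + j t - j t" unfolding q_def[of "q z + j t"] by simp
  then show ?thesis by simp
qed

lemma continuous_j: "continuous_on S j"
  using linear_j by (simp add: linear_continuous_on linear_conv_bounded_linear)

lemma measurable_integrand:
  assumes "schwartz f"
  shows "(\<lambda>t. f (w + j t) * cis (- 2 * pi * (c \<bullet> t))) \<in> borel_measurable borel"
proof (rule borel_measurable_continuous_onI)
  have "continuous_on UNIV f"
    using derivs_in_continuous[OF schwartz_imp_derivs_in[OF assms]] .
  then have "continuous_on UNIV (\<lambda>t. f (w + j t))"
    by (rule continuous_on_compose2) (auto intro!: continuous_intros continuous_j)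
  then show "continuous_on UNIV (\<lambda>t. f (w + j t) * cis (- 2 * pi * (c \<bullet> t)))"
    by (intro continuous_intros) auto
qed

lemma pft_integrable:
  assumes "schwartz f"
  shows "integrable lborel (\<lambda>t. f (q z + j t) * cis (- 2 * pi * (c \<bullet> t)))"
proof -
  obtain C where C: "\<And>x. norm (f x) \<le> C * weight (r x)"
    using decay_weight[OF derivs_in_base[OF assms[unfolded schwartz_iff_derivs_in]], of r] norm_r by auto
  show ?thesis
    by (rule weight_dominated(1)[OF measurable_integrand[OF assms], of _ _ C])
       (use C in \<open>auto simp: norm_mult intro: order_trans[OF C]\<close>)
qed

lemma pft_bound:
  assumes f: "derivs_in (decay a) f"
  obtains C where "\<And>i z. norm (pft (f i) z) \<le> C * a i"
proof -
  obtain C where C: "\<And>i x. norm (f i x) \<le> C * a i * weight (r x)"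
    using decay_weight[OF derivs_in_base[OF f], of r] norm_r by blast
  have "norm (pft (f i) z) \<le> (C * (LINT t|lborel. weight (t::'b))) * a i" for i z
  proof -
    have "norm (f i (q z + j t) * cis (- 2 * pi * (r z \<bullet> t))) \<le> (C * a i) * weight t" for t
      using C[of i "q z + j t"] by (simp add: norm_mult)
    from weight_dominated(2)[OF measurable_integrand[OF derivs_in_imp_schwartz[OF f]] this]
    show ?thesis by (simp add: pft_def mult_ac)
  qed
  then show ?thesis by (rule that)
qed

lemma pft_add: "schwartz f \<Longrightarrow> schwartz g \<Longrightarrow> pft (\<lambda>w. f w + g w) z = pft f z + pft g z"
  unfolding pft_def distrib_right by (intro Bochner_Integration.integral_add pft_integrable)

lemma pft_cmult: "pft (\<lambda>w. c * f w) z = c * pft f z"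
  unfolding pft_def mult.assoc by simp

lemma derivs_in_twist:
  assumes f: "derivs_in (decay a) f"
  shows "derivs_in (decay a) (\<lambda>i. twist v (f i))"
proof -
  have "linear (\<lambda>w. r v \<bullet> r w)"
    using linear_r by (intro linearI) (simp_all add: linear_add linear_cmul inner_add_right)
  then have "derivs_in (decay a) (\<lambda>i w. dir_deriv (q v) (f i) w - (2 * pi * \<i>) * (complex_of_real (r v \<bullet> r w) * f i w))"
    by (intro derivs_in_diff function_space_decay derivs_in_dir_deriv' f derivs_in_cmult derivs_in_decay_linear_functional)
  then show ?thesis
    unfolding twist_def[abs_def] by (simp add: mult.assoc)
qed

lemma schwartz_twist: "schwartz f \<Longrightarrow> schwartz (twist v f)"
  unfolding schwartz_iff_derivs_in by (rule derivs_in_twist)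

lemma has_derivative_pft:
  assumes f: "schwartz f"
  shows "(pft f has_derivative (\<lambda>v. pft (twist v f) z)) (at z)"
proof -
  have df: "f differentiable (at x)" for x
    by (rule derivs_in_differentiable[OF schwartz_imp_derivs_in[OF f]])
  have "linear (\<lambda>v. pft (twist v f) z)"
  proof (rule linearI)
    fix v v'
    have "twist (v + v') f = (\<lambda>w. twist v f w + twist v' f w)"
      by (simp add: twist_def fun_eq_iff linear_add[OF linear_q] linear_add[OF linear_r]
          linear_add[OF linear_dir_deriv[OF df]] inner_add_left algebra_simps)
    then show "pft (twist (v + v') f) z = pft (twist v f) z + pft (twist v' f) z"
      by (simp add: pft_add schwartz_twist f)
  next
    fix c v
    have "twist (c *\<^sub>R v) f = (\<lambda>w. of_real c * twist v f w)"
      by (simp add: twist_def fun_eq_iff linear_cmul[OF linear_q] linear_cmul[OF linear_r]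
          linear_cmul[OF linear_dir_deriv[OF df]] scaleR_conv_of_real algebra_simps)
    then show "pft (twist (c *\<^sub>R v) f) z = c *\<^sub>R pft (twist v f) z"
      by (simp add: pft_cmult scaleR_conv_of_real)
  qed
  moreover obtain K where K: "K > 0" "\<And>h. norm (q h) \<le> K * norm h"
    using linear_bounded_pos[OF linear_q] by blast
  obtain C where C: "\<And>w u c. norm u \<le> 1 \<Longrightarrow>
    norm (f (w + u) * cis (- 2 * pi * (c \<bullet> r w)) - f w -
      (dir_deriv u f w - 2 * pi * \<i> * (c \<bullet> r w) * f w)) \<le> C * (norm u + norm c)\<^sup>2 * weight (r w)"
    using twisted_taylor[OF f norm_r] by blast
  \<comment> \<open>The radius \<open>1 / K\<close> makes \<open>norm (q h) \<le> 1\<close>, as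
    \<open>twisted_taylor\<close> requires.\<close>
  have "norm (pft f (z + h) - pft f z - pft (twist h f) z) \<le>
      (\<bar>C\<bar> * (K + 1)\<^sup>2 * (LINT t|lborel. weight (t::'b))) * (norm h)\<^sup>2" if h: "norm h < 1 / K" for h
  proof -
    let ?e = "\<lambda>t. cis (- 2 * pi * (r z \<bullet> t))"
    let ?w = "\<lambda>t. q z + j t"
    define R where "R t = f (?w t + q h) * cis (- 2 * pi * (r (z + h) \<bullet> t)) - f (?w t) * ?e t - twist h f (?w t) * ?e t" for t
    have qzh: "q (z + h) + j t = ?w t + q h" for t
      by (simp add: linear_add[OF linear_q])
    have int: "integrable lborel (\<lambda>t. f (?w t + q h) * cis (- 2 * pi * (r (z + h) \<bullet> t)))"
      using pft_integrable[OF f, of "z + h" "r (z + h)"] by (simp only: qzh)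
    have "pft f (z + h) - pft f z - pft (twist h f) z = (LINT t|lborel. R t)"
      unfolding pft_def R_def qzh
      by (subst Bochner_Integration.integral_diff,
          (intro Bochner_Integration.integrable_diff int pft_integrable f schwartz_twist)+)+ simp
    moreover have "norm (LINT t|lborel. R t) \<le> (\<bar>C\<bar> * (K + 1)\<^sup>2 * (norm h)\<^sup>2) * (LINT t|lborel. weight (t::'b))"
    proof (rule weight_dominated(2))
      have "integrable lborel R"
        unfolding R_def[abs_def] by (intro Bochner_Integration.integrable_diff int pft_integrable f schwartz_twist)
      then show "R \<in> borel_measurable borel" by simp
      fix t
      \<comment> \<open>The new frequency is \<open>r z + r h\<close>, and
        \<open>t = r (?w t)\<close>. So the unimodular factor \<open>?e t\<close> comes out and
        leaves the difference of \<open>twisted_taylor\<close> with \<open>u = q h\<close> and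
        \<open>c = r h\<close>.\<close>
      have "R t = (f (?w t + q h) * cis (- 2 * pi * (r h \<bullet> r (?w t))) - f (?w t) - twist h f (?w t)) * ?e t"
        by (simp add: R_def linear_add[OF linear_r] inner_add_left algebra_simps cis_mult)
      then have "norm (R t) = norm (f (?w t + q h) * cis (- 2 * pi * (r h \<bullet> r (?w t))) - f (?w t) - twist h f (?w t))"
        by (simp add: norm_mult)
      also have "\<dots> \<le> C * (norm (q h) + norm (r h))\<^sup>2 * weight (r (?w t))"
        unfolding twist_def
      proof (rule C)
        have "norm (q h) \<le> K * norm h" by (rule K)
        also have "\<dots> \<le> 1" using h K(1) by (simp add: field_simps)
        finally show "norm (q h) \<le> 1" .
      qed
      also have "\<dots> \<le> \<bar>C\<bar> * ((K + 1) * norm h)\<^sup>2 * weight t"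
      proof (simp only: r_q, intro mult_right_mono mult_mono power_mono)
        show "norm (q h) + norm (r h) \<le> (K + 1) * norm h"
          using K(2)[of h] norm_r[of h] by (simp add: algebra_simps)
      qed (auto simp: less_imp_le[OF weight_pos])
      finally show "norm (R t) \<le> (\<bar>C\<bar> * (K + 1)\<^sup>2 * (norm h)\<^sup>2) * weight t"
        by (simp add: power_mult_distrib mult_ac)
    qed
    ultimately show ?thesis by (simp add: mult_ac)
  qed
  ultimately show ?thesis
    using K(1) by (intro has_derivative_quadratic[of _ "1 / K"]) auto
qed

text \<open>Integration by parts without boundary terms: translating \<open>f\<close> along
  \<open>j b\<close> multiplies the transform by a character, and both sides of this identity are
  differentiated at 0.\<close>

lemma pft_dir_deriv_j:
  assumes f: "schwartz f"
  shows "pft (dir_deriv (j b) f) z = 2 * pi * \<i> * (r z \<bullet> b) * pft f z"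
proof -
  let ?D = "pft (dir_deriv (j b) f) z" and ?\<kappa> = "r z \<bullet> b"
  let ?e = "\<lambda>t. cis (- 2 * pi * (r z \<bullet> t))"
  let ?w = "\<lambda>t. q z + j t"
  have df: "f differentiable (at x)" for x
    by (rule derivs_in_differentiable[OF schwartz_imp_derivs_in[OF f]])
  have sD: "schwartz (dir_deriv v f)" for v
    using derivs_in_dir_deriv'[OF function_space_decay, of _ "\<lambda>_::unit. f"] f by (simp add: schwartz_iff_derivs_in)
  define F where "F s = cis (2 * pi * ?\<kappa> * s) * pft f z" for s
  have shift: "F s = (LINT t|lborel. f (?w t + s *\<^sub>R j b) * ?e t)"
    and shift_int: "integrable lborel (\<lambda>t. f (?w t + s *\<^sub>R j b) * ?e t)" for s
  proof -
    let ?g = "\<lambda>t. f (?w t) * ?e t"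
    note tr = lborel_translate[OF measurable_integrand[OF f, of "q z" "r z"], of "s *\<^sub>R b"]
    have eq: "f (?w t + s *\<^sub>R j b) * ?e t = cis (2 * pi * ?\<kappa> * s) * ?g (s *\<^sub>R b + t)" for t
      by (simp add: linear_add[OF linear_j] linear_cmul[OF linear_j] inner_add_right cis_mult algebra_simps)
    show "F s = (LINT t|lborel. f (?w t + s *\<^sub>R j b) * ?e t)"
      unfolding eq F_def pft_def tr(1)[symmetric] by simp
    show "integrable lborel (\<lambda>t. f (?w t + s *\<^sub>R j b) * ?e t)"
      unfolding eq by (intro integrable_mult_right tr(2)[THEN iffD2] pft_integrable[OF f])
  qed
  obtain C where C: "\<And>w u c. norm u \<le> 1 \<Longrightarrow>
    norm (f (w + u) * cis (- 2 * pi * (c \<bullet> r w)) - f w -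
      (dir_deriv u f w - 2 * pi * \<i> * (c \<bullet> r w) * f w)) \<le> C * (norm u + norm c)\<^sup>2 * weight (r w)"
    using twisted_taylor[OF f norm_r] by blast
  define \<delta> where "\<delta> = 1 / (1 + norm (j b))"
  have \<delta>: "\<delta> > 0" by (simp add: \<delta>_def add_pos_nonneg)
  have "(F has_derivative (\<lambda>s. s *\<^sub>R ?D)) (at 0)"
  proof (rule has_derivative_quadratic[OF _ \<delta>])
    show "linear (\<lambda>s. s *\<^sub>R ?D)" by (simp add: linearI scaleR_left_distrib)
    fix s :: real assume s: "norm s < \<delta>"
    have small: "norm (s *\<^sub>R j b) \<le> 1"
    proof -
      have "\<bar>s\<bar> * (1 + norm (j b)) \<le> 1"
        using s by (simp add: \<delta>_def field_simps add_pos_nonneg)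
      then show ?thesis by (simp add: algebra_simps)
    qed
    define R where "R t = f (?w t + s *\<^sub>R j b) * ?e t - f (?w t) * ?e t - of_real s * (dir_deriv (j b) f (?w t) * ?e t)" for t
    have int: "integrable lborel (\<lambda>t. of_real s * (dir_deriv (j b) f (?w t) * ?e t))"
      by (intro integrable_mult_right pft_integrable sD)
    have "F (0 + s) - F 0 - s *\<^sub>R ?D = (LINT t|lborel. R t)"
    proof -
      have "F 0 = pft f z" by (simp add: F_def)
      moreover have "s *\<^sub>R ?D = (LINT t|lborel. of_real s * (dir_deriv (j b) f (?w t) * ?e t))"
        by (simp add: pft_def scaleR_conv_of_real)
      ultimately show ?thesis
        unfolding R_def
        by (subst Bochner_Integration.integral_diff,
          (intro Bochner_Integration.integrable_diff int shift_int pft_integrable f)+)+ (simp add: shift pft_def)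
    qed
    moreover have "norm (LINT t|lborel. R t) \<le> (C * (norm (s *\<^sub>R j b))\<^sup>2) * (LINT t|lborel. weight (t::'b))"
    proof (rule weight_dominated(2))
      have "integrable lborel R"
        unfolding R_def[abs_def] by (intro Bochner_Integration.integrable_diff int pft_integrable f shift_int)
      then show "R \<in> borel_measurable borel" by simp
      fix t
      have "R t = (f (?w t + s *\<^sub>R j b) - f (?w t) - dir_deriv (s *\<^sub>R j b) f (?w t)) * ?e t"
        by (simp add: R_def linear_cmul[OF linear_dir_deriv[OF df]] scaleR_conv_of_real algebra_simps)
      then have "norm (R t) = norm (f (?w t + s *\<^sub>R j b) - f (?w t) - dir_deriv (s *\<^sub>R j b) f (?w t))"
        by (simp add: norm_mult)
      also have "\<dots> \<le> (C * (norm (s *\<^sub>R j b))\<^sup>2) * weight t"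
        \<comment> \<open>With \<open>c = 0\<close> the character disappears and the plain
          second-order remainder is left.\<close>
        using C[OF small, of "?w t" 0] by simp
      finally show "norm (R t) \<le> (C * (norm (s *\<^sub>R j b))\<^sup>2) * weight t" .
    qed
    ultimately show "norm (F (0 + s) - F 0 - s *\<^sub>R ?D) \<le> (C * (norm (j b))\<^sup>2 * (LINT t|lborel. weight (t::'b))) * (norm s)\<^sup>2"
      by (simp add: power_mult_distrib mult_ac)
  qed
  then have "(F has_vector_derivative ?D) (at 0)"
    by (simp add: has_vector_derivative_def)
  moreover have "(F has_vector_derivative 2 * pi * \<i> * ?\<kappa> * pft f z) (at 0)"
    unfolding has_vector_derivative_def F_def[abs_def]
    by (auto intro!: derivative_eq_intros simp: scaleR_conv_of_real algebra_simps)
  ultimately show ?thesis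
    by (rule vector_derivative_unique_at)
qed

text \<open>The operator that \<open>pft\<close> turns into multiplication by the coordinate
  \<open>z \<bullet> e\<close>: the free part of the coordinate multiplies directly, and the
  transformed part comes from derivatives divided by \<open>2 * pi * \<i>\<close>.\<close>

definition coord_mult :: "'a \<Rightarrow> ('a \<Rightarrow> complex) \<Rightarrow> 'a \<Rightarrow> complex" where
  "coord_mult e f w = complex_of_real (q w \<bullet> e) * f w +
     (\<Sum>b\<in>Basis. (complex_of_real (j b \<bullet> e) / (2 * pi * \<i>)) * dir_deriv (j b) f w)"

lemma derivs_in_coord_mult:
  assumes f: "derivs_in (decay a) f"
  shows "derivs_in (decay a) (\<lambda>i. coord_mult e (f i))"
proof -
  have "linear (\<lambda>w. q w \<bullet> e)"
    using linear_q by (intro linearI) (simp_all add: linear_add linear_cmul inner_add_left)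
  then show ?thesis
    unfolding coord_mult_def[abs_def]
    by (intro derivs_in_add derivs_in_sum function_space_decay derivs_in_dir_deriv' f derivs_in_cmult
        derivs_in_decay_linear_functional) auto
qed

lemma pft_coord_mult:
  assumes f: "schwartz f"
  shows "pft (coord_mult e f) z = (z \<bullet> e) * pft f z"
proof -
  have F: "derivs_in (decay (\<lambda>_. 1)) (\<lambda>_::unit. f)" using f by (simp add: schwartz_iff_derivs_in)
  have sD: "schwartz (dir_deriv v f)" for v
    using derivs_in_dir_deriv'[OF function_space_decay F] by (simp add: schwartz_iff_derivs_in)
  have sum: "schwartz (\<lambda>w. \<Sum>b\<in>B. c b * dir_deriv (j b) f w)" if "finite B" for B and c :: "'b \<Rightarrow> complex"
    unfolding schwartz_iff_derivs_in
    by (intro derivs_in_sum derivs_in_cmult derivs_in_dir_deriv' function_space_decay F that)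
  have pft_sum: "pft (\<lambda>w. \<Sum>b\<in>B. c b * dir_deriv (j b) f w) z = (\<Sum>b\<in>B. c b * pft (dir_deriv (j b) f) z)"
    if "finite B" for B and c :: "'b \<Rightarrow> complex"
    using that
  proof (induction B rule: finite_induct)
    case empty
    then show ?case by (simp add: pft_def)
  next
    case (insert x B)
    have "schwartz (\<lambda>w. c x * dir_deriv (j x) f w)" using sum[of "{x}" c] by simp
    with insert show ?case by (simp add: pft_add sum pft_cmult)
  qed
  have "linear (\<lambda>w. q w \<bullet> e)"
    using linear_q by (intro linearI) (simp_all add: linear_add linear_cmul inner_add_left)
  then have "schwartz (\<lambda>w. complex_of_real (q w \<bullet> e) * f w)"
    unfolding schwartz_iff_derivs_in by (intro derivs_in_decay_linear_functional F)
  then have "pft (coord_mult e f) z = pft (\<lambda>w. complex_of_real (q w \<bullet> e) * f w) z +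
      (\<Sum>b\<in>Basis. (complex_of_real (j b \<bullet> e) / (2 * pi * \<i>)) * pft (dir_deriv (j b) f) z)"
    unfolding coord_mult_def[abs_def] by (subst pft_add) (simp_all only: sum[OF finite_Basis] pft_sum[OF finite_Basis])
  also have "pft (\<lambda>w. complex_of_real (q w \<bullet> e) * f w) z = complex_of_real (q z \<bullet> e) * pft f z"
    by (simp add: pft_def mult.assoc)
  also have "(\<Sum>b\<in>Basis. (complex_of_real (j b \<bullet> e) / (2 * pi * \<i>)) * pft (dir_deriv (j b) f) z) =
      (\<Sum>b\<in>Basis. complex_of_real ((r z \<bullet> b) * (j b \<bullet> e))) * pft f z"
    unfolding sum_distrib_right pft_dir_deriv_j[OF f] by (intro sum.cong) (simp_all add: mult_ac)
  also have "(\<Sum>b\<in>Basis. complex_of_real ((r z \<bullet> b) * (j b \<bullet> e))) = complex_of_real (j (r z) \<bullet> e)"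
  proof -
    have "j (r z) = j (\<Sum>b\<in>Basis. (r z \<bullet> b) *\<^sub>R b)" by (simp add: euclidean_representation)
    then show ?thesis
      by (simp add: linear_sum[OF linear_j] linear_cmul[OF linear_j] inner_sum_left)
  qed
  finally show ?thesis
    by (simp add: q_def inner_diff_left algebra_simps)
qed

text \<open>Decay is gained one power at a time: \<open>norm z\<close> is at most the sum of the
  \<open>\<bar>z \<bullet> e\<bar>\<close>, and each coordinate is absorbed by
  \<open>coord_mult\<close>. Derivatives are absorbed by \<open>twist\<close>. Both operators keep a
  family in its class, so both inductions close.\<close>

lemma derivs_in_pft:
  assumes f: "derivs_in (decay a) f"
  shows "derivs_in (decay a) (\<lambda>i. pft (f i))"
proof -
  have dec: "\<exists>C. \<forall>i z. norm z ^ k * norm (pft (f i) z) \<le> C * a i" if "derivs_in (decay a) f" for k f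
    using that
  proof (induction k arbitrary: f)
    case 0
    show ?case using pft_bound[OF 0] by simp metis
  next
    case (Suc k)
    have "\<exists>C. \<forall>i z. norm z ^ k * norm (pft (coord_mult e (f i)) z) \<le> C * a i" for e
      by (rule Suc.IH) (rule derivs_in_coord_mult[OF Suc.prems])
    then obtain C where C: "\<And>e i z. norm z ^ k * norm (pft (coord_mult e (f i)) z) \<le> C e * a i"
      unfolding choice_iff by metis
    have "norm z ^ Suc k * norm (pft (f i) z) \<le> (\<Sum>e\<in>Basis. C e) * a i" for i z
    proof -
      have "norm z ^ Suc k * norm (pft (f i) z) = norm z * (norm z ^ k * norm (pft (f i) z))" by simp
      also have "\<dots> \<le> (\<Sum>e\<in>Basis. \<bar>z \<bullet> e\<bar>) * (norm z ^ k * norm (pft (f i) z))"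
        by (intro mult_right_mono norm_le_l1) auto
      also have "\<dots> = (\<Sum>e\<in>Basis. norm z ^ k * norm (pft (coord_mult e (f i)) z))"
        by (simp add: pft_coord_mult[OF derivs_in_imp_schwartz[OF Suc.prems]] norm_mult sum_distrib_left sum_distrib_right mult_ac)
      also have "\<dots> \<le> (\<Sum>e\<in>Basis. C e * a i)"
        by (intro sum_mono C)
      finally show ?thesis by (simp add: sum_distrib_right)
    qed
    then show ?case by blast
  qed
  then have dec: "decay a (\<lambda>i. pft (f i))" if "derivs_in (decay a) f" for f
    unfolding decay_def[of a "\<lambda>i. pft (f i)"] using that by blast
  have "derivs_upto n (decay a) (\<lambda>i. pft (f i))" if "derivs_in (decay a) f" for n f
    using that
  proof (induction n arbitrary: f)
    case 0
    then show ?case by (simp add: dec)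
  next
    case (Suc n)
    note der = has_derivative_pft[OF derivs_in_imp_schwartz[OF Suc.prems]]
    have "dir_deriv e (pft (f i)) = pft (twist e (f i))" for e i
      by (intro ext dir_deriv_eqI[OF der])
    moreover have "derivs_upto n (decay a) (\<lambda>i. pft (twist e (f i)))" for e
      by (rule Suc.IH) (rule derivs_in_twist[OF Suc.prems])
    moreover have "pft (f i) differentiable (at x)" for i x
      using der by (auto simp: differentiable_def)
    ultimately show ?case
      using dec[OF Suc.prems] by simp
  qed
  then show ?thesis using f by (simp add: derivs_in_def)
qed

end

subsection \<open>Tensor products of tempered distributions\<close>

lemma tempered_add:
  "tempered_distribution u \<Longrightarrow> schwartz f \<Longrightarrow> schwartz g \<Longrightarrow> u (\<lambda>x. f x + g x) = u f + u g"
  by (simp add: tempered_distribution_def)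

lemma tempered_cmult: "tempered_distribution u \<Longrightarrow> schwartz f \<Longrightarrow> u (\<lambda>x. c * f x) = c * u f"
  by (simp add: tempered_distribution_def)

lemma schwartz_cmult: "schwartz f \<Longrightarrow> schwartz (\<lambda>x. c * f x)"
  unfolding schwartz_iff_derivs_in by (rule derivs_in_cmult[OF function_space_decay])

lemma schwartz_diff: "schwartz f \<Longrightarrow> schwartz g \<Longrightarrow> schwartz (\<lambda>x. f x - g x)"
  unfolding schwartz_iff_derivs_in by (rule derivs_in_diff[OF function_space_decay])

lemma tempered_diff:
  assumes "tempered_distribution u" "schwartz f" "schwartz g"
  shows "u (\<lambda>x. f x - g x) = u f - u g"
  using tempered_add[OF assms(1,2) schwartz_cmult[OF assms(3), of "-1"]] tempered_cmult[OF assms(1,3), of "-1"] by simp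

lemma inner_join: "join x y \<bullet> join x' y' = x \<bullet> x' + y \<bullet> y'"
  by (simp add: inner_vec_def join_def sum.Plus flip: UNIV_Plus_UNIV)

lemma norm_join: "(norm (join x y))\<^sup>2 = (norm x)\<^sup>2 + (norm y)\<^sup>2"
  by (simp add: power2_norm_eq_inner inner_join)

lemma norm_le_norm_join: "norm x \<le> norm (join x y)" "norm y \<le> norm (join x y)"
  by (rule power2_le_imp_le; simp add: norm_join)+

lemma join_add: "join x y + join x' y' = join (x + x') (y + y')"
  by (simp add: join_def vec_eq_iff split: sum.split)

lemma join_scaleR: "c *\<^sub>R join x y = join (c *\<^sub>R x) (c *\<^sub>R y)"
  by (simp add: join_def vec_eq_iff split: sum.split)

lemma linear_join_left: "linear (\<lambda>x. join x 0)"
  by (rule linearI) (simp_all add: join_add join_scaleR)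

lemma linear_join_right: "linear (\<lambda>y. join 0 y)"
  by (rule linearI) (simp_all add: join_add join_scaleR)

text \<open>The power of \<open>norm x\<close> enters the family before a distribution is applied in
  \<open>y\<close>; the bound obtained afterwards is then decay in \<open>x\<close>.\<close>

lemma slice_mult_power:
  fixes \<Phi> :: "'i \<Rightarrow> real^('d::finite + 'd) \<Rightarrow> complex"
  assumes "derivs_in (decay a) \<Phi>"
  shows "derivs_in (decay (\<lambda>p. a (fst p))) (\<lambda>p y. of_real (norm (snd p) ^ k) * \<Phi> (fst p) (join (snd p) y))"
proof -
  have "derivs_in (decay (\<lambda>p. a (fst p))) (\<lambda>p y. of_real (norm (snd p) ^ k) * \<Phi> (fst p) (join (snd p) 0 + join 0 y))"
  proof (rule derivs_in_affine[OF function_space_decay linear_join_right _ assms], rule decay_affine, assumption)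
    fix m
    have "norm (complex_of_real (norm (snd p) ^ k)) * norm y ^ m \<le> 1 * (1 + norm (join (snd p) 0 + join 0 y)) ^ (k + m)"
      for p :: "'i \<times> (real^'d)" and y :: "real^'d"
    proof -
      have "norm (snd p) ^ k * norm y ^ m \<le> (1 + norm (join (snd p) y)) ^ k * (1 + norm (join (snd p) y)) ^ m"
        using norm_le_norm_join[where x = "snd p" and y = y]
        by (intro mult_mono power_mono) (auto intro: add_increasing)
      then show ?thesis by (simp add: join_add power_add norm_power)
    qed
    then show "\<exists>C N. \<forall>p y. norm (complex_of_real (norm (snd (p :: 'i \<times> (real^'d))) ^ k)) * norm y ^ m
        \<le> C * (1 + norm (join (snd p) 0 + join 0 y)) ^ N" by blast
  qed
  then show ?thesis by (simp add: join_add)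
qed

lemma schwartz_slice:
  fixes \<phi> :: "real^('d::finite + 'd) \<Rightarrow> complex"
  assumes "schwartz \<phi>"
  shows "schwartz (\<lambda>y. \<phi> (join x y))"
  using derivs_in_imp_schwartz[OF slice_mult_power[OF assms[unfolded schwartz_iff_derivs_in], of 0], of "((), x)"] by simp

text \<open>Set up as a family in \<open>y\<close> indexed by \<open>i\<close>, \<open>x\<close> and
  \<open>h\<close>, so that a tempered distribution in \<open>y\<close> sends a bound by
  \<open>(norm h)\<^sup>2\<close> in all seminorms to a second-order remainder in
  \<open>x\<close>.\<close>

definition slice_remainder ::
  "('i \<Rightarrow> real^('d::finite + 'd) \<Rightarrow> complex) \<Rightarrow> 'i \<times> (real^'d) \<times> (real^'d) \<Rightarrow> real^'d \<Rightarrow> complex" where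
  "slice_remainder \<Phi> = (\<lambda>(i, x, h) y.
     \<Phi> i (join (x + h) y) - \<Phi> i (join x y) - dir_deriv (join h 0) (\<Phi> i) (join x y))"

lemma has_derivative_join_right:
  assumes "f differentiable (at (join x y))"
  shows "((\<lambda>y. f (join x y)) has_derivative (\<lambda>v. dir_deriv (join 0 v) f (join x y))) (at y)"
  using has_derivative_affine[of f "join x 0" "\<lambda>y. join 0 y" y 1] assms linear_join_right by (simp add: join_add)

lemma has_derivative_join_left:
  assumes "f differentiable (at (join x y))"
  shows "((\<lambda>x. c * f (join x y)) has_derivative (\<lambda>v. c * dir_deriv (join v 0) f (join x y))) (at x)"
  using has_derivative_affine[of f "join 0 y" "\<lambda>x. join x 0" x c] assms linear_join_left by (simp add: join_add)

text \<open>A derivative in \<open>y\<close> of the remainder is the remainder of a derivative of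
  \<open>\<Phi>\<close>, because derivatives commute. Hence it is enough to bound the remainder
  itself, by the Taylor estimate in \<open>x\<close> with \<open>y\<close> fixed.\<close>

lemma derivs_in_slice_remainder:
  fixes \<Phi> :: "'i \<Rightarrow> real^('d::finite + 'd) \<Rightarrow> complex"
  assumes "derivs_in (decay a) \<Phi>"
  shows "derivs_in (decay (\<lambda>(i, x, h). a i * (norm h)\<^sup>2)) (slice_remainder \<Phi>)" (is "derivs_in ?Q _")
proof -
  have base: "?Q (slice_remainder \<Phi>)" if f: "derivs_in (decay a) \<Phi>" for \<Phi> :: "'i \<Rightarrow> real^('d + 'd) \<Rightarrow> complex"
    unfolding decay_def
  proof
    fix k
    obtain C where C: "\<And>i z v u. (1 + norm z) ^ k * norm (dir_deriv u (dir_deriv v (\<Phi> i)) z) \<le> C * norm u * norm v * a i"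
      using second_order_bound[OF f] by blast
    have "norm y ^ k * norm (slice_remainder \<Phi> (i, x, h) y) \<le> C * (a i * (norm h)\<^sup>2)" for i x h y
    proof -
      \<comment> \<open>This factor is constant in \<open>x\<close>, so it is carried through the
        Taylor estimate and absorbed by the decay of the second derivative at
        \<open>join x y\<close>.\<close>
      let ?c = "complex_of_real (norm y ^ k)"
      let ?g = "\<lambda>x. ?c * \<Phi> i (join x y)"
      note d0 = has_derivative_join_left[OF derivs_in_differentiable[OF f]]
      note d1 = has_derivative_join_left[OF derivs_in_differentiable_dir(1)[OF f]]
      have e1: "dir_deriv h ?g = (\<lambda>x. ?c * dir_deriv (join h 0) (\<Phi> i) (join x y))"
        by (intro ext dir_deriv_eqI[OF d0])
      have e2: "dir_deriv h (dir_deriv h ?g) = (\<lambda>x. ?c * dir_deriv (join h 0) (dir_deriv (join h 0) (\<Phi> i)) (join x y))"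
        unfolding e1 by (intro ext dir_deriv_eqI[OF d1])
      have "norm (?g (x + h) - ?g x - dir_deriv h ?g x) \<le> C * (a i * (norm h)\<^sup>2)"
      proof (rule taylor_dir_deriv)
        show "?g differentiable (at x)" for x
          using d0 unfolding differentiable_def by blast
        show "dir_deriv h ?g differentiable (at x)" for x
          unfolding e1 using d1 unfolding differentiable_def by blast
        show "norm (dir_deriv h (dir_deriv h ?g) x) \<le> C * (a i * (norm h)\<^sup>2)" for x
        proof -
          have "norm (dir_deriv h (dir_deriv h ?g) x) \<le>
             (1 + norm (join x y)) ^ k * norm (dir_deriv (join h 0) (dir_deriv (join h 0) (\<Phi> i)) (join x y))"
            unfolding e2 norm_mult using norm_le_norm_join(2)[of y x]
            by (intro mult_right_mono) (auto simp: norm_power intro!: power_mono)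
          also have "\<dots> \<le> C * norm (join h 0) * norm (join h 0) * a i" by (rule C)
          also have "\<dots> = C * (a i * (norm h)\<^sup>2)"
            using norm_join[of h 0] by (simp add: power2_eq_square)
          finally show ?thesis .
        qed
      qed
      also have "?g (x + h) - ?g x - dir_deriv h ?g x = ?c * slice_remainder \<Phi> (i, x, h) y"
        unfolding e1 slice_remainder_def prod.case right_diff_distrib ..
      finally show ?thesis by (simp add: norm_mult norm_power)
    qed
    then show "\<exists>C. \<forall>p y. norm y ^ k * norm (slice_remainder \<Phi> p y) \<le> C * (case p of (i, x, h) \<Rightarrow> a i * (norm h)\<^sup>2)"
      by (intro exI[of _ C]) auto
  qed
  have "derivs_upto n ?Q (slice_remainder \<Phi>)" if "derivs_in (decay a) \<Phi>" for n and \<Phi> :: "'i \<Rightarrow> real^('d + 'd) \<Rightarrow> complex"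
    using that
  proof (induction n arbitrary: \<Phi>)
    case 0
    then show ?case using base by simp
  next
    case (Suc n)
    note f = Suc.prems
    have der: "(slice_remainder \<Phi> p has_derivative (\<lambda>v. slice_remainder (\<lambda>i. dir_deriv (join 0 v) (\<Phi> i)) p y)) (at y)" for p y
    proof -
      obtain i x h where p: "p = (i, x, h)" by (cases p)
      show ?thesis
        unfolding p slice_remainder_def prod.case derivs_in_commute[OF f, of "join h 0"]
        by (intro has_derivative_diff has_derivative_join_right derivs_in_differentiable[OF f]
            derivs_in_differentiable_dir[OF f])
    qed
    have "(\<lambda>p. dir_deriv e (slice_remainder \<Phi> p)) = slice_remainder (\<lambda>i. dir_deriv (join 0 e) (\<Phi> i))" for e
      by (intro ext dir_deriv_eqI[OF der])
    moreover have "derivs_upto n ?Q (slice_remainder (\<lambda>i. dir_deriv (join 0 e) (\<Phi> i)))" for e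
      by (rule Suc.IH) (rule derivs_in_dir_deriv'[OF function_space_decay f])
    moreover have "slice_remainder \<Phi> p differentiable (at y)" for p y
      using der unfolding differentiable_def by blast
    ultimately show ?case using base[OF f] by simp
  qed
  then show ?thesis using assms by (simp add: derivs_in_def)
qed

lemma has_derivative_tempered_slice:
  fixes \<phi> :: "real^('d::finite + 'd) \<Rightarrow> complex"
  assumes u: "tempered_distribution u" and f: "schwartz \<phi>"
  shows "((\<lambda>x. u (\<lambda>y. \<phi> (join x y))) has_derivative (\<lambda>h. u (\<lambda>y. dir_deriv (join h 0) \<phi> (join x y)))) (at x)"
proof -
  have F: "derivs_in (decay (\<lambda>_. 1)) (\<lambda>_::unit. \<phi>)" using f by (simp add: schwartz_iff_derivs_in)
  have sD: "schwartz (dir_deriv v \<phi>)" for v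
    using derivs_in_dir_deriv'[OF function_space_decay F] by (simp add: schwartz_iff_derivs_in)
  note lin = linear_dir_deriv[OF derivs_in_differentiable[OF F]]
  have "linear (\<lambda>h. u (\<lambda>y. dir_deriv (join h 0) \<phi> (join x y)))"
  proof (rule linearI)
    fix h h' :: "real^'d"
    have "dir_deriv (join (h + h') 0) \<phi> z = dir_deriv (join h 0) \<phi> z + dir_deriv (join h' 0) \<phi> z" for z
      using linear_add[OF lin, of "join h 0" "join h' 0" z] by (simp add: join_add)
    then show "u (\<lambda>y. dir_deriv (join (h + h') 0) \<phi> (join x y)) =
        u (\<lambda>y. dir_deriv (join h 0) \<phi> (join x y)) + u (\<lambda>y. dir_deriv (join h' 0) \<phi> (join x y))"
      by (simp add: tempered_add[OF u] schwartz_slice sD)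
  next
    fix c and h :: "real^'d"
    have "dir_deriv (join (c *\<^sub>R h) 0) \<phi> z = of_real c * dir_deriv (join h 0) \<phi> z" for z
      using linear_cmul[OF lin, of c "join h 0" z] unfolding join_scaleR by (simp add: scaleR_conv_of_real[where 'a = complex])
    then show "u (\<lambda>y. dir_deriv (join (c *\<^sub>R h) 0) \<phi> (join x y)) =
        c *\<^sub>R u (\<lambda>y. dir_deriv (join h 0) \<phi> (join x y))"
      by (simp add: tempered_cmult[OF u] schwartz_slice sD scaleR_conv_of_real[where 'a = complex])
  qed
  moreover obtain C where C: "\<And>p. norm (u (slice_remainder (\<lambda>_::unit. \<phi>) p)) \<le> C * (case p of (i, x, h) \<Rightarrow> 1 * (norm h)\<^sup>2)"
    using tempered_family_bound[OF u derivs_in_slice_remainder[OF F]] by blast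
  have "norm (u (\<lambda>y. \<phi> (join (x + h) y)) - u (\<lambda>y. \<phi> (join x y)) - u (\<lambda>y. dir_deriv (join h 0) \<phi> (join x y))) \<le> C * (norm h)\<^sup>2" for h
    using C[of "((), x, h)"]
    by (simp add: slice_remainder_def tempered_diff[OF u] schwartz_diff schwartz_slice sD f)
  ultimately show ?thesis
    by (intro has_derivative_quadratic[of _ 1]) auto
qed

text \<open>The first functional in \<open>tensor_distribution\<close> is applied to this function
  of \<open>x\<close>, so it has to be Schwartz, with estimates uniform in the index.\<close>

lemma derivs_in_tempered_slice:
  fixes \<Phi> :: "'i \<Rightarrow> real^('d::finite + 'd) \<Rightarrow> complex"
  assumes u: "tempered_distribution u" and f: "derivs_in (decay a) \<Phi>"
  shows "derivs_in (decay a) (\<lambda>i x. u (\<lambda>y. \<Phi> i (join x y)))"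
proof -
  have dec: "decay a (\<lambda>i x. u (\<lambda>y. \<Phi> i (join x y)))" if f: "derivs_in (decay a) \<Phi>"
    for \<Phi> :: "'i \<Rightarrow> real^('d + 'd) \<Rightarrow> complex"
    unfolding decay_def
  proof
    fix k
    obtain C where C: "\<And>p. norm (u (\<lambda>y. of_real (norm (snd p) ^ k) * \<Phi> (fst p) (join (snd p) y))) \<le> C * a (fst p)"
      using tempered_family_bound[OF u slice_mult_power[OF f]] by blast
    have "norm x ^ k * norm (u (\<lambda>y. \<Phi> i (join x y))) \<le> C * a i" for i x
      using C[of "(i, x)"]
      by (simp add: tempered_cmult[OF u schwartz_slice[OF derivs_in_imp_schwartz[OF f]]] norm_mult norm_power del: of_real_power)
    then show "\<exists>C. \<forall>i x. norm x ^ k * norm (u (\<lambda>y. \<Phi> i (join x y))) \<le> C * a i" by blast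
  qed
  have "derivs_upto n (decay a) (\<lambda>i x. u (\<lambda>y. \<Phi> i (join x y)))" if "derivs_in (decay a) \<Phi>"
    for n and \<Phi> :: "'i \<Rightarrow> real^('d + 'd) \<Rightarrow> complex"
    using that
  proof (induction n arbitrary: \<Phi>)
    case 0
    then show ?case using dec by simp
  next
    case (Suc n)
    note der = has_derivative_tempered_slice[OF u derivs_in_imp_schwartz[OF Suc.prems]]
    have "dir_deriv e (\<lambda>x. u (\<lambda>y. \<Phi> i (join x y))) = (\<lambda>x. u (\<lambda>y. dir_deriv (join e 0) (\<Phi> i) (join x y)))" for e i
      by (intro ext dir_deriv_eqI[OF der])
    moreover have "derivs_upto n (decay a) (\<lambda>i x. u (\<lambda>y. dir_deriv (join e 0) (\<Phi> i) (join x y)))" for e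
      by (rule Suc.IH) (rule derivs_in_dir_deriv'[OF function_space_decay Suc.prems])
    moreover have "(\<lambda>x. u (\<lambda>y. \<Phi> i (join x y))) differentiable (at x)" for i x
      using der unfolding differentiable_def by blast
    ultimately show ?case
      using dec[OF Suc.prems] by simp
  qed
  then show ?thesis using f by (simp add: derivs_in_def)
qed

subsection \<open>Smooth cutoff functions\<close>

text \<open>The powers in the denominator make the collection of these functions closed under
  differentiation up to linear combinations, see \<open>DERIV_flat\<close>.\<close>

definition flat :: "nat \<Rightarrow> real \<Rightarrow> real" where
  "flat m x = (if x > 0 then exp (- (1 / x)) / x ^ m else 0)"

text \<open>The inequality \<open>t \<le> exp t\<close> at \<open>t = 1 / (k * x)\<close> is raised
  to the power \<open>k = m + 2\<close>: \<open>m\<close> powers of \<open>x\<close> cancel the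
  denominator, and the two that remain give derivative 0 at the origin.\<close>

lemma flat_le_square: "\<bar>flat m x\<bar> \<le> real (m + 2) ^ (m + 2) * x\<^sup>2"
proof (cases "x > 0")
  case True
  define k where "k = m + 2"
  have k: "real k > 0" by (simp add: k_def)
  have "1 / (real k * x) \<le> exp (1 / (real k * x))"
    using exp_ge_add_one_self[of "1 / (real k * x)"] by linarith
  then have "(1 / (real k * x)) ^ k \<le> exp (1 / (real k * x)) ^ k"
    using True k by (intro power_mono) auto
  also have "\<dots> = exp (1 / x)"
    using k True by (simp add: exp_of_nat_mult[symmetric])
  finally have "exp (- (1 / x)) \<le> (real k * x) ^ k"
    using True k by (simp add: exp_minus inverse_eq_divide power_divide divide_simps mult.commute)
  then have "exp (- (1 / x)) \<le> (real k ^ k * x\<^sup>2) * x ^ m"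
    by (simp add: k_def power_mult_distrib power_add power2_eq_square mult_ac)
  then show ?thesis
    using True unfolding flat_def k_def by (simp add: pos_divide_le_eq)
qed (simp add: flat_def)

lemma flat_pos: "x > 0 \<Longrightarrow> flat m x > 0"
  by (simp add: flat_def)

lemma flat_zero: "x \<le> 0 \<Longrightarrow> flat m x = 0"
  by (simp add: flat_def)

lemma flat_mono: "1 \<le> x \<Longrightarrow> flat 0 1 \<le> flat 0 x"
  by (simp add: flat_def)

lemma DERIV_flat: "DERIV (flat m) x :> flat (m + 2) x - real m * flat (m + 1) x"
proof -
  consider "x > 0" | "x < 0" | "x = 0" by linarith
  then show ?thesis
  proof cases
    case 1
    have "DERIV (\<lambda>x. exp (- (1 / x)) / x ^ m) x :> flat (m + 2) x - real m * flat (m + 1) x"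
    proof -
      have "x ^ (m - 1) = x * x ^ (m - 1 - 1) \<or> m - 1 = 0" by (cases "m - 1") auto
      then show ?thesis
        using 1 by (cases m) (auto intro!: derivative_eq_intros simp: flat_def field_simps power2_eq_square)
    qed
    then show ?thesis
      by (rule has_field_derivative_transform_within_open[where S = "{0<..}"]) (use 1 in \<open>auto simp: flat_def\<close>)
  next
    case 2
    have "DERIV (\<lambda>x. 0) x :> flat (m + 2) x - real m * flat (m + 1) x"
      using 2 by (simp add: flat_def)
    then show ?thesis
      by (rule has_field_derivative_transform_within_open[where S = "{..<0}"]) (use 2 in \<open>auto simp: flat_def\<close>)
  next
    case 3
    have "(flat m has_derivative (\<lambda>h. 0)) (at 0)"
    proof (rule has_derivativeI_sandwich[of 1])
      show "norm (flat m y - flat m 0 - 0) / norm (y - 0) \<le> real (m + 2) ^ (m + 2) * norm y" if "y \<noteq> 0" for y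
      proof -
        have "norm (flat m y - flat m 0 - 0) = \<bar>flat m y\<bar>" by (simp add: flat_def)
        also have "\<dots> \<le> (real (m + 2) ^ (m + 2) * norm y) * norm y"
          using flat_le_square[of m y] by (simp add: power2_eq_square abs_mult_self_eq mult.assoc)
        finally show ?thesis using that by (simp add: pos_divide_le_eq)
      qed
      show "((\<lambda>y. real (m + 2) ^ (m + 2) * norm y) \<longlongrightarrow> 0) (at 0)"
        by (auto intro!: tendsto_eq_intros)
    qed auto
    then show ?thesis
      unfolding 3 has_field_derivative_def by (simp add: flat_zero lambda_zero[symmetric])
  qed
qed

lemma smooth_cmult: "smooth f \<Longrightarrow> smooth (\<lambda>x. c * f x)"
  unfolding smooth_iff_derivs_in by (rule derivs_in_cmult[OF function_space_True])

lemma smooth_diff: "smooth f \<Longrightarrow> smooth g \<Longrightarrow> smooth (\<lambda>x. f x - g x)"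
  unfolding smooth_iff_derivs_in by (rule derivs_in_diff[OF function_space_True])

lemma smooth_mult: "smooth f \<Longrightarrow> smooth g \<Longrightarrow> smooth (\<lambda>x. f x * g x)"
  unfolding smooth_iff_derivs_in by (rule derivs_in_mult[OF function_space_True]) simp_all

lemma smooth_const: "smooth (\<lambda>x. c)"
  unfolding smooth_iff_derivs_in by (rule derivs_in_const) simp

lemma smooth_sum: "finite A \<Longrightarrow> (\<And>a. a \<in> A \<Longrightarrow> smooth (f a)) \<Longrightarrow> smooth (\<lambda>x. \<Sum>a\<in>A. f a x)"
  unfolding smooth_iff_derivs_in by (rule derivs_in_sum[OF function_space_True])

lemma smooth_linear_functional: "linear l \<Longrightarrow> smooth (\<lambda>x. complex_of_real (l x))"
  using derivs_in_imp_smooth[OF derivs_in_linear_functional] .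

lemma smooth_norm_square: "smooth (\<lambda>x::'a::euclidean_space. complex_of_real ((norm (x - c))\<^sup>2))"
proof -
  have "smooth (\<lambda>x::'a. complex_of_real (x \<bullet> e) - complex_of_real (c \<bullet> e))" for e
    by (intro smooth_diff smooth_const smooth_linear_functional linearI) (simp_all add: inner_add_left)
  then have "smooth (\<lambda>x::'a. \<Sum>e\<in>Basis. (complex_of_real (x \<bullet> e) - complex_of_real (c \<bullet> e)) *
      (complex_of_real (x \<bullet> e) - complex_of_real (c \<bullet> e)))"
    by (intro smooth_sum smooth_mult) auto
  moreover have "(norm (x - c))\<^sup>2 = (\<Sum>e\<in>Basis. (x \<bullet> e - c \<bullet> e) * (x \<bullet> e - c \<bullet> e))" for x
    unfolding power2_norm_eq_inner euclidean_inner[of "x - c" "x - c"] by (simp add: inner_diff_left)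
  ultimately show ?thesis by simp
qed

text \<open>Induction on the order with \<open>m\<close> generalised: a derivative is a combination
  of \<open>flat (m + 2)\<close> and \<open>flat (m + 1)\<close> composed with \<open>h\<close>,
  times a derivative of \<open>h\<close>.\<close>

lemma smooth_flat:
  fixes h :: "'a::euclidean_space \<Rightarrow> real"
  assumes H: "smooth (\<lambda>x. complex_of_real (h x))"
  shows "smooth (\<lambda>x. complex_of_real (flat m (h x)))"
proof -
  let ?H = "\<lambda>x. complex_of_real (h x)"
  have S: "derivs_in (\<lambda>_. True) (\<lambda>_::unit. ?H)" using H by (simp add: smooth_iff_derivs_in)
  have der: "((\<lambda>x. complex_of_real (flat m (h x))) has_derivative
     (\<lambda>v. (of_real (flat (m + 2) (h x)) + (- of_nat m) * of_real (flat (m + 1) (h x))) * dir_deriv v ?H x)) (at x)" for m x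
  proof -
    have "((\<lambda>x. Re (?H x)) has_derivative (\<lambda>v. Re (dir_deriv v ?H x))) (at x)"
      by (intro bounded_linear.has_derivative[OF bounded_linear_Re] has_derivative_dir_deriv derivs_in_differentiable[OF S])
    then have h: "(h has_derivative (\<lambda>v. Re (dir_deriv v ?H x))) (at x)" by simp
    \<comment> \<open>The chain rule is applied to the real function \<open>h\<close>; this fact
      returns from the real part to the complex derivative.\<close>
    have "dir_deriv v ?H x = of_real (Re (dir_deriv v ?H x))" for v
      by (rule dir_deriv_eqI) (rule has_derivative_of_real[OF h])
    then have re: "of_real (Re (dir_deriv v ?H x)) = dir_deriv v ?H x" for v by simp
    have "((\<lambda>x. flat m (h x)) has_derivative
       (\<lambda>v. Re (dir_deriv v ?H x) * (flat (m + 2) (h x) - real m * flat (m + 1) (h x)))) (at x)"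
      using DERIV_compose_FDERIV[OF DERIV_flat h] .
    from has_derivative_of_real[OF this, where 'a = complex] show ?thesis
      by (simp add: re mult.commute)
  qed
  have "derivs_upto n (\<lambda>_. True) (\<lambda>_::unit. \<lambda>x. complex_of_real (flat m (h x)))" for n m
  proof (induction n arbitrary: m)
    case (Suc n)
    have "dir_deriv e (\<lambda>x. complex_of_real (flat m (h x))) =
      (\<lambda>x. (of_real (flat (m + 2) (h x)) + (- of_nat m) * of_real (flat (m + 1) (h x))) * dir_deriv e ?H x)" for e
      by (intro ext dir_deriv_eqI[OF der])
    moreover have "derivs_upto n (\<lambda>_. True) (\<lambda>_::unit. \<lambda>x. (of_real (flat (m + 2) (h x)) +
        (- of_nat m) * of_real (flat (m + 1) (h x))) * dir_deriv e ?H x)" if "e \<in> Basis" for e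
    proof (rule derivs_upto_mult[where ?Q1.0 = "\<lambda>_. True" and ?Q2.0 = "\<lambda>_. True"])
      show "derivs_upto n (\<lambda>_. True) (\<lambda>_::unit. dir_deriv e ?H)"
        using derivs_in_dir_deriv[OF S that] by (simp add: derivs_in_def)
    qed (intro derivs_upto_add derivs_upto_cmult Suc.IH function_space_True TrueI)+
    moreover have "(\<lambda>x. complex_of_real (flat m (h x))) differentiable (at x)" for x
      using der unfolding differentiable_def by blast
    ultimately show ?case by simp
  qed simp
  then show ?thesis by (simp add: smooth_iff_derivs_in derivs_in_def)
qed

text \<open>\<open>flat 0\<close> is constant on one side of 0 only, so two of them are nested: the
  inner one makes \<open>g\<close> constant far from \<open>c\<close>, the outer one makes
  \<open>\<psi>\<close> constant where \<open>g \<le> 0\<close>. The normalising denominator is the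
  value of the outer one on the far plateau.\<close>

lemma smooth_cutoff:
  fixes c :: "'a::euclidean_space"
  assumes "\<rho> > 0"
  obtains \<psi> where "smooth \<psi>" "\<And>x. norm (x - c) \<le> \<rho> \<Longrightarrow> \<psi> x = 1" "\<And>x. norm (x - c) \<ge> 2 * \<rho> \<Longrightarrow> \<psi> x = 0"
proof -
  \<comment> \<open>\<open>h \<ge> 1\<close> on the ball of radius \<open>\<rho>\<close>, and
    \<open>h \<le> 0\<close> from distance \<open>sqrt 2 * \<rho>\<close> on, hence beyond
    \<open>2 * \<rho>\<close>.\<close>
  define h where "h x = 2 - (norm (x - c))\<^sup>2 / \<rho>\<^sup>2" for x
  define g where "g x = flat 0 1 - flat 0 (h x)" for x
  define \<psi> where "\<psi> x = 1 - (1 / complex_of_real (flat 0 (flat 0 1))) * complex_of_real (flat 0 (g x))" for x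
  have "smooth (\<lambda>x. 2 - (1 / (complex_of_real \<rho>)\<^sup>2) * complex_of_real ((norm (x - c))\<^sup>2))"
    by (intro smooth_diff smooth_const smooth_cmult smooth_norm_square)
  then have "smooth (\<lambda>x. complex_of_real (h x))" by (simp add: h_def)
  then have "smooth (\<lambda>x. complex_of_real (flat 0 1) - complex_of_real (flat 0 (h x)))"
    by (intro smooth_diff smooth_const smooth_flat)
  then have "smooth (\<lambda>x. complex_of_real (g x))" by (simp add: g_def)
  then have "smooth \<psi>" unfolding \<psi>_def[abs_def]
    by (intro smooth_diff smooth_const smooth_cmult smooth_flat)
  moreover have "\<psi> x = 1" if "norm (x - c) \<le> \<rho>" for x
  proof -
    have "(norm (x - c))\<^sup>2 \<le> \<rho>\<^sup>2" using that by (intro power_mono) auto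
    then have "h x \<ge> 1" using assms by (simp add: h_def)
    then have "g x \<le> 0" using flat_mono by (simp add: g_def)
    then show ?thesis by (simp add: \<psi>_def flat_zero)
  qed
  moreover have "\<psi> x = 0" if "norm (x - c) \<ge> 2 * \<rho>" for x
  proof -
    have "(2 * \<rho>)\<^sup>2 \<le> (norm (x - c))\<^sup>2" using that assms by (intro power_mono) auto
    then have "2 * \<rho>\<^sup>2 \<le> (norm (x - c))\<^sup>2"
      by (rule order_trans[rotated]) (simp add: power_mult_distrib)
    then have "h x \<le> 0" using assms by (simp add: h_def pos_le_divide_eq)
    then have "g x = flat 0 1" by (simp add: g_def flat_zero)
    then show ?thesis using flat_pos[of "flat 0 1" 0] flat_pos[of 1 0] by (simp add: \<psi>_def)
  qed
  ultimately show ?thesis by (rule that)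
qed

subsection \<open>Compactly supported functions\<close>

lemma partial_deriv_const_open:
  assumes "open S" "\<And>x. x \<in> S \<Longrightarrow> f x = c" "x \<in> S"
  shows "partial_deriv vs f x = (if vs = [] then c else 0)"
  using assms(3)
proof (induction vs arbitrary: x)
  case Nil
  then show ?case using assms by simp
next
  case (Cons v vs)
  have "(partial_deriv vs f has_derivative (\<lambda>_. 0)) (at x)"
    by (rule has_derivative_transform_within_open[where f = "\<lambda>_. if vs = [] then c else 0"])
       (use assms Cons in auto)
  then show ?case
    unfolding partial_deriv_Cons by (simp add: dir_deriv_eqI)
qed

lemma partial_deriv_continuous: "smooth f \<Longrightarrow> set vs \<subseteq> Basis \<Longrightarrow> continuous_on S (partial_deriv vs f)"
  using derivs_in_continuous[OF derivs_in_partial_deriv[OF smooth_iff_derivs_in[THEN iffD1]]] .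

lemma compactly_supported_schwartz:
  assumes f: "smooth f" and K: "compact (closure {x. f x \<noteq> 0})"
  shows "schwartz f"
  unfolding schwartz_def
proof (intro conjI allI impI f)
  fix k and vs :: "'a list" assume vs: "set vs \<subseteq> Basis"
  let ?K = "closure {x. f x \<noteq> 0}"
  have "continuous_on ?K (\<lambda>x. norm x ^ k * norm (partial_deriv vs f x))"
    by (intro continuous_intros partial_deriv_continuous f vs)
  then have "bounded ((\<lambda>x. norm x ^ k * norm (partial_deriv vs f x)) ` ?K)"
    by (intro compact_imp_bounded compact_continuous_image K)
  then obtain C where C: "\<And>x. x \<in> ?K \<Longrightarrow> norm (norm x ^ k * norm (partial_deriv vs f x)) \<le> C"
    unfolding bounded_iff by auto
  have "norm x ^ k * norm (partial_deriv vs f x) \<le> max C 0" for x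
  proof (cases "x \<in> ?K")
    case True
    then show ?thesis using C[OF True] by simp
  next
    case False
    have op: "open (- ?K)" by (intro open_Compl closed_closure)
    have eq: "f y = 0" if "y \<in> - ?K" for y
      using that closure_subset[of "{x. f x \<noteq> 0}"] by auto
    from False have "x \<in> - ?K" by simp
    from partial_deriv_const_open[where vs = vs, OF op eq this] have "partial_deriv vs f x = 0" by simp
    then show ?thesis by simp
  qed
  then show "\<exists>C. \<forall>x. norm x ^ k * norm (partial_deriv vs f x) \<le> C" by blast
qed

lemma compact_closure_subset:
  fixes A B :: "'a::heine_borel set"
  shows "compact (closure B) \<Longrightarrow> A \<subseteq> B \<Longrightarrow> compact (closure A)"
  unfolding compact_closure by (rule bounded_subset)

lemma partial_deriv_scale:
  assumes "smooth f" "set vs \<subseteq> Basis"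
  shows "partial_deriv vs (\<lambda>x. f (s *\<^sub>R x)) = (\<lambda>x. of_real s ^ length vs * partial_deriv vs f (s *\<^sub>R x))"
  using assms(2)
proof (induction vs)
  case (Cons v vs)
  have diff: "partial_deriv vs f differentiable (at x)" for x
    using Cons.prems by (intro derivs_in_differentiable[OF derivs_in_partial_deriv[OF assms(1)[unfolded smooth_iff_derivs_in]]]) auto
  have "linear (\<lambda>x. s *\<^sub>R x)" for s :: real by (simp add: linearI scaleR_add_right)
  from has_derivative_affine[OF _ this, of "partial_deriv vs f" 0]
  have "((\<lambda>x. of_real s ^ length vs * partial_deriv vs f (s *\<^sub>R x)) has_derivative
      (\<lambda>v. of_real s ^ length vs * dir_deriv (s *\<^sub>R v) (partial_deriv vs f) (s *\<^sub>R x))) (at x)" for x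
    using diff by simp
  then have "dir_deriv v (\<lambda>x. of_real s ^ length vs * partial_deriv vs f (s *\<^sub>R x)) =
      (\<lambda>x. of_real s ^ length vs * dir_deriv (s *\<^sub>R v) (partial_deriv vs f) (s *\<^sub>R x))"
    by (intro ext dir_deriv_eqI)
  with Cons show ?case
    unfolding partial_deriv_Cons by (simp add: linear_cmul[OF linear_dir_deriv[OF diff]] scaleR_conv_of_real mult_ac)
qed simp

text \<open>\<open>\<eta> = 1 - \<psi>\<close> vanishes near 0 and is constant far out, so each of
  its derivatives at \<open>y\<close> is at most a multiple of \<open>norm y\<close>. At
  \<open>y = (1 / real (Suc n)) *\<^sub>R x\<close> this gains \<open>1 / real (Suc n)\<close> at
  the price of one power of \<open>norm x\<close>, which a Schwartz factor can pay.\<close>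

lemma cutoff_complement_growth:
  fixes \<psi> :: "'a::euclidean_space \<Rightarrow> complex"
  assumes \<psi>: "smooth \<psi>" and one: "\<And>x. norm x \<le> 1 \<Longrightarrow> \<psi> x = 1" and zero: "\<And>x. norm x \<ge> 2 \<Longrightarrow> \<psi> x = 0"
  shows "derivs_in (growth (\<lambda>n. 1 / real (Suc n))) (\<lambda>n x. 1 - \<psi> ((1 / real (Suc n)) *\<^sub>R x))"
proof -
  define \<eta> where "\<eta> x = 1 - \<psi> x" for x
  have \<eta>: "smooth \<eta>" unfolding \<eta>_def[abs_def] by (intro smooth_diff smooth_const \<psi>)
  have bd: "\<exists>B. \<forall>y. norm (partial_deriv vs \<eta> y) \<le> B * norm y" if vs: "set vs \<subseteq> Basis" for vs
  proof -
    have "bounded (partial_deriv vs \<eta> ` cball 0 2)"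
      by (intro compact_imp_bounded compact_continuous_image partial_deriv_continuous \<eta> vs compact_cball)
    then obtain B where "\<And>y. y \<in> cball 0 2 \<Longrightarrow> norm (partial_deriv vs \<eta> y) \<le> B"
      unfolding bounded_iff by blast
    then have B: "\<And>y. norm y \<le> 2 \<Longrightarrow> norm (partial_deriv vs \<eta> y) \<le> B" by simp
    have "norm (partial_deriv vs \<eta> y) \<le> max B 1 * norm y" for y
    proof -
      consider "norm y < 1" | "1 \<le> norm y" "norm y \<le> 2" | "norm y > 2" by linarith
      then show ?thesis
      proof cases
        case 1
        have "partial_deriv vs \<eta> y = (if vs = [] then 0 else 0)"
          by (rule partial_deriv_const_open[where S = "ball 0 1"]) (use 1 one in \<open>auto simp: \<eta>_def\<close>)
        then show ?thesis by simp
      next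
        case 2
        have "norm (partial_deriv vs \<eta> y) \<le> max B 1 * 1" using B[OF 2(2)] by simp
        also have "\<dots> \<le> max B 1 * norm y" using 2 by (intro mult_left_mono) auto
        finally show ?thesis .
      next
        case 3
        have "partial_deriv vs \<eta> y = (if vs = [] then 1 else 0)"
          by (rule partial_deriv_const_open[where S = "- cball 0 2"]) (use 3 zero in \<open>auto simp: \<eta>_def\<close>)
        then have "norm (partial_deriv vs \<eta> y) \<le> 1 * 1" by simp
        also have "\<dots> \<le> max B 1 * norm y" using 3 by (intro mult_mono) auto
        finally show ?thesis .
      qed
    qed
    then show ?thesis by blast
  qed
  have scale: "partial_deriv vs (\<lambda>x. 1 - \<psi> (s *\<^sub>R x)) = (\<lambda>x. of_real s ^ length vs * partial_deriv vs \<eta> (s *\<^sub>R x))"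
    if "set vs \<subseteq> Basis" for s vs
    using partial_deriv_scale[OF \<eta> that, of s] by (simp add: \<eta>_def)
  show ?thesis
    unfolding derivs_in_iff_partial_deriv
  proof (intro allI impI conjI)
    fix vs :: "'a list" assume vs: "set vs \<subseteq> Basis"
    obtain B where B: "\<And>y. norm (partial_deriv vs \<eta> y) \<le> B * norm y" using bd[OF vs] by blast
    have "norm (partial_deriv vs (\<lambda>x. 1 - \<psi> ((1 / real (Suc n)) *\<^sub>R x)) x) \<le> \<bar>B\<bar> * (1 / real (Suc n)) * (1 + norm x) ^ 1" for n x
    proof -
      let ?s = "1 / real (Suc n)"
      have "norm (partial_deriv vs (\<lambda>x. 1 - \<psi> (?s *\<^sub>R x)) x) = ?s ^ length vs * norm (partial_deriv vs \<eta> (?s *\<^sub>R x))"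
        unfolding scale[OF vs] norm_mult norm_power norm_of_real by (simp only: abs_of_nonneg zero_le_divide_1_iff of_nat_0_le_iff)
      also have "\<dots> \<le> 1 * (\<bar>B\<bar> * norm (?s *\<^sub>R x))"
        by (intro mult_mono power_le_one order_trans[OF B] mult_right_mono) auto
      also have "\<dots> = \<bar>B\<bar> * ?s * norm x" by simp
      also have "\<dots> \<le> \<bar>B\<bar> * ?s * (1 + norm x) ^ 1" by (intro mult_left_mono) auto
      finally show ?thesis .
    qed
    then show "growth (\<lambda>n. 1 / real (Suc n)) (\<lambda>n. partial_deriv vs (\<lambda>x. 1 - \<psi> ((1 / real (Suc n)) *\<^sub>R x)))"
      unfolding growth_def by blast
  next
    fix vs :: "'a list" and n x assume vs: "set vs \<subseteq> Basis"
    have "linear (\<lambda>x::'a. s *\<^sub>R x)" for s :: real by (simp add: linearI scaleR_add_right)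
    from has_derivative_affine[OF _ this, of "partial_deriv vs \<eta>" 0]
      derivs_in_differentiable[OF derivs_in_partial_deriv[OF \<eta>[unfolded smooth_iff_derivs_in] vs]]
    show "partial_deriv vs (\<lambda>x. 1 - \<psi> ((1 / real (Suc n)) *\<^sub>R x)) differentiable (at x)"
      unfolding scale[OF vs] differentiable_def by fastforce
  qed
qed

subsection \<open>Supports of distributions\<close>

text \<open>These are the properties that the support argument uses, with bounds along sequences
  because truncation supplies a sequence. They pass at once from a tempered distribution to its
  composition with additive operators that preserve decaying families.\<close>

definition schwartz_continuous :: "'a::euclidean_space functional \<Rightarrow> bool" where
  "schwartz_continuous u \<longleftrightarrow>
     (\<forall>f g. schwartz f \<longrightarrow> schwartz g \<longrightarrow> u (\<lambda>x. f x + g x) = u f + u g) \<and>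
     (\<forall>(f :: nat \<Rightarrow> _) a. derivs_in (decay a) f \<longrightarrow> (\<exists>C. \<forall>n. norm (u (f n)) \<le> C * a n))"

text \<open>A partition of unity made step by step: for each ball of a finite cover a cutoff splits
  off a piece annihilated by \<open>u\<close>, and the rest is supported in the remaining
  balls.\<close>

lemma vanishes_on_compactly_supported:
  fixes u :: "'a::euclidean_space functional"
  assumes u: "schwartz_continuous u" and f: "smooth f" "compact (closure {x. f x \<noteq> 0})"
    and disj: "closure {x. f x \<noteq> 0} \<inter> dist_supp u = {}"
  shows "u f = 0"
proof -
  have add: "u (\<lambda>x. f x + g x) = u f + u g" if "schwartz f" "schwartz g" for f g
    using u that by (simp add: schwartz_continuous_def)
  \<comment> \<open>The cutoff is 1 on the ball of radius \<open>\<rho>\<close> and supported in the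
    closed ball of twice that radius, so the larger ball must lie in an annihilated open
    set.\<close>
  let ?V = "\<lambda>(c, \<rho>). \<rho> > 0 \<and> (\<exists>U. open U \<and> (\<forall>f. test_function_on U f \<longrightarrow> u f = 0) \<and> cball c (2 * \<rho>) \<subseteq> U)"
  have local: "u f = 0" if "finite F" "\<And>p. p \<in> F \<Longrightarrow> ?V p" "smooth f" "compact (closure {x. f x \<noteq> 0})"
      "{x. f x \<noteq> 0} \<subseteq> (\<Union>(c, \<rho>)\<in>F. ball c \<rho>)" for F f
    using that
  proof (induction F arbitrary: f rule: finite_induct)
    case empty
    then have "f = (\<lambda>x. 0)" by auto
    moreover have "schwartz (\<lambda>x::'a. 0)"
      using derivs_in_def derivs_upto_zero[OF function_space_decay] unfolding schwartz_iff_derivs_in by blast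
    ultimately show ?case using add[of "\<lambda>x. 0" "\<lambda>x. 0"] by simp
  next
    case (insert p F)
    obtain c \<rho> where p: "p = (c, \<rho>)" by (cases p)
    then obtain U where \<rho>: "\<rho> > 0" and U: "open U" "\<And>f. test_function_on U f \<Longrightarrow> u f = 0" "cball c (2 * \<rho>) \<subseteq> U"
      using insert.prems(1)[of p] by auto
    obtain \<psi> where \<psi>: "smooth \<psi>" "\<And>x. norm (x - c) \<le> \<rho> \<Longrightarrow> \<psi> x = 1" "\<And>x. norm (x - c) \<ge> 2 * \<rho> \<Longrightarrow> \<psi> x = 0"
      using smooth_cutoff[OF \<rho>, of c] by blast
    let ?g = "\<lambda>x. \<psi> x * f x" and ?h = "\<lambda>x. (1 - \<psi> x) * f x"
    have sm: "smooth ?g" "smooth ?h"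
      by (intro smooth_mult smooth_diff smooth_const \<psi> insert.prems)+
    have "{x. ?g x \<noteq> 0} \<subseteq> {x. f x \<noteq> 0}" "{x. ?h x \<noteq> 0} \<subseteq> {x. f x \<noteq> 0}" by auto
    then have cp: "compact (closure {x. ?g x \<noteq> 0})" "compact (closure {x. ?h x \<noteq> 0})"
      using compact_closure_subset[OF insert.prems(3)] by blast+
    have "closure {x. ?g x \<noteq> 0} \<subseteq> cball c (2 * \<rho>)"
    proof (rule closure_minimal)
      show "{x. ?g x \<noteq> 0} \<subseteq> cball c (2 * \<rho>)"
      proof
        fix x assume "x \<in> {x. ?g x \<noteq> 0}"
        then have "norm (x - c) < 2 * \<rho>" using \<psi>(3)[of x] by fastforce
        then show "x \<in> cball c (2 * \<rho>)" by (simp add: dist_norm norm_minus_commute)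
      qed
    qed simp
    then have "test_function_on U ?g" using sm cp U unfolding test_function_on_def by blast
    then have g0: "u ?g = 0" by (rule U)
    have h0: "u ?h = 0"
    proof (rule insert.IH)
      show "{x. ?h x \<noteq> 0} \<subseteq> (\<Union>(c, \<rho>)\<in>F. ball c \<rho>)"
      proof
        fix x assume x: "x \<in> {x. ?h x \<noteq> 0}"
        then have "\<psi> x \<noteq> 1" "f x \<noteq> 0" by auto
        then have "x \<notin> ball c \<rho>" using \<psi>(2)[of x] by (force simp: dist_norm norm_minus_commute)
        moreover have "x \<in> (\<Union>(c, \<rho>)\<in>insert p F. ball c \<rho>)" using \<open>f x \<noteq> 0\<close> insert.prems(4) by blast
        ultimately show "x \<in> (\<Union>(c, \<rho>)\<in>F. ball c \<rho>)" by (auto simp: p)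
      qed
    qed (use sm cp insert.prems(1) in auto)
    have "u (\<lambda>x. ?g x + ?h x) = u ?g + u ?h"
      by (intro add compactly_supported_schwartz sm cp)
    then show ?case using g0 h0 by (simp add: algebra_simps)
  qed
  let ?K = "closure {x. f x \<noteq> 0}"
  have ex: "\<exists>\<rho>. ?V (x, \<rho>)" if "x \<in> ?K" for x
  proof -
    have "x \<notin> dist_supp u" using that disj by blast
    then obtain U where U: "open U" "x \<in> U" "\<forall>f. test_function_on U f \<longrightarrow> u f = 0"
      unfolding dist_supp_def by auto
    obtain e where "e > 0" "cball x e \<subseteq> U" using U(1,2) open_contains_cball by blast
    then show ?thesis using U by (intro exI[of _ "e / 2"]) auto
  qed
  define \<rho> where "\<rho> x = (SOME \<rho>. ?V (x, \<rho>))" for x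
  have \<rho>: "?V (x, \<rho> x)" if "x \<in> ?K" for x
    unfolding \<rho>_def by (rule someI_ex[OF ex[OF that]])
  have "?K \<subseteq> (\<Union>x\<in>?K. ball x (\<rho> x))" using \<rho> by fastforce
  then obtain D where D: "D \<subseteq> ?K" "finite D" "?K \<subseteq> (\<Union>x\<in>D. ball x (\<rho> x))"
    using compactE_image[OF f(2), of ?K "\<lambda>x. ball x (\<rho> x)"] by auto
  show ?thesis
  proof (rule local[of "(\<lambda>x. (x, \<rho> x)) ` D"])
    show "?V p" if "p \<in> (\<lambda>x. (x, \<rho> x)) ` D" for p using that D(1) \<rho> by blast
    show "{x. f x \<noteq> 0} \<subseteq> (\<Union>(c, \<rho>)\<in>(\<lambda>x. (x, \<rho> x)) ` D. ball c \<rho>)"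
      using D(3) closure_subset[of "{x. f x \<noteq> 0}"] by auto
  qed (use D f in auto)
qed

text \<open>\<open>dist_supp\<close> speaks about compactly supported functions, whereas the partial
  transform used in \<open>frequency_in_projection\<close> has no compact support. Truncation at a
  radius of order \<open>Suc n\<close> gives a function annihilated by \<open>u\<close>, and on the
  error \<open>u\<close> is at most a multiple of \<open>1 / real (Suc n)\<close>.\<close>

lemma vanishes_off_support:
  fixes u :: "'a::euclidean_space functional"
  assumes u: "schwartz_continuous u" and f: "schwartz f"
    and disj: "closure {x. f x \<noteq> 0} \<inter> dist_supp u = {}"
  shows "u f = 0"
proof -
  obtain \<psi> :: "'a \<Rightarrow> complex" where "smooth \<psi>" "\<And>x. norm (x - 0) \<le> 1 \<Longrightarrow> \<psi> x = 1" "\<And>x. norm (x - 0) \<ge> 2 * 1 \<Longrightarrow> \<psi> x = 0"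
    using smooth_cutoff[of 1 "0::'a"] by (metis zero_less_one)
  then have \<psi>: "smooth \<psi>" "\<And>x. norm x \<le> 1 \<Longrightarrow> \<psi> x = 1" "\<And>x. norm x \<ge> 2 \<Longrightarrow> \<psi> x = 0" by auto
  let ?m = "\<lambda>n x. 1 - \<psi> ((1 / real (Suc n)) *\<^sub>R x)"
  note m = cutoff_complement_growth[OF \<psi>]
  have h: "derivs_in (decay (\<lambda>n. 1 * (1 / real (Suc n)))) (\<lambda>n x. f x * ?m n x)"
    by (rule derivs_in_decay_mult[OF schwartz_imp_derivs_in[OF f] m])
  then obtain C where C: "\<And>n. norm (u (\<lambda>x. f x * ?m n x)) \<le> C * (1 * (1 / real (Suc n)))"
    using u unfolding schwartz_continuous_def by blast
  have "u f = u (\<lambda>x. f x * ?m n x)" for n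
  proof -
    let ?g = "\<lambda>x. f x - f x * ?m n x"
    have g: "schwartz ?g" by (intro schwartz_diff f derivs_in_imp_schwartz[OF h])
    have "{x. ?g x \<noteq> 0} \<subseteq> cball 0 (2 * real (Suc n))"
    proof
      fix x assume "x \<in> {x. ?g x \<noteq> 0}"
      then have "\<psi> ((1 / real (Suc n)) *\<^sub>R x) \<noteq> 0" by (auto simp: algebra_simps)
      then have "norm ((1 / real (Suc n)) *\<^sub>R x) < 2" using \<psi>(3) not_le by blast
      then have "norm x < 2 * real (Suc n)" by (simp add: pos_divide_less_eq)
      then show "x \<in> cball 0 (2 * real (Suc n))" by simp
    qed
    then have cp: "compact (closure {x. ?g x \<noteq> 0})"
      by (meson bounded_cball bounded_subset compact_closure)
    have "{x. ?g x \<noteq> 0} \<subseteq> {x. f x \<noteq> 0}" by auto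
    from closure_mono[OF this] have "closure {x. ?g x \<noteq> 0} \<inter> dist_supp u = {}" using disj by blast
    then have "u ?g = 0"
      using g cp by (intro vanishes_on_compactly_supported[OF u]) (auto simp: schwartz_def)
    moreover have "u (\<lambda>x. ?g x + f x * ?m n x) = u ?g + u (\<lambda>x. f x * ?m n x)"
      using u g derivs_in_imp_schwartz[OF h] unfolding schwartz_continuous_def by blast
    ultimately show ?thesis by simp
  qed
  then have "norm (u f) \<le> C * (1 / real (Suc n))" for n using C by simp
  moreover have "(\<lambda>n. C * (1 / real (Suc n))) \<longlonglongrightarrow> C * 0"
    by (intro tendsto_intros LIMSEQ_inverse_real_of_nat[unfolded inverse_eq_divide])
  ultimately have "norm (u f) \<le> C * 0"
    by (intro LIMSEQ_le_const) auto
  then show ?thesis by simp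
qed

subsection \<open>Complex conjugation and affine substitutions\<close>

lemma has_derivative_cnj_comp:
  assumes "f differentiable (at x)"
  shows "((\<lambda>x. cnj (f x)) has_derivative (\<lambda>v. cnj (dir_deriv v f x))) (at x)"
  by (rule bounded_linear.has_derivative[OF bounded_linear_cnj has_derivative_dir_deriv[OF assms]])

lemma partial_deriv_cnj:
  assumes "smooth f" "set vs \<subseteq> Basis"
  shows "partial_deriv vs (\<lambda>x. cnj (f x)) = (\<lambda>x. cnj (partial_deriv vs f x))"
  using assms(2)
proof (induction vs)
  case (Cons v vs)
  have "partial_deriv vs f differentiable (at x)" for x
    using Cons.prems by (intro derivs_in_differentiable[OF derivs_in_partial_deriv[OF assms(1)[unfolded smooth_iff_derivs_in]]]) auto
  from has_derivative_cnj_comp[OF this]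
  have "dir_deriv v (\<lambda>x. cnj (partial_deriv vs f x)) = (\<lambda>x. cnj (dir_deriv v (partial_deriv vs f) x))"
    by (intro ext dir_deriv_eqI)
  with Cons show ?case unfolding partial_deriv_Cons by simp
qed simp

lemma smooth_cnj:
  assumes "smooth f" shows "smooth (\<lambda>x. cnj (f x))"
  unfolding smooth_def
proof (intro allI impI)
  fix vs :: "'a list" assume vs: "set vs \<subseteq> Basis"
  have "partial_deriv vs f differentiable (at x)" for x
    by (rule derivs_in_differentiable[OF derivs_in_partial_deriv[OF assms(1)[unfolded smooth_iff_derivs_in] vs]])
  then show "partial_deriv vs (\<lambda>x. cnj (f x)) differentiable_on UNIV"
    unfolding partial_deriv_cnj[OF assms vs] differentiable_on_def
    using has_derivative_cnj_comp unfolding differentiable_def by blast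
qed

lemma schwartz_cnj: "schwartz f \<Longrightarrow> schwartz (\<lambda>x. cnj (f x))"
  by (simp add: schwartz_def smooth_cnj partial_deriv_cnj)

lemma tempered_cnj:
  assumes u: "tempered_distribution u"
  shows "tempered_distribution (cnj_distribution u)"
  unfolding tempered_distribution_def
proof (intro conjI allI impI)
  show "cnj_distribution u (\<lambda>x. f x + g x) = cnj_distribution u f + cnj_distribution u g"
    if "schwartz f" "schwartz g" for f g
    using tempered_add[OF u schwartz_cnj[OF that(1)] schwartz_cnj[OF that(2)]] by (simp add: cnj_distribution_def)
  show "cnj_distribution u (\<lambda>x. c * f x) = c * cnj_distribution u f" if "schwartz f" for c f
    using tempered_cmult[OF u schwartz_cnj[OF that], of "cnj c"] by (simp add: cnj_distribution_def)
  obtain C N where C: "\<And>f. schwartz f \<Longrightarrow> norm (u f) \<le>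
      C * (\<Sum>vs\<in>{vs. set vs \<subseteq> Basis \<and> length vs \<le> N}. \<Sum>k\<le>N. schwartz_seminorm k vs f)"
    using u unfolding tempered_distribution_def by blast
  have "norm (cnj_distribution u f) \<le>
      C * (\<Sum>vs\<in>{vs. set vs \<subseteq> Basis \<and> length vs \<le> N}. \<Sum>k\<le>N. schwartz_seminorm k vs f)" if f: "schwartz f" for f
  proof -
    have "schwartz_seminorm k vs (\<lambda>x. cnj (f x)) = schwartz_seminorm k vs f" if "set vs \<subseteq> Basis" for k vs
      using f that by (simp add: schwartz_seminorm_def partial_deriv_cnj schwartz_def)
    then show ?thesis
      using C[OF schwartz_cnj[OF f]] by (simp add: cnj_distribution_def)
  qed
  then show "\<exists>C N. \<forall>f. schwartz f \<longrightarrow> norm (cnj_distribution u f) \<le>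
      C * (\<Sum>vs\<in>{vs. set vs \<subseteq> Basis \<and> length vs \<le> N}. \<Sum>k\<le>N. schwartz_seminorm k vs f)" by blast
qed

lemma derivs_in_decay_affine:
  fixes L :: "'b::euclidean_space \<Rightarrow> 'a::euclidean_space"
  assumes f: "derivs_in (decay a) f" and L: "linear L"
    and K: "\<And>y. norm y \<le> K * (1 + norm (w + L y))"
  shows "derivs_in (decay a) (\<lambda>i y. f i (w + L y))"
proof -
  have "derivs_in (decay a) (\<lambda>i y. 1 * f i (w + L y))"
  proof (rule derivs_in_affine[OF function_space_decay L _ f], rule decay_affine, assumption)
    fix k
    have "norm (1::complex) * norm y ^ k \<le> K ^ k * (1 + norm (w + L y)) ^ k" for y
      using power_mono[OF K, of y k] by (simp add: power_mult_distrib)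
    then show "\<exists>C N. \<forall>i y. norm (1::complex) * norm y ^ k \<le> C * (1 + norm (w + L y)) ^ N" by blast
  qed
  then show ?thesis by simp
qed

lemma derivs_in_decay_linear:
  fixes L :: "'b::euclidean_space \<Rightarrow> 'a::euclidean_space"
  assumes f: "derivs_in (decay a) f" and L: "linear L" "inj L"
  shows "derivs_in (decay a) (\<lambda>i y. f i (L y))"
proof -
  obtain B where B: "B > 0" "\<And>y. B * norm y \<le> norm (L y)"
    using linear_inj_bounded_below_pos[OF L] by (auto simp: mult.commute)
  have "norm y \<le> (1 / B) * (1 + norm (0 + L y))" for y
    using B(1) B(2)[of y] by (simp add: pos_le_divide_eq mult.commute)
  from derivs_in_decay_affine[OF f L(1) this] show ?thesis by simp
qed

lemma schwartz_linear:
  fixes L :: "'b::euclidean_space \<Rightarrow> 'a::euclidean_space"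
  assumes "schwartz f" "linear L" "inj L"
  shows "schwartz (\<lambda>y. f (L y))"
  using derivs_in_decay_linear[of _ "\<lambda>_::unit. f"] assms by (simp add: schwartz_iff_derivs_in)

lemma schwartz_translate:
  assumes f: "schwartz f" shows "schwartz (\<lambda>y. f (w + y))"
proof -
  have "norm y \<le> (1 + norm w) * (1 + norm (w + y))" for y
  proof -
    have "norm y \<le> norm (w + y) + norm w" by (metis add_diff_cancel_left' norm_triangle_ineq4)
    also have "\<dots> \<le> (1 + norm w) * (1 + norm (w + y))" by (simp add: algebra_simps)
    finally show ?thesis .
  qed
  from derivs_in_decay_affine[OF f[unfolded schwartz_iff_derivs_in] linear_ident this] show ?thesis
    by (simp add: schwartz_iff_derivs_in)
qed

subsection \<open>Fourier inversion up to a constant\<close>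

interpretation full: splitting "\<lambda>t. t" "\<lambda>z. z"
  by unfold_locales (auto intro: linear_ident)

lemma full_pft: "full.pft = fourier"
  by (simp add: fun_eq_iff full.pft_def full.q_def fourier_def)

lemma derivs_in_fourier: "derivs_in (decay a) f \<Longrightarrow> derivs_in (decay a) (\<lambda>i. fourier (f i))"
  using full.derivs_in_pft unfolding full_pft .

lemma schwartz_fourier: "schwartz f \<Longrightarrow> schwartz (fourier f)"
  unfolding schwartz_iff_derivs_in by (rule derivs_in_fourier)

lemma fourier_add: "schwartz f \<Longrightarrow> schwartz g \<Longrightarrow> fourier (\<lambda>x. f x + g x) = (\<lambda>x. fourier f x + fourier g x)"
  using full.pft_add unfolding full_pft by blast

lemma fourier_cmult: "fourier (\<lambda>x. c * f x) = (\<lambda>x. c * fourier f x)"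
  using full.pft_cmult unfolding full_pft by blast

lemma integrable_fourier_kernel:
  "schwartz f \<Longrightarrow> integrable lborel (\<lambda>t. f t * cis (- 2 * pi * (c \<bullet> t)))"
  using full.pft_integrable[of f c c] by (simp add: full.q_def)

lemma measurable_fourier_kernel:
  "schwartz f \<Longrightarrow> (\<lambda>t. f t * cis (- 2 * pi * (c \<bullet> t))) \<in> borel_measurable borel"
  using borel_measurable_integrable[OF integrable_fourier_kernel] unfolding measurable_lborel2 .

lemma lborel_integral_scale:
  fixes h :: "'a::euclidean_space \<Rightarrow> complex"
  assumes [measurable]: "h \<in> borel_measurable borel" and c: "c > 0"
  shows "(LINT x|lborel. h x) = of_real (c ^ DIM('a)) * (LINT x|lborel. h (c *\<^sub>R x))"
proof -
  have "(LINT x|lborel. h x) = (LINT x|density (distr lborel borel (\<lambda>x. 0 + c *\<^sub>R x)) (\<lambda>_. ennreal (\<bar>c\<bar> ^ DIM('a))). h x)"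
    using lborel_affine[of c "0::'a"] c by simp
  also have "\<dots> = (LINT x|distr lborel borel (\<lambda>x. 0 + c *\<^sub>R x). (\<bar>c\<bar> ^ DIM('a)) *\<^sub>R h x)"
    by (rule integral_density) auto
  also have "\<dots> = (LINT x|lborel. (\<bar>c\<bar> ^ DIM('a)) *\<^sub>R h (0 + c *\<^sub>R x))"
    by (rule integral_distr) auto
  finally show ?thesis using c by (simp add: scaleR_conv_of_real)
qed

lemma schwartz_continuous_on: "schwartz f \<Longrightarrow> continuous_on S f"
  using derivs_in_continuous[OF schwartz_imp_derivs_in] .

lemma fourier_duality:
  assumes f: "schwartz f" and g: "schwartz g"
  shows "(LINT \<omega>|lborel. fourier f \<omega> * g \<omega>) = (LINT t|lborel. f t * fourier g t)"
proof -
  let ?F = "\<lambda>t \<omega>. f t * g \<omega> * cis (- 2 * pi * (\<omega> \<bullet> t))"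
  have "continuous_on UNIV (\<lambda>p. ?F (fst p) (snd p))"
    by (intro continuous_intros continuous_on_compose2[OF schwartz_continuous_on[OF f]]
        continuous_on_compose2[OF schwartz_continuous_on[OF g]]) auto
  then have "(\<lambda>p. ?F (fst p) (snd p)) \<in> borel_measurable (lborel \<Otimes>\<^sub>M lborel)"
    unfolding lborel_prod by (simp add: borel_measurable_continuous_onI)
  then have m: "(\<lambda>(t, \<omega>). ?F t \<omega>) \<in> borel_measurable (lborel \<Otimes>\<^sub>M lborel)"
    by (simp add: case_prod_beta)
  have "integrable lborel (\<lambda>\<omega>. ?F t \<omega>)" for t
    using integrable_mult_right[OF integrable_fourier_kernel[OF g, of t], of "f t"] by (simp add: mult.assoc inner_commute)
  moreover have "integrable lborel (\<lambda>t. LINT \<omega>|lborel. norm (?F t \<omega>))"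
  proof -
    have "integrable lborel (\<lambda>t. norm (f t) * (LINT \<omega>|lborel. norm (g \<omega>)))"
      by (intro integrable_mult_left integrable_norm schwartz_integrable f)
    then show ?thesis by (simp add: norm_mult)
  qed
  ultimately have int: "integrable (lborel \<Otimes>\<^sub>M lborel) (\<lambda>(t, \<omega>). ?F t \<omega>)"
    by (intro lborel_pair.Fubini_integrable m) auto
  have "(LINT \<omega>|lborel. fourier f \<omega> * g \<omega>) = (LINT \<omega>|lborel. LINT t|lborel. ?F t \<omega>)"
  proof (rule Bochner_Integration.integral_cong[OF refl])
    fix \<omega>
    have "fourier f \<omega> * g \<omega> = (LINT t|lborel. f t * cis (- 2 * pi * (\<omega> \<bullet> t)) * g \<omega>)"
      unfolding fourier_def by simp
    then show "fourier f \<omega> * g \<omega> = (LINT t|lborel. ?F t \<omega>)" by (simp add: mult_ac)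
  qed
  also have "\<dots> = (LINT t|lborel. LINT \<omega>|lborel. ?F t \<omega>)"
    by (rule lborel_pair.Fubini_integral[OF int])
  also have "\<dots> = (LINT t|lborel. f t * fourier g t)"
    unfolding fourier_def by (simp add: mult.assoc inner_commute)
  finally show ?thesis .
qed

text \<open>Substituting \<open>s *\<^sub>R y\<close> moves the dilation from \<open>g\<close> to
  \<open>f\<close>, and the Jacobian cancels against the one in the transform of the dilated
  \<open>g\<close>.\<close>

lemma fourier_scaled_duality:
  fixes f g :: "'a::euclidean_space \<Rightarrow> complex"
  assumes f: "schwartz f" and g: "schwartz g" and s: "s > 0"
  shows "(LINT \<omega>|lborel. fourier f \<omega> * g (s *\<^sub>R \<omega>)) = (LINT y|lborel. f (s *\<^sub>R y) * fourier g y)"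
proof -
  have "linear (\<lambda>x::'a. s *\<^sub>R x)" "inj (\<lambda>x::'a. s *\<^sub>R x)"
    using s by (auto simp: linearI scaleR_add_right inj_def)
  then have gs: "schwartz (\<lambda>\<omega>. g (s *\<^sub>R \<omega>))" by (intro schwartz_linear[OF g])
  have ft: "of_real (s ^ DIM('a)) * fourier (\<lambda>\<omega>. g (s *\<^sub>R \<omega>)) (s *\<^sub>R y) = fourier g y" for y
  proof -
    have "(\<lambda>\<omega>. g \<omega> * cis (- 2 * pi * (y \<bullet> \<omega>))) \<in> borel_measurable borel"
      by (rule measurable_fourier_kernel[OF g])
    from lborel_integral_scale[OF this s] show ?thesis
      unfolding fourier_def by (simp add: inner_commute)
  qed
  have "(LINT \<omega>|lborel. fourier f \<omega> * g (s *\<^sub>R \<omega>)) = (LINT t|lborel. f t * fourier (\<lambda>\<omega>. g (s *\<^sub>R \<omega>)) t)"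
    by (rule fourier_duality[OF f gs])
  also have "\<dots> = of_real (s ^ DIM('a)) * (LINT y|lborel. f (s *\<^sub>R y) * fourier (\<lambda>\<omega>. g (s *\<^sub>R \<omega>)) (s *\<^sub>R y))"
  proof (rule lborel_integral_scale[OF _ s])
    show "(\<lambda>t. f t * fourier (\<lambda>\<omega>. g (s *\<^sub>R \<omega>)) t) \<in> borel_measurable borel"
      by (intro borel_measurable_continuous_onI continuous_intros schwartz_continuous_on f schwartz_fourier gs)
  qed
  also have "\<dots> = (LINT y|lborel. of_real (s ^ DIM('a)) * (f (s *\<^sub>R y) * fourier (\<lambda>\<omega>. g (s *\<^sub>R \<omega>)) (s *\<^sub>R y)))"
    by (rule integral_mult_right_zero[symmetric])
  also have "\<dots> = (LINT y|lborel. f (s *\<^sub>R y) * fourier g y)"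
    unfolding ft[symmetric] by (simp add: mult_ac)
  finally show ?thesis .
qed

lemma tendsto_scaled_integral:
  fixes f g :: "'a::euclidean_space \<Rightarrow> complex"
  assumes f: "schwartz f" and g: "schwartz g"
  shows "(\<lambda>n. LINT x|lborel. f x * g ((1 / real (Suc n)) *\<^sub>R x)) \<longlonglongrightarrow> (LINT x|lborel. f x * g 0)"
proof -
  obtain B where B: "\<And>x. norm (g x) \<le> B"
    using g unfolding schwartz_def by (metis mult_1 partial_deriv.simps(1) power_0 empty_subsetI set_empty)
  show ?thesis
  proof (rule integral_dominated_convergence[where w = "\<lambda>x. norm (f x) * B"])
    show "(\<lambda>x. f x * g 0) \<in> borel_measurable lborel"
      using schwartz_integrable[OF f] by simp
    show "(\<lambda>x. f x * g ((1 / real (Suc n)) *\<^sub>R x)) \<in> borel_measurable lborel" for n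
      by (simp, intro borel_measurable_continuous_onI continuous_intros schwartz_continuous_on[OF f]
          continuous_on_compose2[OF schwartz_continuous_on[OF g]]) auto
    show "integrable lborel (\<lambda>x. norm (f x) * B)"
      by (intro integrable_mult_left integrable_norm schwartz_integrable f)
    have "isCont g 0"
      using schwartz_continuous_on[OF g, of UNIV] by (simp add: continuous_on_eq_continuous_at)
    moreover have "(\<lambda>n. (1 / real (Suc n)) *\<^sub>R x) \<longlonglongrightarrow> 0 *\<^sub>R x" for x :: 'a
      by (intro tendsto_intros LIMSEQ_inverse_real_of_nat[unfolded inverse_eq_divide])
    ultimately have "(\<lambda>n. g ((1 / real (Suc n)) *\<^sub>R x)) \<longlonglongrightarrow> g 0" for x
      by (intro isCont_tendsto_compose[of 0 g]) simp_all
    then show "AE x in lborel. (\<lambda>n. f x * g ((1 / real (Suc n)) *\<^sub>R x)) \<longlonglongrightarrow> f x * g 0"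
      by (intro AE_I2 tendsto_intros)
    show "AE x in lborel. norm (f x * g ((1 / real (Suc n)) *\<^sub>R x)) \<le> norm (f x) * B" for n
      by (intro AE_I2) (simp add: norm_mult mult_left_mono B)
  qed
qed

text \<open>The limit of scaled duality for scales \<open>1 / real (Suc n)\<close>. Fixing
  \<open>g\<close> with \<open>g 0 = 1\<close> shows that the integral of \<open>fourier f\<close>
  is a constant times \<open>f 0\<close>: inversion at the origin, without transforming a
  Gaussian.\<close>

lemma integral_fourier:
  fixes f g :: "'a::euclidean_space \<Rightarrow> complex"
  assumes f: "schwartz f" and g: "schwartz g"
  shows "(LINT \<omega>|lborel. fourier f \<omega>) * g 0 = (LINT \<omega>|lborel. fourier g \<omega>) * f 0"
proof -
  have "(LINT \<omega>|lborel. fourier f \<omega> * g ((1 / real (Suc n)) *\<^sub>R \<omega>)) = (LINT y|lborel. fourier g y * f ((1 / real (Suc n)) *\<^sub>R y))" for n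
    using fourier_scaled_duality[OF f g, of "1 / real (Suc n)"] by (simp add: mult.commute)
  then have "(LINT x|lborel. fourier f x * g 0) = (LINT x|lborel. fourier g x * f 0)"
    using tendsto_scaled_integral[OF schwartz_fourier[OF f] g] tendsto_scaled_integral[OF schwartz_fourier[OF g] f]
    by (simp add: LIMSEQ_unique)
  then show ?thesis by simp
qed

lemma schwartz_zero_if_square_integral_zero:
  fixes h :: "'a::euclidean_space \<Rightarrow> complex"
  assumes h: "schwartz h" and z: "(LINT x|lborel. h x * cnj (h x)) = 0"
  shows "h x = 0"
proof -
  obtain B where B: "\<And>x. norm (h x) \<le> B"
    using h unfolding schwartz_def by (metis mult_1 partial_deriv.simps(1) power_0 empty_subsetI set_empty)
  have [measurable]: "h \<in> borel_measurable borel"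
    by (intro borel_measurable_continuous_onI schwartz_continuous_on h)
  have int: "integrable lborel (\<lambda>x. (norm (h x))\<^sup>2)"
  proof (rule Bochner_Integration.integrable_bound[OF integrable_mult_left[OF integrable_norm[OF schwartz_integrable[OF h]], of B]])
    show "AE x in lborel. norm ((norm (h x))\<^sup>2) \<le> norm (norm (h x) * B)"
    proof (intro AE_I2)
      fix x
      have "norm (h x) * norm (h x) \<le> norm (h x) * B" by (intro mult_left_mono B) auto
      then show "norm ((norm (h x))\<^sup>2) \<le> norm (norm (h x) * B)" by (simp add: power2_eq_square)
    qed
  qed simp
  have "(LINT x|lborel. complex_of_real ((norm (h x))\<^sup>2)) = 0"
    using z by (simp only: complex_norm_square)
  then have "(LINT x|lborel. (norm (h x))\<^sup>2) = 0"
    by (simp only: integral_complex_of_real of_real_eq_0_iff)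
  then have "AE x in lborel. (norm (h x))\<^sup>2 = 0"
    using integral_nonneg_eq_0_iff_AE[OF int] by simp
  then have "AE x in lborel. x \<in> {x. h x = 0}" by simp
  then have ae: "AE x in lebesgue. x \<in> {x. h x = 0}" by (rule AE_completion)
  have "closed {x. h x = 0}"
    by (intro closed_Collect_eq schwartz_continuous_on h continuous_intros)
  from mem_closed_if_AE_lebesgue[OF this ae] show ?thesis by simp
qed

text \<open>\<open>smooth_cutoff\<close> gives no sign for \<open>\<psi>\<close>; the squared
  modulus \<open>\<psi> x * cnj (\<psi> x)\<close> is a bump whose integral cannot vanish.\<close>

lemma schwartz_bump:
  obtains \<psi> :: "'a::euclidean_space \<Rightarrow> complex"
  where "schwartz \<psi>" "schwartz (\<lambda>x. \<psi> x * cnj (\<psi> x))" "\<psi> 0 = 1"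
proof -
  obtain \<psi> :: "'a \<Rightarrow> complex" where \<psi>: "smooth \<psi>" "\<And>x. norm (x - 0) \<le> 1 \<Longrightarrow> \<psi> x = 1" "\<And>x. norm (x - 0) \<ge> 2 * 1 \<Longrightarrow> \<psi> x = 0"
    using smooth_cutoff[of 1 "0::'a"] by (metis zero_less_one)
  have "{x. \<psi> x \<noteq> 0} \<subseteq> cball 0 2" using \<psi>(3) by force
  then have cp: "compact (closure {x. \<psi> x \<noteq> 0})"
    unfolding compact_closure by (rule bounded_subset[OF bounded_cball])
  show ?thesis
  proof (rule that)
    show "schwartz \<psi>" by (rule compactly_supported_schwartz[OF \<psi>(1) cp])
    show "schwartz (\<lambda>x. \<psi> x * cnj (\<psi> x))"
    proof (rule compactly_supported_schwartz)
      show "compact (closure {x. \<psi> x * cnj (\<psi> x) \<noteq> 0})"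
        by (rule compact_closure_subset[OF cp]) auto
    qed (intro smooth_mult smooth_cnj \<psi>)
    show "\<psi> 0 = 1" using \<psi>(2)[of 0] by simp
  qed
qed

lemma fourier_fourier:
  obtains c where "c \<noteq> 0" "\<And>f x. schwartz (f :: 'a::euclidean_space \<Rightarrow> complex) \<Longrightarrow> fourier (fourier f) x = c * f (- x)"
proof -
  obtain \<psi> :: "'a \<Rightarrow> complex" where s\<psi>: "schwartz \<psi>" and \<psi>2: "schwartz (\<lambda>x. \<psi> x * cnj (\<psi> x))" and \<psi>0: "\<psi> 0 = 1"
    using schwartz_bump by blast
  define c where "c = (LINT \<omega>|lborel. fourier \<psi> \<omega>)"
  have inv0: "(LINT \<omega>|lborel. fourier f \<omega>) = c * f 0" if "schwartz f" for f :: "'a \<Rightarrow> complex"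
    using integral_fourier[OF that s\<psi>] by (simp add: c_def \<psi>0)
  have inv: "fourier (fourier f) x = c * f (- x)" if f: "schwartz f" for f :: "'a \<Rightarrow> complex" and x
  proof -
    \<comment> \<open>Inversion at \<open>- x\<close> is inversion at the origin for this
      translate.\<close>
    let ?g = "\<lambda>t. f (- x + t)"
    have "fourier ?g \<omega> = fourier f \<omega> * cis (- 2 * pi * (x \<bullet> \<omega>))" for \<omega>
    proof -
      have "(\<lambda>t. ?g t * cis (- 2 * pi * (\<omega> \<bullet> t))) \<in> borel_measurable borel"
        by (rule measurable_fourier_kernel[OF schwartz_translate[OF f]])
      from lborel_translate(1)[OF this, of x]
      have "fourier ?g \<omega> = (LINT t|lborel. f t * cis (- 2 * pi * (\<omega> \<bullet> t)) * cis (- 2 * pi * (x \<bullet> \<omega>)))"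
        by (simp add: fourier_def inner_add_right cis_mult algebra_simps inner_commute)
      then show ?thesis by (simp add: fourier_def)
    qed
    then have "fourier (fourier f) x = (LINT \<omega>|lborel. fourier ?g \<omega>)"
      by (simp add: fourier_def[of "fourier f"])
    also have "\<dots> = c * ?g 0" by (rule inv0[OF schwartz_translate[OF f]])
    finally show ?thesis by simp
  qed
  have "c \<noteq> 0"
  proof
    \<comment> \<open>Then every double transform vanishes, and duality turns the integral of the
      squared modulus of \<open>fourier f\<close> into one that contains a conjugated double
      transform. So all transforms vanish, including the one of
      \<open>\<psi> x * cnj (\<psi> x)\<close> at frequency 0, which is the integral of a squared
      modulus.\<close>
    assume c: "c = 0"
    have "fourier f x = 0" if f: "schwartz f" for f :: "'a \<Rightarrow> complex" and x
    proof (rule schwartz_zero_if_square_integral_zero[OF schwartz_fourier[OF f]])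
      have "fourier (\<lambda>\<omega>. cnj (fourier f \<omega>)) y = cnj (fourier (fourier f) (- y))" for y
      proof -
        have "cnj (fourier (fourier f) (- y)) = (LINT t|lborel. cnj (fourier f t * cis (- 2 * pi * (- y \<bullet> t))))"
          unfolding fourier_def[of "fourier f"] by (rule Bochner_Integration.integral_cnj[symmetric])
        then show ?thesis
          unfolding fourier_def[of "\<lambda>\<omega>. cnj (fourier f \<omega>)"] by (simp add: cis_cnj)
      qed
      then have "fourier (\<lambda>\<omega>. cnj (fourier f \<omega>)) y = 0" for y
        using inv[OF f] c by simp
      then show "(LINT x|lborel. fourier f x * cnj (fourier f x)) = 0"
        using fourier_duality[OF f schwartz_cnj[OF schwartz_fourier[OF f]]] by simp
    qed
    from this[OF \<psi>2] have "fourier (\<lambda>x. \<psi> x * cnj (\<psi> x)) 0 = 0" .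
    then have "(LINT x|lborel. \<psi> x * cnj (\<psi> x)) = 0" by (simp add: fourier_def)
    from schwartz_zero_if_square_integral_zero[OF s\<psi> this, of 0] show False using \<psi>0 by simp
  qed
  then show ?thesis using inv by (rule that)
qed

lemma fourier_surj:
  fixes h :: "'a::euclidean_space \<Rightarrow> complex"
  assumes h: "schwartz h"
  obtains f where "schwartz f" "fourier f = h"
proof -
  obtain c where c: "c \<noteq> 0" "\<And>f x. schwartz (f :: 'a \<Rightarrow> complex) \<Longrightarrow> fourier (fourier f) x = c * f (- x)"
    using fourier_fourier by blast
  have "linear (\<lambda>x::'a. - x)" "inj (\<lambda>x::'a. - x)" by (auto simp: linearI inj_def)
  then have k: "schwartz (\<lambda>x. h (- x))" by (rule schwartz_linear[OF h])
  show ?thesis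
  proof (rule that)
    show "schwartz (\<lambda>x. (1 / c) * fourier (\<lambda>x. h (- x)) x)"
      by (intro schwartz_cmult schwartz_fourier k)
    show "fourier (\<lambda>x. (1 / c) * fourier (\<lambda>x. h (- x)) x) = h"
      unfolding fourier_cmult using c(1) by (simp add: c(2)[OF k] fun_eq_iff)
  qed
qed

section \<open>Spectra of tempered distributions\<close>

lemma schwartz_continuous_fourier:
  fixes u :: "'a::euclidean_space functional"
  assumes u: "tempered_distribution u"
  shows "schwartz_continuous (fourier_distribution u)"
  unfolding schwartz_continuous_def fourier_distribution_def
proof (intro conjI allI impI)
  fix f g :: "'a \<Rightarrow> complex" assume "schwartz f" "schwartz g"
  then show "u (fourier (\<lambda>x. f x + g x)) = u (fourier f) + u (fourier g)"
    by (simp add: fourier_add tempered_add[OF u] schwartz_fourier)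
next
  fix f :: "nat \<Rightarrow> 'a \<Rightarrow> complex" and a assume "derivs_in (decay a) f"
  then show "\<exists>C. \<forall>n. norm (u (fourier (f n))) \<le> C * a n"
    using tempered_family_bound[OF u derivs_in_fourier] by metis
qed

text \<open>If the support is empty, every Schwartz function is annihilated by the transform of
  \<open>u\<close>, and every Schwartz function is itself a Fourier transform.\<close>

lemma fourier_support_nonempty:
  fixes u :: "'a::euclidean_space functional"
  assumes u: "tempered_distribution u" and nz: "\<not> zero_distribution u"
  shows "dist_supp (fourier_distribution u) \<noteq> {}"
proof
  assume e: "dist_supp (fourier_distribution u) = {}"
  have "u h = 0" if h: "schwartz h" for h
  proof -
    obtain f where f: "schwartz f" "fourier f = h" using fourier_surj[OF h] by blast
    have "fourier_distribution u f = 0"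
      by (rule vanishes_off_support[OF schwartz_continuous_fourier[OF u] f(1)]) (simp add: e)
    then show ?thesis by (simp add: fourier_distribution_def f(2))
  qed
  then show False using nz by (simp add: zero_distribution_def)
qed

text \<open>The transform of \<open>x \<mapsto> cnj (g (- x))\<close> is the conjugate of the
  transform of \<open>g\<close>, so an open set annihilated for the conjugate distribution reflects
  to one annihilated for \<open>u\<close>.\<close>

lemma fourier_support_cnj:
  fixes u :: "'a::euclidean_space functional"
  assumes q: "q \<in> dist_supp (fourier_distribution u)"
  shows "- q \<in> dist_supp (fourier_distribution (cnj_distribution u))"
proof (rule ccontr)
  assume "- q \<notin> dist_supp (fourier_distribution (cnj_distribution u))"
  then obtain U where U: "open U" "- q \<in> U" "\<And>f. test_function_on U f \<Longrightarrow> fourier_distribution (cnj_distribution u) f = 0"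
    unfolding dist_supp_def by auto
  have "fourier_distribution u g = 0" if g: "test_function_on (uminus ` U) g" for g
  proof -
    let ?f = "\<lambda>x. cnj (g (- x))"
    have lin: "linear (\<lambda>x::'a. - x)" "inj (\<lambda>x::'a. - x)" by (auto simp: linearI inj_def)
    have supp: "closure {x. ?f x \<noteq> 0} = uminus ` closure {x. g x \<noteq> 0}"
    proof -
      have "{x. ?f x \<noteq> 0} = uminus ` {x. g x \<noteq> 0}"
        by (auto simp: image_iff) (metis minus_minus)
      then show ?thesis using closure_injective_linear_image[OF lin, of "{x. g x \<noteq> 0}"] by simp
    qed
    have gs: "schwartz g" using g by (intro compactly_supported_schwartz) (auto simp: test_function_on_def)
    have "smooth ?f"
      using schwartz_cnj[OF schwartz_linear[OF gs lin]] by (simp add: schwartz_def)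
    moreover have "compact (uminus ` closure {x. g x \<noteq> 0})"
      using g by (intro compact_continuous_image continuous_intros) (auto simp: test_function_on_def)
    moreover have "uminus ` closure {x. g x \<noteq> 0} \<subseteq> U"
      using g by (force simp: test_function_on_def)
    ultimately have "test_function_on U ?f" unfolding test_function_on_def supp by blast
    then have "cnj (u (\<lambda>x. cnj (fourier ?f x))) = 0"
      using U(3)[of ?f] by (simp add: fourier_distribution_def cnj_distribution_def)
    moreover have "cnj (fourier ?f x) = fourier g x" for x
    proof -
      have m: "(\<lambda>t. g t * cis (- 2 * pi * (x \<bullet> t))) \<in> borel_measurable borel"
        by (rule measurable_fourier_kernel[OF gs])
      have "fourier g x = (LINT t|distr lborel borel uminus. g t * cis (- 2 * pi * (x \<bullet> t)))"
        using lborel_affine[of "-1" "0::'a"] by (simp add: fourier_def density_1)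
      also have "\<dots> = (LINT t|lborel. g (- t) * cis (- 2 * pi * (x \<bullet> (- t))))"
        by (rule integral_distr[OF _ m]) simp
      also have "\<dots> = cnj (fourier ?f x)"
      proof -
        have "cnj (fourier ?f x) = (LINT t|lborel. cnj (?f t * cis (- 2 * pi * (x \<bullet> t))))"
          unfolding fourier_def by (rule Bochner_Integration.integral_cnj[symmetric])
        then show ?thesis by (simp add: cis_cnj)
      qed
      finally show ?thesis by simp
    qed
    ultimately show ?thesis by (simp add: fourier_distribution_def)
  qed
  moreover have "open (uminus ` U)" "q \<in> uminus ` U"
    using U(1,2) open_negations by (auto simp: image_iff intro: bexI[of _ "- q"])
  ultimately show False using q unfolding dist_supp_def by auto
qed

subsection \<open>Integration over the product space\<close>

lemma linear_part1: "linear part1" and linear_part2: "linear part2"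
  by (rule linearI; simp add: part1_def part2_def vec_eq_iff)+

lemma norm_part1_le: "norm (part1 z) \<le> norm z" and norm_part2_le: "norm (part2 z) \<le> norm z"
  using norm_le_norm_join[of "part1 z" "part2 z"] norm_le_norm_join(2)[of "part2 z" "part1 z"] by simp_all

lemma continuous_on_join [continuous_intros]:
  fixes f g :: "'a::euclidean_space \<Rightarrow> real^'d::finite"
  assumes "continuous_on S f" "continuous_on S g"
  shows "continuous_on S (\<lambda>x. join (f x) (g x))"
proof -
  have "continuous_on S (\<lambda>x. join (f x) 0 + join 0 (g x))"
    using linear_continuous_on_compose[OF assms(1) linear_join_left]
      linear_continuous_on_compose[OF assms(2) linear_join_right] by (rule continuous_on_add)
  then show ?thesis by (simp add: join_add)
qed

lemma Basis_cart: "(Basis :: (real^'n) set) = range (\<lambda>i. axis i 1)"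
  by (auto simp: Basis_vec_def)

lemma prod_Basis_cart: "(\<Prod>b\<in>(Basis :: (real^'n) set). (x :: real^'n) \<bullet> b) = (\<Prod>i\<in>UNIV. x $ i)"
proof -
  have "inj (\<lambda>i::'n. axis i (1::real))" by (auto simp: inj_def axis_eq_axis)
  then show ?thesis unfolding Basis_cart by (subst prod.reindex) (simp_all add: inner_axis)
qed

lemma measurable_join: "(\<lambda>(x, y). join x y) \<in> lborel \<Otimes>\<^sub>M lborel \<rightarrow>\<^sub>M borel"
  unfolding lborel_prod case_prod_beta
  by (simp, intro borel_measurable_continuous_onI continuous_intros)

text \<open>\<open>real^('d + 'd)\<close> is not a type of pairs, so Lebesgue measure is identified
  through its values on boxes, which split along the sum index type.\<close>

lemma lborel_join:
  "distr (lborel \<Otimes>\<^sub>M lborel) borel (\<lambda>(x, y). join x y) = (lborel :: (real^('d::finite + 'd)) measure)"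
proof (rule lborel_eqI[symmetric])
  fix l u :: "real^('d + 'd)" assume le: "\<And>b. b \<in> Basis \<Longrightarrow> l \<bullet> b \<le> u \<bullet> b"
  have le': "l $ i \<le> u $ i" for i
    using le[of "axis i 1"] by (auto simp: Basis_cart inner_axis)
  have le1: "part1 l \<bullet> b \<le> part1 u \<bullet> b" "part2 l \<bullet> b \<le> part2 u \<bullet> b" if "b \<in> Basis" for b
    using that le' by (auto simp: Basis_cart inner_axis part1_def part2_def)
  have "(\<lambda>(x, y). join x y) -` box l u \<inter> space (lborel \<Otimes>\<^sub>M lborel) =
      box (part1 l) (part1 u) \<times> box (part2 l) (part2 u)"
    by (auto simp: mem_box_cart join_def part1_def part2_def space_pair_measure split_sum_all)
  then have "emeasure (distr (lborel \<Otimes>\<^sub>M lborel) borel (\<lambda>(x, y). join x y)) (box l u) =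
      emeasure (lborel \<Otimes>\<^sub>M lborel) (box (part1 l) (part1 u) \<times> box (part2 l) (part2 u))"
    by (simp add: emeasure_distr[OF measurable_join])
  also have "\<dots> = emeasure lborel (box (part1 l) (part1 u)) * emeasure lborel (box (part2 l) (part2 u))"
    by (rule lborel.emeasure_pair_measure_Times) auto
  also have "\<dots> = ennreal (\<Prod>b\<in>Basis. (part1 u - part1 l) \<bullet> b) * ennreal (\<Prod>b\<in>Basis. (part2 u - part2 l) \<bullet> b)"
    using le1 by simp
  also have "\<dots> = ennreal ((\<Prod>i\<in>UNIV. (u - l) $ Inl i) * (\<Prod>i\<in>UNIV. (u - l) $ Inr i))"
    unfolding prod_Basis_cart using le'
    by (simp add: ennreal_mult'' prod_nonneg part1_def part2_def)
  also have "\<dots> = ennreal (\<Prod>b\<in>Basis. (u - l) \<bullet> b)"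
    unfolding prod_Basis_cart by (simp add: prod.Plus flip: UNIV_Plus_UNIV)
  finally show "emeasure (distr (lborel \<Otimes>\<^sub>M lborel) borel (\<lambda>(x, y). join x y)) (box l u) =
      ennreal (\<Prod>b\<in>Basis. (u - l) \<bullet> b)" .
qed simp

lemma integral_join:
  fixes h :: "real^('d::finite + 'd) \<Rightarrow> complex"
  assumes h: "integrable lborel h"
  shows "(LINT z|lborel. h z) = (LINT y|lborel. LINT x|lborel. h (join x y))"
proof -
  have hm: "h \<in> borel_measurable borel" using h by simp
  have "integrable (distr (lborel \<Otimes>\<^sub>M lborel) borel (\<lambda>(x, y). join x y)) h"
    using h by (simp only: lborel_join)
  then have int: "integrable (lborel \<Otimes>\<^sub>M lborel) (\<lambda>(x, y). h (join x y))"
    using integrable_distr_eq[OF measurable_join hm] by (simp add: split_def)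
  have "(LINT z|lborel. h z) = (LINT z|distr (lborel \<Otimes>\<^sub>M lborel) borel (\<lambda>(x, y). join x y). h z)"
    by (simp only: lborel_join)
  also have "\<dots> = integral\<^sup>L (lborel \<Otimes>\<^sub>M lborel) (\<lambda>(x, y). h (join x y))"
    using integral_distr[OF measurable_join hm] by (simp add: split_def)
  also have "\<dots> = (LINT y|lborel. LINT x|lborel. h (join x y))"
    by (rule lborel_pair.integral_snd[OF int, symmetric])
  finally show ?thesis .
qed

section \<open>Integrals under invertible linear substitutions\<close>

lemma lborel_reflect:
  fixes g :: "'b::euclidean_space \<Rightarrow> complex"
  assumes [measurable]: "g \<in> borel_measurable borel"
  shows "(LINT t|lborel. g (c - t)) = (LINT t|lborel. g t)"
proof -
  have "(LINT t|lborel. g t) = (LINT t|distr lborel borel (\<lambda>x. c - x). g t)"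
    using lborel_affine[of "-1" c] by (simp add: density_1)
  also have "\<dots> = (LINT t|lborel. g (c - t))"
    by (rule integral_distr) auto
  finally show ?thesis ..
qed

lemma integrable_convolution_kernel:
  fixes L :: "'a::euclidean_space \<Rightarrow> 'a" and f g :: "'a \<Rightarrow> complex"
  assumes f: "continuous_on UNIV f" "integrable lborel (\<lambda>z. f (L z))"
    and g: "continuous_on UNIV g" "integrable lborel g" and L: "linear L"
  shows "integrable (lborel \<Otimes>\<^sub>M lborel) (\<lambda>(z, y). f (L z) * g (y - L z))"
proof (rule lborel_pair.Fubini_integrable)
  have "continuous_on (UNIV :: ('a \<times> 'a) set) (\<lambda>p. L (fst p))"
    by (intro linear_continuous_on_compose[OF _ L] continuous_intros)
  then have "continuous_on UNIV (\<lambda>p. f (L (fst p)) * g (snd p - L (fst p)))"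
    by (intro continuous_intros continuous_on_compose2[OF f(1)] continuous_on_compose2[OF g(1)]) auto
  then have "(\<lambda>p. f (L (fst p)) * g (snd p - L (fst p))) \<in> borel_measurable (lborel \<Otimes>\<^sub>M lborel)"
    unfolding lborel_prod by (simp add: borel_measurable_continuous_onI)
  then show "(\<lambda>(z, y). f (L z) * g (y - L z)) \<in> borel_measurable (lborel \<Otimes>\<^sub>M lborel)"
    by (simp add: split_def)
  have gm: "g \<in> borel_measurable borel" using g(1) by (rule borel_measurable_continuous_onI)
  have "integrable lborel (\<lambda>y. g (y - L z))" for z
    using lborel_translate(2)[OF gm, of "- L z"] g(2) by simp
  then show "AE z in lborel. integrable lborel (\<lambda>y. case (z, y) of (z, y) \<Rightarrow> f (L z) * g (y - L z))"
    by simp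
  have cm: "(\<lambda>y. complex_of_real (norm (g y))) \<in> borel_measurable borel" using gm by simp
  have "(LINT y|lborel. norm (g (y - L z))) = (LINT y|lborel. norm (g y))" for z
  proof -
    have "complex_of_real (LINT y|lborel. norm (g (y - L z))) = complex_of_real (LINT y|lborel. norm (g y))"
      using lborel_translate(1)[OF cm, of "- L z"] by (simp only: integral_complex_of_real add_uminus_conv_diff uminus_add_conv_diff)
    then show ?thesis by (simp only: of_real_eq_iff)
  qed
  then show "integrable lborel (\<lambda>z. LINT y|lborel. norm (case (z, y) of (z, y) \<Rightarrow> f (L z) * g (y - L z)))"
    using f(2) by (simp add: norm_mult)
qed

text \<open>Haar uniqueness by Fubini: evaluating the integral of \<open>f (L z) * g (y - L z)\<close> in both orders
  exchanges the roles of \<open>f\<close> and \<open>g\<close>. Only the non-vanishing of the Jacobian factor is needed.\<close>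

lemma integral_linear_exchange:
  fixes L :: "'a::euclidean_space \<Rightarrow> 'a" and f g :: "'a \<Rightarrow> complex"
  assumes f: "continuous_on UNIV f" "integrable lborel f" "integrable lborel (\<lambda>z. f (L z))"
    and g: "continuous_on UNIV g" "integrable lborel g" "integrable lborel (\<lambda>z. g (L z))"
    and L: "linear L" "inj L"
  shows "(LINT z|lborel. f (L z)) * (LINT y|lborel. g y) = (LINT z|lborel. g (L z)) * (LINT y|lborel. f y)"
proof -
  have one: "(LINT y|lborel. LINT z|lborel. f (L z) * g (y - L z)) = (LINT z|lborel. f (L z)) * (LINT y|lborel. g y)"
    if f: "continuous_on UNIV f" "integrable lborel (\<lambda>z. f (L z))" and g: "continuous_on UNIV g" "integrable lborel g"
    for f g :: "'a \<Rightarrow> complex"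
  proof -
    have gm: "g \<in> borel_measurable borel" using g(1) by (rule borel_measurable_continuous_onI)
    have "(LINT y|lborel. LINT z|lborel. f (L z) * g (y - L z)) = (LINT z|lborel. LINT y|lborel. f (L z) * g (y - L z))"
      by (rule lborel_pair.Fubini_integral) (rule integrable_convolution_kernel[OF f g L(1)])
    also have "\<dots> = (LINT z|lborel. f (L z) * (LINT y|lborel. g y))"
      using lborel_translate(1)[OF gm, of "- L z" for z] by simp
    finally show ?thesis by simp
  qed
  have "(LINT z|lborel. f (L z) * g (y - L z)) = (LINT z|lborel. g (L z) * f (y - L z))" for y
  proof -
    \<comment> \<open>Since \<open>L\<close> is onto, replacing \<open>z\<close> by
      \<open>w - z\<close> turns \<open>f (L z) * g (y - L z)\<close> into the same expression with
      \<open>f\<close> and \<open>g\<close> interchanged.\<close>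
    obtain w where w: "y = L w" using linear_injective_imp_surjective[OF L] by (auto simp: surj_def)
    have cL: "continuous_on UNIV L" using L(1) by (simp add: linear_continuous_on linear_conv_bounded_linear)
    have m: "(\<lambda>z. f (L z) * g (y - L z)) \<in> borel_measurable borel"
      by (intro borel_measurable_continuous_onI continuous_intros continuous_on_compose2[OF f(1)]
          continuous_on_compose2[OF g(1)] cL) auto
    from lborel_reflect[OF m, of w] show ?thesis
      by (simp add: w linear_diff[OF L(1)] mult.commute)
  qed
  then show ?thesis
    using one[OF f(1,3) g(1,2)] one[OF g(1,3) f(1,2)] by simp
qed

text \<open>The constant is read off from one fixed function, the squared modulus of a bump: its
  integral and the integral of its composition with \<open>L\<close> are both non-zero, being
  integrals of squared moduli of non-zero Schwartz functions.\<close>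

lemma integral_linear_substitution:
  fixes L :: "'a::euclidean_space \<Rightarrow> 'a"
  assumes L: "linear L" "inj L"
  obtains c where "c \<noteq> 0" "\<And>f :: 'a \<Rightarrow> complex. continuous_on UNIV f \<Longrightarrow> integrable lborel f \<Longrightarrow>
    integrable lborel (\<lambda>z. f (L z)) \<Longrightarrow> (LINT z|lborel. f (L z)) = c * (LINT y|lborel. f y)"
proof -
  obtain \<psi> :: "'a \<Rightarrow> complex" where \<psi>: "schwartz \<psi>" "schwartz (\<lambda>x. \<psi> x * cnj (\<psi> x))" "\<psi> 0 = 1"
    using schwartz_bump by blast
  let ?g = "\<lambda>x. \<psi> x * cnj (\<psi> x)"
  have gL: "schwartz (\<lambda>x. ?g (L x))" using schwartz_linear[OF \<psi>(2) L] .
  have "(LINT x|lborel. ?g x) \<noteq> 0"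
    using schwartz_zero_if_square_integral_zero[OF \<psi>(1), of 0] \<psi>(3) by auto
  moreover have "(LINT x|lborel. ?g (L x)) \<noteq> 0"
    using schwartz_zero_if_square_integral_zero[OF schwartz_linear[OF \<psi>(1) L], of 0] \<psi>(3) linear_0[OF L(1)] by auto
  ultimately show ?thesis
    using integral_linear_exchange[OF _ _ _ schwartz_continuous_on[OF \<psi>(2)] schwartz_integrable[OF \<psi>(2)] schwartz_integrable[OF gL] L]
    by (intro that[of "(LINT x|lborel. ?g (L x)) / (LINT x|lborel. ?g x)"]) (auto simp: field_simps)
qed

subsection \<open>The matrix-Wigner transform\<close>

lemma join_diff: "join x y - join x' y' = join (x - x') (y - y')"
  by (simp add: join_def vec_eq_iff split: sum.split)

interpretation snd: splitting "\<lambda>t. join 0 t" part2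
  by (rule splitting.intro[OF linear_join_right linear_part2 part2_join norm_part2_le])

interpretation fst: splitting "\<lambda>t. join t 0" part1
  by (rule splitting.intro[OF linear_join_left linear_part1 part1_join norm_part1_le])

lemma snd_q: "snd.q z = join (part1 z) 0"
  using join_diff[of "part1 z" "part2 z" 0 "part2 z"] by (simp add: snd.q_def)

lemma fst_q: "fst.q z = join 0 (part2 z)"
  using join_diff[of "part1 z" "part2 z" "part1 z" 0] by (simp add: fst.q_def)

lemma snd_pft: "snd.pft = fourier2"
  by (simp add: fun_eq_iff snd.pft_def snd_q fourier2_def fourier_def join_add)

lemma fst_pft: "fst.pft f z = (LINT t|lborel. f (join t (part2 z)) * cis (- 2 * pi * (part1 z \<bullet> t)))"
  by (simp add: fst.pft_def fst_q join_add)

lemma derivs_in_fourier2: "derivs_in (decay a) f \<Longrightarrow> derivs_in (decay a) (\<lambda>i. fourier2 (f i))"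
  using snd.derivs_in_pft unfolding snd_pft .

lemma matrix_inv_mult:
  fixes A :: "real^'n^'n"
  assumes "invertible A"
  shows "A ** matrix_inv A = mat 1" "matrix_inv A ** A = mat 1" "invertible (matrix_inv A)"
proof -
  have "A ** matrix_inv A = mat 1 \<and> matrix_inv A ** A = mat 1"
    using assms unfolding matrix_inv_def invertible_def by (rule someI_ex)
  then show "A ** matrix_inv A = mat 1" "matrix_inv A ** A = mat 1" "invertible (matrix_inv A)"
    unfolding invertible_def by blast+
qed

text \<open>As a simp rule it rewrites \<open>transpose A *v x\<close> to \<open>x v* A\<close>,
  away from the form in which the facts below are stated.\<close>

declare transpose_matrix_vector [simp del]

lemma inner_transpose: "(transpose A *v v) \<bullet> w = v \<bullet> (A *v w)" for A :: "real^'n^'m"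
  by (simp add: dot_lmul_matrix transpose_matrix_vector)

text \<open>The partial transform, the linear substitution and the slicing by \<open>\<nu>\<close>
  each preserve decaying families with the same \<open>a\<close>, so the bound after applying
  \<open>\<mu>\<close> is again a multiple of \<open>a\<close>.\<close>

lemma schwartz_continuous_matrix_wigner:
  fixes \<mu> \<nu> :: "(real^'d::finite) functional"
  assumes \<mu>: "tempered_distribution \<mu>" and \<nu>: "tempered_distribution \<nu>" and T: "invertible T"
  shows "schwartz_continuous (matrix_wigner T \<mu> \<nu>)"
proof -
  let ?\<nu> = "cnj_distribution \<nu>" and ?M = "matrix_inv T"
  let ?\<Phi> = "\<lambda>f z. fourier2 f (?M *v z)"
  note \<nu>' = tempered_cnj[OF \<nu>]
  have inv: "invertible ?M" by (rule matrix_inv_mult[OF T])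
  have W: "matrix_wigner T \<mu> \<nu> f = \<mu> (\<lambda>x. ?\<nu> (\<lambda>y. ?\<Phi> f (join x y))) / complex_of_real \<bar>det T\<bar>" for f
    by (simp add: matrix_wigner_def fourier2_distribution_def pullback_distribution_def tensor_distribution_def)
  note \<Phi> = derivs_in_decay_linear[OF derivs_in_fourier2 matrix_vector_mul_linear inj_matrix_vector_mult[OF inv]]
  have s: "schwartz (?\<Phi> f)" "schwartz (\<lambda>x. ?\<nu> (\<lambda>y. ?\<Phi> f (join x y)))" if "schwartz f" for f
    using \<Phi> derivs_in_tempered_slice[OF \<nu>' \<Phi>] that unfolding schwartz_iff_derivs_in by blast+
  show ?thesis
    unfolding schwartz_continuous_def
  proof (intro conjI allI impI)
    fix f g :: "real^('d + 'd) \<Rightarrow> complex" assume fg: "schwartz f" "schwartz g"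
    have add: "fourier2 (\<lambda>x. f x + g x) z = fourier2 f z + fourier2 g z" for z
      using snd.pft_add[OF fg] unfolding snd_pft .
    show "matrix_wigner T \<mu> \<nu> (\<lambda>x. f x + g x) = matrix_wigner T \<mu> \<nu> f + matrix_wigner T \<mu> \<nu> g"
      unfolding W add tempered_add[OF \<nu>' schwartz_slice[OF s(1)[OF fg(1)]] schwartz_slice[OF s(1)[OF fg(2)]]]
        tempered_add[OF \<mu> s(2)[OF fg(1)] s(2)[OF fg(2)]] by (rule add_divide_distrib)
  next
    fix f :: "nat \<Rightarrow> real^('d + 'd) \<Rightarrow> complex" and a assume f: "derivs_in (decay a) f"
    obtain C where C: "\<And>i. norm (\<mu> (\<lambda>x. ?\<nu> (\<lambda>y. ?\<Phi> (f i) (join x y)))) \<le> C * a i"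
      using tempered_family_bound[OF \<mu> derivs_in_tempered_slice[OF \<nu>' \<Phi>[OF f]]] by blast
    have "norm (matrix_wigner T \<mu> \<nu> (f n)) \<le> (C / \<bar>det T\<bar>) * a n" for n
      using divide_right_mono[OF C[of n], of "\<bar>det T\<bar>"] by (simp add: W norm_divide)
    then show "\<exists>C. \<forall>n. norm (matrix_wigner T \<mu> \<nu> (f n)) \<le> C * a n" by blast
  qed
qed

lemma schwartz_tensor:
  fixes f g :: "real^'d::finite \<Rightarrow> complex"
  assumes f: "test_function_on U f" and g: "test_function_on V g"
  shows "schwartz (\<lambda>z :: real^('d + 'd). f (part1 z) * g (part2 z))"
proof (rule compactly_supported_schwartz)
  have sm: "smooth (\<lambda>z. h (p z))" if h: "smooth h" and p: "linear p"
    for h and p :: "real^('d + 'd) \<Rightarrow> real^'d"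
    using derivs_in_affine[OF function_space_True p TrueI h[unfolded smooth_iff_derivs_in], of "\<lambda>_. 1" "\<lambda>_. 0"]
    by (simp add: derivs_in_True)
  show "smooth (\<lambda>z :: real^('d + 'd). f (part1 z) * g (part2 z))"
    using f g by (intro smooth_mult sm linear_part1 linear_part2) (auto simp: test_function_on_def)
  have "bounded {x. f x \<noteq> 0}" "bounded {x. g x \<noteq> 0}"
    using f g by (auto simp: test_function_on_def compact_closure)
  then obtain A B where A: "\<And>x. f x \<noteq> 0 \<Longrightarrow> norm x \<le> A" and B: "\<And>x. g x \<noteq> 0 \<Longrightarrow> norm x \<le> B"
    unfolding bounded_iff by auto
  have "bounded {z :: real^('d + 'd). f (part1 z) * g (part2 z) \<noteq> 0}"
    unfolding bounded_iff
  proof (intro exI ballI)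
    fix z :: "real^('d + 'd)" assume "z \<in> {z. f (part1 z) * g (part2 z) \<noteq> 0}"
    then have "norm (part1 z) \<le> A" "norm (part2 z) \<le> B" using A B by auto
    moreover have "norm z \<le> norm (join (part1 z) 0) + norm (join 0 (part2 z))"
      using norm_triangle_ineq[of "join (part1 z) 0" "join 0 (part2 z)"] by (simp add: join_add)
    moreover have "norm (join (part1 z) 0) = norm (part1 z)" "norm (join 0 (part2 z)) = norm (part2 z)"
      using norm_join[of "part1 z" 0] norm_join[of 0 "part2 z"] by (auto simp: power2_eq_iff_nonneg)
    ultimately show "norm z \<le> A + B" by linarith
  qed
  then show "compact (closure {z :: real^('d + 'd). f (part1 z) * g (part2 z) \<noteq> 0})"
    by (simp add: compact_closure)
qed

text \<open>The two partial transforms compose to the full one, and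
  \<open>(M *v v) \<bullet> z = v \<bullet> (transpose M *v z)\<close>, so the whole integrand is a
  function of \<open>transpose M *v z\<close>. A linear substitution then separates the variables;
  \<open>c\<close> is its Jacobian factor.\<close>

lemma fourier2_pft_tensor:
  fixes M :: "real^('d::finite + 'd)^('d + 'd)"
  assumes M: "invertible M"
  obtains c where "c \<noteq> 0"
    "\<And>f g x y. schwartz (\<lambda>z :: real^('d + 'd). f (part1 z) * g (part2 z)) \<Longrightarrow>
      fourier2 (fst.pft (\<lambda>z. f (part1 (transpose M *v z)) * g (part2 (transpose M *v z)))) (M *v join x y) =
      c * (fourier f x * fourier g y)"
proof -
  have Mt: "invertible (transpose M)" by (rule transpose_invertible[OF M])
  obtain c where c: "c \<noteq> 0" "\<And>f :: real^('d + 'd) \<Rightarrow> complex. continuous_on UNIV f \<Longrightarrow> integrable lborel f \<Longrightarrow>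
    integrable lborel (\<lambda>z. f (transpose M *v z)) \<Longrightarrow> (LINT z|lborel. f (transpose M *v z)) = c * (LINT y|lborel. f y)"
    using integral_linear_substitution[OF matrix_vector_mul_linear inj_matrix_vector_mult[OF Mt]] by blast
  show ?thesis
  proof (rule that[OF c(1)])
    fix f g :: "real^'d \<Rightarrow> complex" and x y
    let ?K = "\<lambda>z :: real^('d + 'd). f (part1 z) * g (part2 z)"
    let ?G = "\<lambda>z. ?K (transpose M *v z)"
    let ?z = "M *v join x y"
    assume K: "schwartz ?K"
    have G: "schwartz ?G"
      by (rule schwartz_linear[OF K matrix_vector_mul_linear inj_matrix_vector_mult[OF Mt]])
    have kernel: "?G z * cis (- 2 * pi * (?z \<bullet> z)) = (\<lambda>v. ?K v * cis (- 2 * pi * (join x y \<bullet> v))) (transpose M *v z)" for z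
    proof -
      have "?z \<bullet> z = z \<bullet> ?z" by (rule inner_commute)
      also have "\<dots> = (transpose M *v z) \<bullet> join x y" by (rule inner_transpose[symmetric])
      also have "\<dots> = join x y \<bullet> (transpose M *v z)" by (rule inner_commute)
      finally show ?thesis by (simp only:)
    qed
    have "fst.pft ?G (join (part1 ?z) t) * cis (- 2 * pi * (part2 ?z \<bullet> t)) =
        (LINT s|lborel. ?G (join s t) * cis (- 2 * pi * (?z \<bullet> join s t)))" for t
    proof -
      have "cis (- 2 * pi * (?z \<bullet> join s t)) = cis (- 2 * pi * (part1 ?z \<bullet> s)) * cis (- 2 * pi * (part2 ?z \<bullet> t))" for s
        using inner_join[of "part1 ?z" "part2 ?z" s t] by (simp add: cis_mult algebra_simps)
      then show ?thesis by (simp add: fst_pft mult.assoc[symmetric])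
    qed
    then have "fourier2 (fst.pft ?G) ?z = (LINT t|lborel. LINT s|lborel. ?G (join s t) * cis (- 2 * pi * (?z \<bullet> join s t)))"
      by (simp add: fourier2_def fourier_def)
    also have "\<dots> = (LINT z|lborel. ?G z * cis (- 2 * pi * (?z \<bullet> z)))"
      by (rule integral_join[symmetric]) (rule integrable_fourier_kernel[OF G])
    also have "\<dots> = c * (LINT v|lborel. ?K v * cis (- 2 * pi * (join x y \<bullet> v)))"
      unfolding kernel
    proof (rule c(2))
      show "continuous_on UNIV (\<lambda>v. ?K v * cis (- 2 * pi * (join x y \<bullet> v)))"
        by (intro continuous_on_mult schwartz_continuous_on[OF K] continuous_intros)
      show "integrable lborel (\<lambda>z. ?K (transpose M *v z) * cis (- 2 * pi * (join x y \<bullet> (transpose M *v z))))"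
        using integrable_fourier_kernel[OF G, of ?z] unfolding kernel .
    qed (rule integrable_fourier_kernel[OF K])
    also have "(LINT v|lborel. ?K v * cis (- 2 * pi * (join x y \<bullet> v))) =
        (LINT t|lborel. LINT s|lborel. (g t * cis (- 2 * pi * (y \<bullet> t))) * (f s * cis (- 2 * pi * (x \<bullet> s))))"
    proof -
      have eq: "?K (join s t) * cis (- 2 * pi * (join x y \<bullet> join s t)) =
          (g t * cis (- 2 * pi * (y \<bullet> t))) * (f s * cis (- 2 * pi * (x \<bullet> s)))" for s t
      proof -
        have "cis (- 2 * pi * (join x y \<bullet> join s t)) = cis (- 2 * pi * (y \<bullet> t)) * cis (- 2 * pi * (x \<bullet> s))"
          by (simp add: inner_join cis_mult algebra_simps)
        then show ?thesis by simp
      qed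
      show ?thesis
        unfolding integral_join[OF integrable_fourier_kernel[OF K, of "join x y"]] eq ..
    qed
    also have "\<dots> = fourier f x * fourier g y"
      by (simp add: fourier_def mult.commute)
    finally show "fourier2 (fst.pft ?G) ?z = c * (fourier f x * fourier g y)" .
  qed
qed

lemma frequency_in_projection:
  fixes \<mu> \<nu> :: "(real^'d::finite) functional"
  assumes \<mu>: "tempered_distribution \<mu>" and \<nu>: "tempered_distribution \<nu>" and T: "invertible T"
    and cl: "closed (proj2 (dist_supp (matrix_wigner T \<mu> \<nu>)))"
    and p: "p \<in> dist_supp (fourier_distribution \<mu>)"
    and q: "q \<in> dist_supp (fourier_distribution (cnj_distribution \<nu>))"
  shows "part2 (transpose T *v join p q) \<in> proj2 (dist_supp (matrix_wigner T \<mu> \<nu>))"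
proof (rule ccontr)
  let ?W = "matrix_wigner T \<mu> \<nu>" and ?M = "matrix_inv T" and ?\<nu> = "cnj_distribution \<nu>"
  let ?\<Omega> = "\<lambda>p q. part2 (transpose T *v join p q)"
  assume "?\<Omega> p q \<notin> proj2 (dist_supp ?W)"
  then have "?\<Omega> p q \<in> - proj2 (dist_supp ?W)" by simp
  \<comment> \<open>A closed ball, because the closure of the support of \<open>\<phi>\<close> has
    to stay inside its preimage under \<open>part2\<close>. Closedness of the projection provides
    the ball.\<close>
  then obtain e where e: "e > 0" "cball (?\<Omega> p q) e \<subseteq> - proj2 (dist_supp ?W)"
    using cl open_contains_cball[of "- proj2 (dist_supp ?W)"] by blast
  have "continuous_on (UNIV :: ((real^'d) \<times> (real^'d)) set) (\<lambda>w. ?\<Omega> (fst w) (snd w))"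
    by (intro linear_continuous_on_compose[OF _ linear_part2] linear_continuous_on_compose[OF _ matrix_vector_mul_linear]
        continuous_intros)
  then have "open ((\<lambda>w. ?\<Omega> (fst w) (snd w)) -` ball (?\<Omega> p q) e)"
    by (intro open_vimage) auto
  moreover have "(p, q) \<in> (\<lambda>w. ?\<Omega> (fst w) (snd w)) -` ball (?\<Omega> p q) e" using e by simp
  ultimately obtain U V where UV: "open U" "open V" "p \<in> U" "q \<in> V"
      "U \<times> V \<subseteq> (\<lambda>w. ?\<Omega> (fst w) (snd w)) -` ball (?\<Omega> p q) e"
    by (elim open_prod_elim) auto
  obtain f where f: "test_function_on U f" "\<mu> (fourier f) \<noteq> 0"
    using p UV unfolding dist_supp_def fourier_distribution_def by blast
  obtain g where g: "test_function_on V g" "?\<nu> (fourier g) \<noteq> 0"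
    using q UV unfolding dist_supp_def fourier_distribution_def by blast
  have sf: "schwartz f" "schwartz g"
    using f g by (auto intro: compactly_supported_schwartz simp: test_function_on_def)
  have MT: "invertible ?M" "?M ** T = mat 1" "T ** ?M = mat 1"
    using matrix_inv_mult[OF T] by simp_all
  note K = schwartz_tensor[OF f(1) g(1)]
  \<comment> \<open>\<open>G z\<close> can be non-zero only if \<open>transpose ?M *v z\<close>
    corresponds to a point of \<open>U \<times> V\<close>, that is, if \<open>z\<close> is the image
    under \<open>transpose T\<close> of a point near \<open>join p q\<close>.\<close>
  define G where "G = (\<lambda>z. f (part1 (transpose ?M *v z)) * g (part2 (transpose ?M *v z)))"
  have Mt: "invertible (transpose ?M)" by (rule transpose_invertible[OF MT(1)])
  have G: "schwartz G"
    unfolding G_def by (rule schwartz_linear[OF K matrix_vector_mul_linear inj_matrix_vector_mult[OF Mt]])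
  have recover: "transpose T *v (transpose ?M *v z) = z" for z
    unfolding matrix_vector_mul_assoc matrix_transpose_mul[symmetric] MT(2) transpose_mat by simp
  define \<phi> where "\<phi> = fst.pft G"
  have \<phi>: "schwartz \<phi>"
    using fst.derivs_in_pft[of "\<lambda>_. 1" "\<lambda>_::unit. G"] G by (simp add: schwartz_iff_derivs_in \<phi>_def)
  \<comment> \<open>\<open>fst.pft\<close> integrates over the first variable with the second one
    fixed, so \<open>\<phi> z \<noteq> 0\<close> forces \<open>G\<close> to be non-zero at a point
    with the same second component.\<close>
  have supp: "part2 z \<in> cball (?\<Omega> p q) e" if "\<phi> z \<noteq> 0" for z
  proof (rule ccontr)
    assume far: "part2 z \<notin> cball (?\<Omega> p q) e"
    have "G (join t (part2 z)) = 0" for t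
    proof (rule ccontr)
      let ?w = "transpose ?M *v join t (part2 z)"
      assume "G (join t (part2 z)) \<noteq> 0"
      then have "f (part1 ?w) \<noteq> 0" "g (part2 ?w) \<noteq> 0" by (auto simp: G_def)
      then have "part1 ?w \<in> U" "part2 ?w \<in> V"
        using f(1) g(1) closure_subset[of "{x. f x \<noteq> 0}"] closure_subset[of "{x. g x \<noteq> 0}"]
        by (auto simp: test_function_on_def)
      then have "(part1 ?w, part2 ?w) \<in> U \<times> V" by simp
      then have "(part1 ?w, part2 ?w) \<in> (\<lambda>w. ?\<Omega> (fst w) (snd w)) -` ball (?\<Omega> p q) e"
        using UV(5) by (rule rev_subsetD)
      then have "?\<Omega> (part1 ?w) (part2 ?w) \<in> ball (?\<Omega> p q) e" by simp
      then have "part2 z \<in> ball (?\<Omega> p q) e" unfolding join_parts recover part2_join .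
      then show False using far by simp
    qed
    then have "\<phi> z = 0" by (simp add: \<phi>_def fst_pft)
    with that show False by simp
  qed
  have "closure {z. \<phi> z \<noteq> 0} \<subseteq> part2 -` cball (?\<Omega> p q) e"
  proof (rule closure_minimal)
    show "closed (part2 -` cball (?\<Omega> p q) e)"
      using linear_part2 by (intro closed_vimage closed_cball linear_continuous_on) (simp add: linear_conv_bounded_linear)
  qed (use supp in auto)
  moreover have "part2 z \<in> proj2 (dist_supp ?W)" if "z \<in> dist_supp ?W" for z
    using that unfolding proj2_def by (metis (mono_tags, lifting) join_parts mem_Collect_eq)
  ultimately have "closure {z. \<phi> z \<noteq> 0} \<inter> dist_supp ?W = {}"
    using e(2) by blast
  then have "?W \<phi> = 0"
    by (rule vanishes_off_support[OF schwartz_continuous_matrix_wigner[OF \<mu> \<nu> T] \<phi>])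
  moreover have "?W \<phi> = \<mu> (\<lambda>x. ?\<nu> (\<lambda>y. fourier2 \<phi> (?M *v join x y))) / complex_of_real \<bar>det T\<bar>"
    by (simp add: matrix_wigner_def fourier2_distribution_def pullback_distribution_def tensor_distribution_def)
  moreover have "det T \<noteq> 0" using T by (simp add: invertible_det_nz)
  ultimately have z: "\<mu> (\<lambda>x. ?\<nu> (\<lambda>y. fourier2 \<phi> (?M *v join x y))) = 0" by simp
  obtain c where c: "c \<noteq> 0" "\<And>f g x y. schwartz (\<lambda>z :: real^('d + 'd). f (part1 z) * g (part2 z)) \<Longrightarrow>
      fourier2 (fst.pft (\<lambda>z. f (part1 (transpose ?M *v z)) * g (part2 (transpose ?M *v z)))) (?M *v join x y) =
      c * (fourier f x * fourier g y)"
    using fourier2_pft_tensor[OF MT(1)] by blast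
  have "fourier2 \<phi> (?M *v join x y) = (c * fourier f x) * fourier g y" for x y
    using c(2)[OF K] by (simp add: \<phi>_def G_def)
  then have "\<mu> (\<lambda>x. ?\<nu> (\<lambda>y. (c * fourier f x) * fourier g y)) = 0" using z by simp
  then have "\<mu> (\<lambda>x. (c * fourier f x) * ?\<nu> (fourier g)) = 0"
    unfolding tempered_cmult[OF tempered_cnj[OF \<nu>] schwartz_fourier[OF sf(2)]] .
  then have "\<mu> (\<lambda>x. (c * ?\<nu> (fourier g)) * fourier f x) = 0"
    by (simp add: mult_ac)
  then have "(c * ?\<nu> (fourier g)) * \<mu> (fourier f) = 0"
    by (simp add: tempered_cmult[OF \<mu> schwartz_fourier[OF sf(1)]])
  then show False using f g c(1) by simp
qed

section \<open>From frequencies to uniformly discrete spectra\<close>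

lemma uniform_discrete_linear_preimage:
  fixes g :: "'a::euclidean_space \<Rightarrow> 'b::euclidean_space"
  assumes \<Lambda>: "uniform_discrete \<Lambda>" and g: "linear g" "inj g" and S: "\<And>x. x \<in> S \<Longrightarrow> c + g x \<in> \<Lambda>"
  shows "uniform_discrete S"
proof -
  obtain \<epsilon> where \<epsilon>: "\<epsilon> > 0" "\<And>x y. x \<in> \<Lambda> \<Longrightarrow> y \<in> \<Lambda> \<Longrightarrow> dist x y < \<epsilon> \<Longrightarrow> x = y"
    using \<Lambda> unfolding uniform_discrete_def by blast
  obtain B where B: "B > 0" "\<And>x. norm (g x) \<le> B * norm x"
    using linear_bounded_pos[OF g(1)] by blast
  \<comment> \<open>The Lipschitz constant \<open>B\<close> carries closeness from \<open>S\<close>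
    over to \<open>\<Lambda>\<close>; there it forces equal images, and injectivity gives equal
    points.\<close>
  have "x = y" if "x \<in> S" "y \<in> S" "dist x y < \<epsilon> / B" for x y
  proof -
    have "dist (c + g x) (c + g y) = norm (g (x - y))"
      by (simp add: dist_norm linear_diff[OF g(1)])
    also have "\<dots> \<le> B * norm (x - y)" by (rule B)
    also have "\<dots> < \<epsilon>" using that(3) B(1) by (simp add: dist_norm pos_less_divide_eq mult.commute)
    finally have "c + g x = c + g y" by (rule \<epsilon>(2)[OF S[OF that(1)] S[OF that(2)]])
    then show ?thesis using g(2) by (simp add: inj_eq)
  qed
  then show ?thesis using \<epsilon>(1) B(1) unfolding uniform_discrete_def by (intro exI[of _ "\<epsilon> / B"]) auto
qed

lemma linear_frequency_maps:
  fixes T :: "real^('d::finite + 'd)^('d + 'd)"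
  shows "linear (\<lambda>q. part2 (T *v join 0 q))" and "linear (\<lambda>p. part2 (T *v join p 0))"
  using linear_compose[OF linear_compose[OF linear_join_right matrix_vector_mul_linear] linear_part2]
    linear_compose[OF linear_compose[OF linear_join_left matrix_vector_mul_linear] linear_part2]
  by (simp_all add: o_def)

text \<open>If \<open>transpose T *v join 0 q\<close> has the form \<open>join u 0\<close>, pairing
  it with \<open>matrix_inv T *v join x 0\<close> gives \<open>u \<bullet> (A *v x)\<close>, which
  equals \<open>join 0 q \<bullet> join x 0 = 0\<close>. So \<open>u\<close> is orthogonal to the
  range of \<open>A\<close>. For \<open>B\<close> the same works with \<open>join p 0\<close> and
  \<open>join 0 y\<close>.\<close>

lemma inj_frequency_maps:
  fixes T :: "real^('d::finite + 'd)^('d + 'd)"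
  assumes T: "invertible T" and M: "matrix_inv T = block_matrix A B C D"
  shows "det A \<noteq> 0 \<Longrightarrow> inj (\<lambda>q. part2 (transpose T *v join 0 q))"
    and "det B \<noteq> 0 \<Longrightarrow> inj (\<lambda>p. part2 (transpose T *v join p 0))"
proof -
  let ?M = "matrix_inv T"
  have TM: "T ** ?M = mat 1" by (rule matrix_inv_mult[OF T])
  have adj: "part1 (transpose T *v v) \<bullet> part1 (?M *v w) = v \<bullet> w" if "part2 (transpose T *v v) = 0" for v w
  proof -
    have "(transpose T *v v) \<bullet> (?M *v w) = v \<bullet> (T *v (?M *v w))"
      by (rule inner_transpose)
    also have "\<dots> = v \<bullet> w" using TM by (simp add: matrix_vector_mul_assoc)
    finally have "join (part1 (transpose T *v v)) (part2 (transpose T *v v)) \<bullet>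
        join (part1 (?M *v w)) (part2 (?M *v w)) = v \<bullet> w" by simp
    then show ?thesis unfolding inner_join that by simp
  qed
  have zero: "s = 0" if N: "det N \<noteq> 0" and s: "\<And>x. s \<bullet> (N *v x) = 0" for s :: "real^'d" and N :: "real^'d^'d"
  proof -
    have "N ** matrix_inv N = mat 1" using N by (intro matrix_inv_mult) (simp add: invertible_det_nz)
    then have "N *v (matrix_inv N *v s) = s" by (simp add: matrix_vector_mul_assoc)
    then show ?thesis using s[of "matrix_inv N *v s"] by simp
  qed
  note lin = linear_frequency_maps[of "transpose T"]
  have v0: "v = 0" if "part1 (transpose T *v v) = 0" "part2 (transpose T *v v) = 0" for v
    using adj[OF that(2), of v] that(1) by simp
  show "inj (\<lambda>q. part2 (transpose T *v join 0 q))" if "det A \<noteq> 0"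
    unfolding linear_injective_0[OF lin(1)]
  proof (intro allI impI)
    fix q assume q: "part2 (transpose T *v join 0 q) = 0"
    have "part1 (transpose T *v join 0 q) \<bullet> (A *v x) = 0" for x
      using adj[OF q, of "join x 0"] by (simp add: M block_matrix_mult_join inner_join)
    then have "join 0 q = 0" using zero[OF that] v0[OF _ q] by blast
    then show "q = 0" using part2_join[of 0 q] by (simp add: part2_def vec_eq_iff)
  qed
  show "inj (\<lambda>p. part2 (transpose T *v join p 0))" if "det B \<noteq> 0"
    unfolding linear_injective_0[OF lin(2)]
  proof (intro allI impI)
    fix p assume p: "part2 (transpose T *v join p 0) = 0"
    have "part1 (transpose T *v join p 0) \<bullet> (B *v y) = 0" for y
      using adj[OF p, of "join 0 y"] by (simp add: M block_matrix_mult_join inner_join)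
    then have "join p 0 = 0" using zero[OF that] v0[OF _ p] by blast
    then show "p = 0" using part1_join[of p 0] by (simp add: part1_def vec_eq_iff)
  qed
qed

text \<open>Each implication has the non-vanishing of the other distribution as a premise: if one
  member of the pair is zero, the transform vanishes on all Schwartz functions and carries no
  information about the other member.\<close>

theorem proposition13:
  fixes \<mu> \<nu> :: "(real^'d::finite) functional"
    and T :: "real^('d + 'd)^('d + 'd)"
    and A B C D :: "real^'d^'d"
  assumes "tempered_distribution \<mu>" and "tempered_distribution \<nu>"
    and "uniform_discrete (proj2 (dist_supp (matrix_wigner T \<mu> \<nu>)))"
    and "invertible T"
    and "matrix_inv T = block_matrix A B C D"
  shows "(\<not> zero_distribution \<mu> \<longrightarrow> det A \<noteq> 0 \<longrightarrow>
            uniform_discrete (dist_supp (fourier_distribution \<nu>))) \<and>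
         (\<not> zero_distribution \<nu> \<longrightarrow> det B \<noteq> 0 \<longrightarrow>
            uniform_discrete (dist_supp (fourier_distribution \<mu>)))"
proof -
  let ?\<Omega> = "\<lambda>p q. part2 (transpose T *v join p q)"
  note in_proj = frequency_in_projection[OF assms(1,2,4) uniform_discrete_imp_closed[OF assms(3)]]
  have split: "?\<Omega> p q = ?\<Omega> p 0 + ?\<Omega> 0 q" for p q
  proof -
    have "transpose T *v join p q = transpose T *v join p 0 + transpose T *v join 0 q"
      unfolding matrix_vector_right_distrib[symmetric] join_add by simp
    then show ?thesis by (simp add: linear_add[OF linear_part2])
  qed
  note lin = linear_frequency_maps[of "transpose T"]
  show ?thesis
  proof (intro conjI impI)
    assume "\<not> zero_distribution \<mu>" and A: "det A \<noteq> 0"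
    then obtain p where p: "p \<in> dist_supp (fourier_distribution \<mu>)"
      using fourier_support_nonempty[OF assms(1)] by blast
    \<comment> \<open>The sign accounts for the reflection between the spectra of
      \<open>\<nu>\<close> and \<open>cnj_distribution \<nu>\<close>.\<close>
    have "linear (\<lambda>q. ?\<Omega> 0 (- q))" "inj (\<lambda>q. ?\<Omega> 0 (- q))"
      using linear_compose[OF linear_uminus lin(1)] inj_compose[OF inj_frequency_maps(1)[OF assms(4,5) A] inj_uminus]
      by (simp_all add: o_def)
    moreover have "?\<Omega> p 0 + ?\<Omega> 0 (- q) \<in> proj2 (dist_supp (matrix_wigner T \<mu> \<nu>))"
      if "q \<in> dist_supp (fourier_distribution \<nu>)" for q
      using in_proj[OF p fourier_support_cnj[OF that]] unfolding split[of p "- q"] .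
    ultimately show "uniform_discrete (dist_supp (fourier_distribution \<nu>))"
      by (rule uniform_discrete_linear_preimage[OF assms(3)])
  next
    assume "\<not> zero_distribution \<nu>" and B: "det B \<noteq> 0"
    then obtain q where q: "- q \<in> dist_supp (fourier_distribution (cnj_distribution \<nu>))"
      using fourier_support_nonempty[OF assms(2)] fourier_support_cnj by blast
    have "?\<Omega> 0 (- q) + ?\<Omega> p 0 \<in> proj2 (dist_supp (matrix_wigner T \<mu> \<nu>))"
      if "p \<in> dist_supp (fourier_distribution \<mu>)" for p
      using in_proj[OF that q] unfolding split[of p "- q"] by (simp only: add.commute)
    then show "uniform_discrete (dist_supp (fourier_distribution \<mu>))"
      by (rule uniform_discrete_linear_preimage[OF assms(3) lin(2) inj_frequency_maps(2)[OF assms(4,5) B]])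
  qed
qed

end
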